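(* Let $\mathcal A\in\{\mathfrak S,\mathcal B,\mathcal Bs,\mathcal H,\mathcal P\}$. For any integer $N$, let $(M_i^N)_{i\in\mathcal I}$ be a family of random matrices of size $N$. The family $(M_i^N)_{i\in\mathcal I}$ converges in $\mathcal A$-distribution if and only if one of the following assertions is valid: (1) for any $k$, any $(i_1,\dots,i_k)\in\mathcal I^k$ and any $p\in\mathcal A_k$, the finite-dimensional cumulant $\mathbb E\kappa^{\mathcal A}_p(M_{i_1}^N,\dots,M_{i_k}^N)$ converges as $N\to\infty$; (2) for any $k$, any $(i_1,\dots,i_k)\in\mathcal I^k$ and any $p\in\mathcal P_k$, the finite-dimensional exclusive moment $\mathbb Em^{\mathcal A}_{p^c}(M_{i_1}^N,\dots,M_{i_k}^N)$ converges as $N\to\infty$. If it does, then for any $k$ and any $(i_1,\dots,i_k)\in\mathcal I^k$: for any $p\in\mathcal A_k$, $$\mathbb E\kappa_p^{\mathcal A}(M_{i_1},\dots,M_{i_k})=\lim_{N\to\infty}\mathbb E\kappa_p^{\mathcal A}(M^N_{i_1},\dots,M^N_{i_k}),$$ and for any $p\in\mathcal P_k$, $$\mathbb Em_{p^c}^{\mathcal A}(M_{i_1},\dots,M_{i_k})=\lim_{N\to\infty}\mathbb Em_{p^c}^{\mathcal A}(M^N_{i_1},\dots,M^N_{i_k}),$$ where the left-hand sides are respectively the asymptotic $p$-$\mathcal A$-cumulant and the asymptotic $p$-$\mathcal A$-exclusive moment.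
   Context: Partitions. For $k\ge 0$, $\mathcal P_k$ is the set of partitions of $\{1,\dots,k,1',\dots,k'\}$. $\mathrm{nc}(p)$ is the number of blocks of $p$; $p\vee p'$ is the finest partition coarser than both; $\mathrm{id}_k=\{\{i,i'\}\}$; ${}^tp$ is obtained by exchanging $i$ and $i'$ for every $i$; $p\trianglelefteq p'$ means $p'$ is coarser than $p$. A permutation $\sigma\in\mathfrak S_k$ is identified with $\{\{i,\sigma(i)'\}\}\in\mathcal P_k$. $\mathcal B_k$, $\mathcal H_k$, $\mathcal Bs_k$ are the sets of $p\in\mathcal P_k$ whose blocks all have size $2$, all have even size, all have size at most $2$ respectively. Set $d(p,p')=\frac{\mathrm{nc}(p)+\mathrm{nc}(p')}{2}-\mathrm{nc}(p\vee p')$ and $p\le p'$ if $d(\mathrm{id}_k,p)+d(p,p')=d(\mathrm{id}_k,p')$ (a partial order). Write $p'\sqsupset p$ if $p'$ is finer than $p$ and $\mathrm{nc}(p')-\mathrm{nc}(p'\vee\mathrm{id}_k)=\mathrm{nc}(p)-\mathrm{nc}(p\vee\mathrm{id}_k)$. Representation. $E_i^j$ is the $N\times N$ matrix sending $e_j$ to $e_i$ and the other basis vectors to $0$. For $I=(i_1,\dots,i_k,i_{1'},\dots,i_{k'})\in\{1,\dots,N\}^{2k}$, $\mathrm{Ker}(I)\in\mathcal P_k$ is the partition where $a,b$ are in the same block iff $i_a=i_b$. $\rho_N(p)=\sum_{I:\,p\trianglelefteq\mathrm{Ker}(I)}E_{i_{1'}}^{i_1}\otimes\dots\otimes E_{i_{k'}}^{i_k}$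 and $\rho_N(p^c)=\sum_{I:\,\mathrm{Ker}(I)=p}E_{i_{1'}}^{i_1}\otimes\dots\otimes E_{i_{k'}}^{i_k}$, in $\mathrm{End}((\mathbb C^N)^{\otimes k})$; ${}^tp^c$ means $({}^tp)^c$. Groups. $\mathcal G(\mathfrak S)(N)=U(N)$, $\mathcal G(\mathcal B)(N)=O(N)$, $\mathcal G(\mathcal H)(N)$ = signed permutation matrices, $\mathcal G(\mathcal Bs)(N)$ = orthogonal matrices whose rows and columns all sum to $1$, $\mathcal G(\mathcal P)(N)$ = permutation matrices. Random matrices have entries with finite moments of all orders. Mean moments: $\mathbb Em_p(M_1,\dots,M_k)=N^{-\mathrm{nc}(p\vee\mathrm{id}_k)}\mathbb E\,\mathrm{Tr}\big[(M_1\otimes\dots\otimes M_k)\rho_N({}^tp)\big]$. The family $(M_i^N)_{i\in\mathcal I}$ converges in $\mathcal A$-distribution if $\mathbb Em_p(M_{i_1}^N,\dots,M^N_{i_k})$ converges (as $N\to\infty$) for all $k$, $p\in\mathcal A_k$, $(i_1,\dots,i_k)\in\mathcal I^k$; the limit is $\mathbb Em_p(M_{i_1},\dots,M_{i_k})$. Asymptotic $\mathcal A$-cumulants are then defined by $\mathbb Em_p(M_{i_1},\dots,M_{i_k})=\sum_{p'\in\mathcal A_k,p'\le p}\mathbb E\kappa_{p'}^{\mathcal A}(M_{i_1},\dots,M_{i_k})$ for all $p\in\mathcal A_k$, and asymptotic $\mathcal A$-exclusive moments by $\mathbb Em^{\mathcal A}_{p^c}(M_{i_1},\dots,M_{i_k})=\sum_{p'\in\mathcal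 A_k,p'\sqsupset p}\mathbb E\kappa^{\mathcal A}_{p'}(M_{i_1},\dots,M_{i_k})$ for $p\in\mathcal P_k$. Finite-dimensional quantities (always considered for $N\ge2k$). Let $E=\int_{\mathcal G(\mathcal A)(N)}g^{\otimes k}\,\mathbb E[M_{i_1}^N\otimes\dots\otimes M_{i_k}^N]\,(g^{-1})^{\otimes k}dg$ (Haar probability measure). By Schur–Weyl type duality $E$ is in the span of the $\rho_N(p)$, $p\in\mathcal A_k$, which are linearly independent for $N\ge 2k$. The finite-dimensional $\mathcal A$-cumulants are the unique numbers with $E=\sum_{p\in\mathcal A_k}\mathbb E\kappa_p^{\mathcal A}(M^N_{i_1},\dots,M_{i_k}^N)\,N^{\mathrm{nc}(p\vee\mathrm{id}_k)-\mathrm{nc}(p)}\rho_N(p)$, and for $p\in\mathcal P_k$, $\mathbb Em^{\mathcal A}_{p^c}(M^N_{i_1},\dots,M^N_{i_k})=N^{-\mathrm{nc}(p\vee\mathrm{id}_k)}\mathrm{Tr}[E\,\rho_N({}^tp^c)]$. *)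

theory Defs
  imports
    "HOL-Probability.Probability"
    "HOL-Library.Disjoint_Sets"
    "HOL-Combinatorics.Permutations"
    "Jordan_Normal_Form.Schur_Decomposition"
    "Jordan_Normal_Form.Gauss_Jordan_Elimination"
begin

section \<open>Partitions\<close>

text \<open>
  Indices are shifted to start at 0: the point \<open>i\<close> is \<open>Inl (i - 1)\<close> and the point \<open>i'\<close> is
  \<open>Inr (i - 1)\<close>.
\<close>

type_synonym point = "nat + nat"
type_synonym ptn = "point set set"

definition points :: "nat \<Rightarrow> point set" where
  "points k = {..<k} <+> {..<k}"

definition partitions :: "nat \<Rightarrow> ptn set" where
  "partitions k = {p. partition_on (points k) p}"

definition nc :: "ptn \<Rightarrow> nat" where
  "nc p = card p"

definition coarser :: "nat \<Rightarrow> ptn \<Rightarrow> ptn \<Rightarrow> bool" where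
  "coarser k p p' \<longleftrightarrow> refines (points k) p p'"

definition pjoin :: "nat \<Rightarrow> ptn \<Rightarrow> ptn \<Rightarrow> ptn" where
  "pjoin k p p' = (THE q. coarser k p q \<and> coarser k p' q \<and>
     (\<forall>r. coarser k p r \<and> coarser k p' r \<longrightarrow> coarser k q r))"

definition perm_ptn :: "nat \<Rightarrow> (nat \<Rightarrow> nat) \<Rightarrow> ptn" where
  "perm_ptn k \<sigma> = {{Inl i, Inr (\<sigma> i)} | i. i < k}"

definition id_ptn :: "nat \<Rightarrow> ptn" where
  "id_ptn k = {{Inl i, Inr i} | i. i < k}"

definition ptn_transpose :: "ptn \<Rightarrow> ptn" where
  "ptn_transpose p = (\<lambda>b. case_sum Inr Inl ` b) ` p"

datatype ptn_class = Class_S | Class_B | Class_Bs | Class_H | Class_P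

fun class_ptns :: "ptn_class \<Rightarrow> nat \<Rightarrow> ptn set" where
  "class_ptns Class_S k = {perm_ptn k \<sigma> | \<sigma>. \<sigma> permutes {..<k}}"
| "class_ptns Class_B k = {p \<in> partitions k. \<forall>b\<in>p. card b = 2}"
| "class_ptns Class_Bs k = {p \<in> partitions k. \<forall>b\<in>p. card b \<le> 2}"
| "class_ptns Class_H k = {p \<in> partitions k. \<forall>b\<in>p. even (card b)}"
| "class_ptns Class_P k = partitions k"

definition ptn_dist :: "nat \<Rightarrow> ptn \<Rightarrow> ptn \<Rightarrow> real" where
  "ptn_dist k p p' = (real (nc p) + real (nc p')) / 2 - real (nc (pjoin k p p'))"

definition ptn_le :: "nat \<Rightarrow> ptn \<Rightarrow> ptn \<Rightarrow> bool" where
  "ptn_le k p p' \<longleftrightarrow>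
     ptn_dist k (id_ptn k) p + ptn_dist k p p' = ptn_dist k (id_ptn k) p'"

text \<open>\<open>ptn_sqsup k p' p\<close> is \<open>p' \<sqsupset> p\<close>; in it \<open>p'\<close> is the finer partition.\<close>

definition ptn_sqsup :: "nat \<Rightarrow> ptn \<Rightarrow> ptn \<Rightarrow> bool" where
  "ptn_sqsup k p' p \<longleftrightarrow> coarser k p' p \<and>
     int (nc p') - int (nc (pjoin k p' (id_ptn k))) = int (nc p) - int (nc (pjoin k p (id_ptn k)))"


section \<open>Operators on tensor powers\<close>

text \<open>
  An endomorphism of the \<open>k\<close>-th tensor power of \<open>\<complex>\<^sup>N\<close> is given by its matrix in the basis
  \<open>e\<^bsub>r 0\<^esub> \<otimes> \<dots> \<otimes> e\<^bsub>r (k - 1)\<^esub>\<close>, \<open>r \<in> multi_index N k\<close>; the first argument is the row.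
  Only the values on \<open>multi_index N k\<close> carry meaning.
\<close>

type_synonym tensor_op = "(nat \<Rightarrow> nat) \<Rightarrow> (nat \<Rightarrow> nat) \<Rightarrow> complex"

definition multi_index :: "nat \<Rightarrow> nat \<Rightarrow> (nat \<Rightarrow> nat) set" where
  "multi_index N k = {..<k} \<rightarrow>\<^sub>E {..<N}"

definition tensor :: "complex mat list \<Rightarrow> tensor_op" where
  "tensor As = (\<lambda>r c. \<Prod>l<length As. (As ! l) $$ (r l, c l))"

definition op_mult :: "nat \<Rightarrow> nat \<Rightarrow> tensor_op \<Rightarrow> tensor_op \<Rightarrow> tensor_op" where
  "op_mult N k S T = (\<lambda>r c. \<Sum>s\<in>multi_index N k. S r s * T s c)"

definition op_trace :: "nat \<Rightarrow> nat \<Rightarrow> tensor_op \<Rightarrow> complex" where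
  "op_trace N k T = (\<Sum>r\<in>multi_index N k. T r r)"

text \<open>\<open>elem_mat N i j\<close> maps \<open>e\<^sub>j\<close> to \<open>e\<^sub>i\<close>.\<close>

definition elem_mat :: "nat \<Rightarrow> nat \<Rightarrow> nat \<Rightarrow> complex mat" where
  "elem_mat N i j = Matrix.mat N N (\<lambda>(a, b). if a = i \<and> b = j then 1 else 0)"

definition double_index :: "nat \<Rightarrow> nat \<Rightarrow> (point \<Rightarrow> nat) set" where
  "double_index N k = points k \<rightarrow>\<^sub>E {..<N}"

definition Ker :: "nat \<Rightarrow> (point \<Rightarrow> nat) \<Rightarrow> ptn" where
  "Ker k I = {{b \<in> points k. I b = I a} | a. a \<in> points k}"

definition elem_tensor :: "nat \<Rightarrow> nat \<Rightarrow> (point \<Rightarrow> nat) \<Rightarrow> tensor_op" where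
  "elem_tensor N k I = tensor (map (\<lambda>l. elem_mat N (I (Inr l)) (I (Inl l))) [0..<k])"

definition rho :: "nat \<Rightarrow> nat \<Rightarrow> ptn \<Rightarrow> tensor_op" where
  "rho N k p = (\<lambda>r c. \<Sum>I | I \<in> double_index N k \<and> coarser k p (Ker k I). elem_tensor N k I r c)"

definition rho_excl :: "nat \<Rightarrow> nat \<Rightarrow> ptn \<Rightarrow> tensor_op" where
  "rho_excl N k p = (\<lambda>r c. \<Sum>I | I \<in> double_index N k \<and> Ker k I = p. elem_tensor N k I r c)"


section \<open>Matrix groups and Haar measure\<close>

definition orthogonal_group :: "nat \<Rightarrow> complex mat set" where
  "orthogonal_group N = {g \<in> carrier_mat N N.
     (\<forall>i<N. \<forall>j<N. g $$ (i, j) \<in> \<real>) \<and> g * transpose_mat g = 1\<^sub>m N}"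

fun class_group :: "ptn_class \<Rightarrow> nat \<Rightarrow> complex mat set" where
  "class_group Class_S N = {g \<in> carrier_mat N N. g * mat_adjoint g = 1\<^sub>m N}"
| "class_group Class_B N = orthogonal_group N"
| "class_group Class_Bs N = {g \<in> orthogonal_group N.
     (\<forall>i<N. (\<Sum>j<N. g $$ (i, j)) = 1) \<and> (\<forall>j<N. (\<Sum>i<N. g $$ (i, j)) = 1)}"
| "class_group Class_H N =
     {Matrix.mat N N (\<lambda>(i, j). if i = \<sigma> j then \<epsilon> j else 0) | \<sigma> \<epsilon>.
        \<sigma> permutes {..<N} \<and> (\<forall>j<N. \<epsilon> j \<in> {1, -1})}"
| "class_group Class_P N =
     {Matrix.mat N N (\<lambda>(i, j). if i = \<sigma> j then 1 else 0) | \<sigma>. \<sigma> permutes {..<N}}"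

text \<open>The Borel sigma-algebra of the space of complex matrices of size \<open>N\<close>: the topology is that of
  \<open>N\<^sup>2\<close> complex coordinates and is second countable, so the coordinates generate.\<close>

definition borel_mat :: "nat \<Rightarrow> complex mat measure" where
  "borel_mat N = sigma (carrier_mat N N)
     {{A \<in> carrier_mat N N. A $$ (i, j) \<in> S} | i j S. i < N \<and> j < N \<and> open S}"

definition haar_prob :: "nat \<Rightarrow> complex mat set \<Rightarrow> complex mat measure \<Rightarrow> bool" where
  "haar_prob N G \<mu> \<longleftrightarrow>
     prob_space \<mu> \<and> space \<mu> = G \<and> sets \<mu> = sets (restrict_space (borel_mat N) G) \<and>
     (\<forall>g\<in>G. distr \<mu> \<mu> (\<lambda>h. g * h) = \<mu>)"


section \<open>Random matrices, moments and cumulants\<close>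

definition random_matrix :: "'w measure \<Rightarrow> nat \<Rightarrow> ('w \<Rightarrow> complex mat) \<Rightarrow> bool" where
  "random_matrix P N X \<longleftrightarrow> X \<in> measurable P (borel_mat N) \<and>
     (\<forall>i<N. \<forall>j<N. \<forall>n::nat. integrable P (\<lambda>w. norm (X w $$ (i, j)) ^ n))"

definition mean_moment :: "'w measure \<Rightarrow> nat \<Rightarrow> ('w \<Rightarrow> complex mat) list \<Rightarrow> ptn \<Rightarrow> complex" where
  "mean_moment P N Xs p = (let k = length Xs in
     of_nat N powi (- int (nc (pjoin k p (id_ptn k)))) *
     (LINT w|P. op_trace N k (op_mult N k (tensor (map (\<lambda>X. X w) Xs)) (rho N k (ptn_transpose p)))))"

definition mean_tensor :: "'w measure \<Rightarrow> ('w \<Rightarrow> complex mat) list \<Rightarrow> tensor_op" where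
  "mean_tensor P Xs = (\<lambda>r c. LINT w|P. tensor (map (\<lambda>X. X w) Xs) r c)"

definition haar_average :: "complex mat measure \<Rightarrow> nat \<Rightarrow> nat \<Rightarrow> tensor_op \<Rightarrow> tensor_op" where
  "haar_average \<mu> N k T = (\<lambda>r c. LINT g|\<mu>.
     op_mult N k (op_mult N k (tensor (replicate k g)) T)
       (tensor (replicate k (the (mat_inverse g)))) r c)"

text \<open>Uniqueness of the coefficients is only guaranteed for \<open>N \<ge> 2 * k\<close>; the value for smaller
  \<open>N\<close> has no meaning. Outside \<open>class_ptns A k\<close> the coefficients are set to 0.\<close>

definition fin_cumulant ::
  "ptn_class \<Rightarrow> complex mat measure \<Rightarrow> 'w measure \<Rightarrow> nat \<Rightarrow> ('w \<Rightarrow> complex mat) list \<Rightarrow> ptn \<Rightarrow> complex"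
where
  "fin_cumulant A \<mu> P N Xs = (let k = length Xs in
     (THE \<kappa>. (\<forall>p. p \<notin> class_ptns A k \<longrightarrow> \<kappa> p = 0) \<and>
        (\<forall>r\<in>multi_index N k. \<forall>c\<in>multi_index N k.
           haar_average \<mu> N k (mean_tensor P Xs) r c =
           (\<Sum>p\<in>class_ptns A k.
              \<kappa> p * of_nat N powi (int (nc (pjoin k p (id_ptn k))) - int (nc p)) * rho N k p r c))))"

definition fin_excl_moment ::
  "complex mat measure \<Rightarrow> 'w measure \<Rightarrow> nat \<Rightarrow> ('w \<Rightarrow> complex mat) list \<Rightarrow> ptn \<Rightarrow> complex"
where
  "fin_excl_moment \<mu> P N Xs p = (let k = length Xs in
     of_nat N powi (- int (nc (pjoin k p (id_ptn k)))) *
     op_trace N k (op_mult N k (haar_average \<mu> N k (mean_tensor P Xs)) (rho_excl N k (ptn_transpose p))))"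

definition converges_in_distribution ::
  "ptn_class \<Rightarrow> (nat \<Rightarrow> 'w measure) \<Rightarrow> (nat \<Rightarrow> 'i \<Rightarrow> 'w \<Rightarrow> complex mat) \<Rightarrow> bool"
where
  "converges_in_distribution A P M \<longleftrightarrow>
     (\<forall>is. \<forall>p\<in>class_ptns A (length is).
        convergent (\<lambda>N. mean_moment (P N) N (map (M N) is) p))"

definition lim_moment ::
  "(nat \<Rightarrow> 'w measure) \<Rightarrow> (nat \<Rightarrow> 'i \<Rightarrow> 'w \<Rightarrow> complex mat) \<Rightarrow> 'i list \<Rightarrow> ptn \<Rightarrow> complex"
where
  "lim_moment P M is p = lim (\<lambda>N. mean_moment (P N) N (map (M N) is) p)"

definition asym_cumulant ::
  "ptn_class \<Rightarrow> (nat \<Rightarrow> 'w measure) \<Rightarrow> (nat \<Rightarrow> 'i \<Rightarrow> 'w \<Rightarrow> complex mat) \<Rightarrow> 'i list \<Rightarrow> ptn \<Rightarrow> complex"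
where
  "asym_cumulant A P M is = (let k = length is in
     (THE \<kappa>. (\<forall>p. p \<notin> class_ptns A k \<longrightarrow> \<kappa> p = 0) \<and>
        (\<forall>p\<in>class_ptns A k.
           lim_moment P M is p = (\<Sum>p' | p' \<in> class_ptns A k \<and> ptn_le k p' p. \<kappa> p'))))"

definition asym_excl_moment ::
  "ptn_class \<Rightarrow> (nat \<Rightarrow> 'w measure) \<Rightarrow> (nat \<Rightarrow> 'i \<Rightarrow> 'w \<Rightarrow> complex mat) \<Rightarrow> 'i list \<Rightarrow> ptn \<Rightarrow> complex"
where
  "asym_excl_moment A P M is p = (let k = length is in
     \<Sum>p' | p' \<in> class_ptns A k \<and> ptn_sqsup k p' p. asym_cumulant A P M is p')"

end

theory Submission
  imports Defs
begin

text \<open>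
  Conjugating by a group element acts on the expected tensor product of the matrices, and the Haar
  average \<open>E\<close> is the projection onto the invariant operators. Everything rests on writing \<open>E\<close> as a
  combination of the operators \<open>rho N k p\<close> with \<open>p\<close> in the class, normalized so that the coefficients are
  the finite-dimensional cumulants.

  Once this expansion is available, the theorem is linear algebra in a fixed finite dimension with
  coefficients depending on \<open>N\<close>. Pairing \<open>E\<close> with \<open>rho N k p\<close> yields the mean moments as
  \<open>m\<^sub>p = (\<Sum>q. N powi (- defect q p) * \<kappa>\<^sub>q)\<close>, where \<open>defect q p\<close> is the excess in the triangle inequality for
  the path from the identity through \<open>q\<close> to \<open>p\<close> (\<open>mean_moment_expansion\<close>). The excess is non-negative
  because the lattice of partitions is semimodular (\<open>nc_semimodular\<close>), and zero exactly when \<open>q \<le> p\<close>. The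
  coefficient matrix thus tends to the incidence matrix of a partial order, which is unitriangular;
  for a matrix that converges to a unitriangular one, convergence of the right-hand sides is equivalent
  to convergence of the solutions, and the limits solve the limit system
  (\<open>unitriangular_perturbation_tendsto\<close>). That system defines the asymptotic cumulants. For the
  exclusive moments only the partitions \<open>q\<close> finer than \<open>p\<close> contribute, with the same powers of \<open>N\<close> up to a
  factor tending to 1 (\<open>fin_excl_moment_expansion\<close>, \<open>card_Ker_asymp\<close>), so the limit matrix is that of
  \<open>\<sqsupset>\<close>; restricted to \<open>p\<close> in the class it is unitriangular as well, for refinement. The injectivity of the
  moment matrix for large \<open>N\<close> also shows that the cumulants are well defined.

  The expansion of \<open>E\<close> is the analogue of Schur-Weyl duality for the five groups
  (\<open>invariant_vec_spanned\<close>), proved for \<open>N \<ge> 2 * k + 2\<close> by a direct argument. Seen as a tensor with \<open>2 * k\<close>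
  indices, an invariant operator has coefficients that depend only on the kernel of the multi-index,
  because all five groups contain the permutation matrices. After subtracting a combination of the
  \<open>rho N k p\<close> its coefficients vanish on all kernels in the class, and it remains to see that
  such an invariant tensor is zero (\<open>invariant_vec_eq_0\<close>). Diagonal signs and phases annihilate the
  coefficients whose kernel has an odd block or, in the unitary case, a pair on one side. A block of at
  least three points is split by an infinitesimal rotation in the direction of a fresh basis vector:
  this expresses the coefficient through coefficients of multi-indices with more distinct values
  (\<open>infinitesimal_reduction\<close>), and an induction on the number of values concludes.
\<close>

section \<open>Unitriangular systems, their perturbations, and indicator sums\<close>

text \<open>
  Equations are solved in the order of increasing rank: apart from its own unknown, an equation only
  involves unknowns of lower rank, so a new equation of maximal rank does not disturb those already
  solved.
\<close>

lemma unitriangular_solvable: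
  fixes G :: "'p \<Rightarrow> 'p \<Rightarrow> complex" and r :: "'p \<Rightarrow> 'r :: linorder"
  assumes "finite S"
    and "\<And>p. p \<in> S \<Longrightarrow> G p p = 1"
    and "\<And>p q. p \<in> S \<Longrightarrow> q \<in> S \<Longrightarrow> q \<noteq> p \<Longrightarrow> G p q \<noteq> 0 \<Longrightarrow> r q < r p"
  shows "\<exists>\<kappa>. \<forall>p\<in>S. (\<Sum>q\<in>S. G p q * \<kappa> q) = m p"
  using assms
proof (induction S rule: finite_ranking_induct[where f = r])
  case empty
  then show ?case by simp
next
  case (insert x S)
  show ?case
  proof (cases "x \<in> S")
    case True
    with insert show ?thesis by (simp add: insert_absorb)
  next
    case False
    obtain \<kappa> where \<kappa>: "\<forall>p\<in>S. (\<Sum>q\<in>S. G p q * \<kappa> q) = m p"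
      using insert by auto
    define \<kappa>' where "\<kappa>' = \<kappa>(x := m x - (\<Sum>q\<in>S. G x q * \<kappa> q))"
    have sumS: "(\<Sum>q\<in>S. G p q * \<kappa>' q) = (\<Sum>q\<in>S. G p q * \<kappa> q)" for p
      using False by (intro sum.cong) (auto simp: \<kappa>'_def)
    have "G p x = 0" if "p \<in> S" for p
      using insert.prems(2)[of p x] insert.hyps(2)[of p] that False by fastforce
    then have "\<forall>p\<in>insert x S. (\<Sum>q\<in>insert x S. G p q * \<kappa>' q) = m p"
      using \<kappa> insert.hyps(1) False insert.prems(1)[of x] sumS by (simp add: \<kappa>'_def)
    then show ?thesis by blast
  qed
qed

text \<open>
  The transposed matrix is unitriangular for the opposite ranking, so each row of the inverse solves
  a transposed system.
\<close>

lemma unitriangular_left_inverse: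
  fixes G :: "'p \<Rightarrow> 'p \<Rightarrow> complex" and r :: "'p \<Rightarrow> real"
  assumes S: "finite S"
    and G1: "\<And>p. p \<in> S \<Longrightarrow> G p p = 1"
    and G0: "\<And>p q. p \<in> S \<Longrightarrow> q \<in> S \<Longrightarrow> q \<noteq> p \<Longrightarrow> G p q \<noteq> 0 \<Longrightarrow> r q < r p"
  obtains H where "\<And>q q'. q \<in> S \<Longrightarrow> q' \<in> S \<Longrightarrow> (\<Sum>p\<in>S. H q p * G p q') = (if q = q' then 1 else 0)"
proof -
  have "\<exists>h. \<forall>q'\<in>S. (\<Sum>p\<in>S. G p q' * h p) = (if q = q' then 1 else 0)" for q
    by (rule unitriangular_solvable[where r = "\<lambda>p. - r p"])
       (use S G1 G0 in \<open>auto\<close>)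
  then obtain H where "\<forall>q. \<forall>q'\<in>S. (\<Sum>p\<in>S. G p q' * H q p) = (if q = q' then 1 else 0)"
    by metis
  then show ?thesis
    by (intro that[of H]) (simp add: mult.commute)
qed

text \<open>
  With a left inverse \<open>H\<close> of the limit, \<open>\<kappa> = H (GN \<kappa>) - H ((GN - G) \<kappa>)\<close>, and the second term is
  absorbed into the left-hand side once \<open>GN - G\<close> is small compared with \<open>H\<close>. The bound is uniform in
  \<open>\<kappa>\<close>: it gives the injectivity of \<open>GN\<close> for large \<open>N\<close> and, applied to differences, the convergence of
  solutions.
\<close>

lemma unitriangular_perturbation_bound:
  fixes G :: "'p \<Rightarrow> 'p \<Rightarrow> complex" and r :: "'p \<Rightarrow> real"
    and GN :: "nat \<Rightarrow> 'p \<Rightarrow> 'p \<Rightarrow> complex"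
  assumes S: "finite S"
    and G1: "\<And>p. p \<in> S \<Longrightarrow> G p p = 1"
    and G0: "\<And>p q. p \<in> S \<Longrightarrow> q \<in> S \<Longrightarrow> q \<noteq> p \<Longrightarrow> G p q \<noteq> 0 \<Longrightarrow> r q < r p"
    and lim: "\<And>p q. p \<in> S \<Longrightarrow> q \<in> S \<Longrightarrow> (\<lambda>N. GN N p q) \<longlonglongrightarrow> G p q"
  obtains C where "C \<ge> 0"
    "\<forall>\<^sub>F N in sequentially. \<forall>\<kappa>. (\<Sum>q\<in>S. norm (\<kappa> q)) \<le> C * (\<Sum>p\<in>S. norm (\<Sum>q\<in>S. GN N p q * \<kappa> q))"
proof -
  obtain H where H: "\<And>q q'. q \<in> S \<Longrightarrow> q' \<in> S \<Longrightarrow> (\<Sum>p\<in>S. H q p * G p q') = (if q = q' then 1 else 0)"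
    using unitriangular_left_inverse[of S G r] S G1 G0 by blast
  define D where "D = (\<Sum>q\<in>S. \<Sum>p\<in>S. norm (H q p))"
  have D0: "D \<ge> 0" unfolding D_def by (intro sum_nonneg) auto
  define E where "E N = (\<Sum>p\<in>S. \<Sum>q\<in>S. norm (GN N p q - G p q))" for N
  have "E \<longlonglongrightarrow> (\<Sum>p\<in>S. \<Sum>q\<in>S. norm (G p q - G p q))"
    unfolding E_def by (intro tendsto_intros lim)
  then have "(\<lambda>N. D * E N) \<longlonglongrightarrow> D * 0"
    by (intro tendsto_intros) simp
  then have ev: "\<forall>\<^sub>F N in sequentially. D * E N < 1/2"
    by (intro order_tendstoD(2)[where y = "D * 0"]) auto
  have "\<forall>\<^sub>F N in sequentially. \<forall>\<kappa>. (\<Sum>q\<in>S. norm (\<kappa> q)) \<le> 2 * D * (\<Sum>p\<in>S. norm (\<Sum>q\<in>S. GN N p q * \<kappa> q))"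
    using ev
  proof eventually_elim
    case (elim N)
    show ?case
    proof
      fix \<kappa> :: "'p \<Rightarrow> complex"
      define s where "s = (\<Sum>q\<in>S. norm (\<kappa> q))"
      define n where "n p = (\<Sum>q\<in>S. GN N p q * \<kappa> q)" for p
      define e where "e p = (\<Sum>q\<in>S. (GN N p q - G p q) * \<kappa> q)" for p
      define y where "y = (\<Sum>p\<in>S. norm (n p))"
      have ks: "norm (\<kappa> q) \<le> s" if "q \<in> S" for q
        unfolding s_def by (intro member_le_sum that S) auto
      have s0: "s \<ge> 0" unfolding s_def by (intro sum_nonneg) auto
      \<comment> \<open>The perturbation term, with \<open>s\<close> the norm of \<open>\<kappa>\<close>; for small \<open>E N\<close> it is absorbed at the end.\<close>
      have e_le: "(\<Sum>p\<in>S. norm (e p)) \<le> E N * s"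
      proof -
        have "norm (e p) \<le> (\<Sum>q\<in>S. norm (GN N p q - G p q) * s)" for p
          unfolding e_def
          by (rule order_trans[OF norm_sum]) (auto intro!: sum_mono mult_left_mono ks simp: norm_mult)
        then show ?thesis
          unfolding E_def sum_distrib_right by (intro sum_mono)
      qed
      have k: "\<kappa> q = (\<Sum>p\<in>S. H q p * (n p - e p))" if "q \<in> S" for q
      proof -
        have "(\<Sum>p\<in>S. H q p * (n p - e p)) = (\<Sum>p\<in>S. H q p * (\<Sum>q'\<in>S. G p q' * \<kappa> q'))"
          by (simp add: n_def e_def algebra_simps sum_subtractf)
        also have "\<dots> = (\<Sum>q'\<in>S. (\<Sum>p\<in>S. H q p * G p q') * \<kappa> q')"
          unfolding sum_distrib_left sum_distrib_right by (subst sum.swap) (simp add: mult.assoc)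
        also have "\<dots> = (\<Sum>q'\<in>S. if q = q' then \<kappa> q' else 0)"
          by (rule sum.cong) (auto simp: H that)
        finally show ?thesis using that S by simp
      qed
      have "norm (\<kappa> q) \<le> (\<Sum>p\<in>S. norm (H q p)) * (y + E N * s)" if q: "q \<in> S" for q
      proof -
        have "norm (n p - e p) \<le> y + E N * s" if "p \<in> S" for p
        proof -
          have "norm (n p) \<le> y" unfolding y_def by (intro member_le_sum that S) auto
          moreover have "norm (e p) \<le> (\<Sum>p\<in>S. norm (e p))" by (intro member_le_sum that S) auto
          ultimately show ?thesis using e_le norm_triangle_ineq4[of "n p" "e p"] by linarith
        qed
        then show ?thesis
          unfolding k[OF q] sum_distrib_right
          by (intro order_trans[OF norm_sum] sum_mono) (auto simp: norm_mult intro!: mult_left_mono)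
      qed
      then have "s \<le> D * (y + E N * s)"
        unfolding s_def D_def sum_distrib_right[where A = S] by (intro sum_mono) (simp add: s_def)
      also have "\<dots> = D * y + (D * E N) * s" by (simp add: algebra_simps)
      also have "\<dots> \<le> D * y + 1/2 * s"
        using elim s0 by (intro add_left_mono mult_right_mono) auto
      finally show "(\<Sum>q\<in>S. norm (\<kappa> q)) \<le> 2 * D * (\<Sum>p\<in>S. norm (\<Sum>q\<in>S. GN N p q * \<kappa> q))"
        unfolding s_def y_def n_def by simp
    qed
  qed
  with D0 show ?thesis by (intro that[of "2 * D"]) auto
qed

text \<open>
  No bound on the solutions \<open>\<kappa>N\<close> is known beforehand. The uniform bound is therefore applied to
  \<open>\<kappa>N - \<kappa>\<close>, whose image under \<open>GN\<close> is \<open>mN - GN \<kappa>\<close> and tends to \<open>m - G \<kappa> = 0\<close>.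
\<close>

lemma unitriangular_perturbation_tendsto:
  fixes G :: "'p \<Rightarrow> 'p \<Rightarrow> complex" and r :: "'p \<Rightarrow> real"
    and GN :: "nat \<Rightarrow> 'p \<Rightarrow> 'p \<Rightarrow> complex"
  assumes S: "finite S"
    and G1: "\<And>p. p \<in> S \<Longrightarrow> G p p = 1"
    and G0: "\<And>p q. p \<in> S \<Longrightarrow> q \<in> S \<Longrightarrow> q \<noteq> p \<Longrightarrow> G p q \<noteq> 0 \<Longrightarrow> r q < r p"
    and lim: "\<And>p q. p \<in> S \<Longrightarrow> q \<in> S \<Longrightarrow> (\<lambda>N. GN N p q) \<longlonglongrightarrow> G p q"
    and eq: "\<And>p. p \<in> S \<Longrightarrow> \<forall>\<^sub>F N in sequentially. mN N p = (\<Sum>q\<in>S. GN N p q * \<kappa>N N q)"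
    and m: "\<And>p. p \<in> S \<Longrightarrow> (\<lambda>N. mN N p) \<longlonglongrightarrow> m p"
    and sol: "\<And>p. p \<in> S \<Longrightarrow> (\<Sum>q\<in>S. G p q * \<kappa> q) = m p"
    and q: "q \<in> S"
  shows "(\<lambda>N. \<kappa>N N q) \<longlonglongrightarrow> \<kappa> q"
proof -
  obtain C where C: "C \<ge> 0" and bound:
    "\<forall>\<^sub>F N in sequentially. \<forall>\<kappa>. (\<Sum>q\<in>S. norm (\<kappa> q)) \<le> C * (\<Sum>p\<in>S. norm (\<Sum>q\<in>S. GN N p q * \<kappa> q))"
    using unitriangular_perturbation_bound[of S G r GN] S G1 G0 lim by blast
  define e where "e N = (\<Sum>p\<in>S. norm (mN N p - (\<Sum>q\<in>S. GN N p q * \<kappa> q)))" for N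
  have "e \<longlonglongrightarrow> (\<Sum>p\<in>S. norm (m p - (\<Sum>q\<in>S. G p q * \<kappa> q)))"
    unfolding e_def by (intro tendsto_intros m lim)
  then have "(\<lambda>N. C * e N) \<longlonglongrightarrow> C * 0"
    by (intro tendsto_intros) (simp add: sol)
  then have lim0: "(\<lambda>N. C * e N) \<longlonglongrightarrow> 0" by simp
  have "\<forall>\<^sub>F N in sequentially. \<forall>p\<in>S. mN N p = (\<Sum>q\<in>S. GN N p q * \<kappa>N N q)"
    using eq S by (simp add: eventually_ball_finite)
  with bound have "\<forall>\<^sub>F N in sequentially. norm (\<kappa>N N q - \<kappa> q) \<le> C * e N"
  proof eventually_elim
    case (elim N)
    have "norm (\<kappa>N N q - \<kappa> q) \<le> (\<Sum>q\<in>S. norm (\<kappa>N N q - \<kappa> q))"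
      by (rule member_le_sum[OF q _ S, of "\<lambda>q. norm (\<kappa>N N q - \<kappa> q)"]) auto
    also have "\<dots> \<le> C * (\<Sum>p\<in>S. norm (\<Sum>q\<in>S. GN N p q * (\<kappa>N N q - \<kappa> q)))"
      using elim(1)[rule_format, of "\<lambda>q. \<kappa>N N q - \<kappa> q"] .
    also have "\<dots> = C * e N"
      using elim(2) by (simp add: e_def algebra_simps sum_subtractf)
    finally show ?case .
  qed
  then have "(\<lambda>N. \<kappa>N N q - \<kappa> q) \<longlonglongrightarrow> 0"
    by (rule Lim_null_comparison[OF _ lim0])
  then show ?thesis by (simp add: LIM_zero_iff)
qed

lemma unitriangular_unique:
  fixes G :: "'p \<Rightarrow> 'p \<Rightarrow> complex" and r :: "'p \<Rightarrow> real"
  assumes S: "finite S"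
    and G1: "\<And>p. p \<in> S \<Longrightarrow> G p p = 1"
    and G0: "\<And>p q. p \<in> S \<Longrightarrow> q \<in> S \<Longrightarrow> q \<noteq> p \<Longrightarrow> G p q \<noteq> 0 \<Longrightarrow> r q < r p"
    and eq: "\<And>p. p \<in> S \<Longrightarrow> (\<Sum>q\<in>S. G p q * \<kappa> q) = (\<Sum>q\<in>S. G p q * \<kappa>' q)"
    and q: "q \<in> S"
  shows "\<kappa> q = \<kappa>' q"
proof -
  have "(\<lambda>N. \<kappa> q) \<longlonglongrightarrow> \<kappa>' q"
    by (rule unitriangular_perturbation_tendsto[of S G r "\<lambda>_. G" "\<lambda>_ p. \<Sum>q\<in>S. G p q * \<kappa> q" "\<lambda>_. \<kappa>"
          "\<lambda>p. \<Sum>q\<in>S. G p q * \<kappa> q" \<kappa>' q]) (use assms in auto)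
  then show ?thesis by (simp add: LIMSEQ_const_iff)
qed

lemma sum_filter_of_bool:
  fixes f :: "'a \<Rightarrow> complex"
  assumes "finite S"
  shows "(\<Sum>x | x \<in> S \<and> R x. f x) = (\<Sum>x\<in>S. of_bool (R x) * f x)"
  unfolding sum.inter_filter[OF assms] by (rule sum.cong[OF refl]) simp

lemma prod_of_bool:
  assumes "finite S"
  shows "(\<Prod>b\<in>S. of_bool (Q b)) = (of_bool (\<forall>b\<in>S. Q b) :: complex)"
  using assms by (induction S rule: finite_induct) auto

section \<open>Partitions and functions constant on their blocks\<close>

text \<open>
  This is the relation \<open>p \<unlhd> Ker I\<close>, stated for functions with values in any type: index functions
  take values in \<open>{..<N}\<close>, while semimodularity is proved with Boolean functions.
\<close>

definition blockconst :: "ptn \<Rightarrow> (point \<Rightarrow> 'v) \<Rightarrow> bool" where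
  "blockconst p I \<longleftrightarrow> (\<forall>b\<in>p. \<forall>x\<in>b. \<forall>y\<in>b. I x = I y)"

definition block :: "ptn \<Rightarrow> point \<Rightarrow> point set" where
  "block p x = (THE b. b \<in> p \<and> x \<in> b)"

lemma block_eq:
  assumes "partition_on X p" "b \<in> p" "x \<in> b"
  shows "block p x = b"
  unfolding block_def
proof (rule the_equality)
  fix c assume "c \<in> p \<and> x \<in> c"
  then show "c = b" using assms partition_onD2[OF assms(1)] by (auto simp: disjoint_def)
qed (use assms in auto)

lemma block_in:
  assumes "partition_on X p" "x \<in> X"
  shows "block p x \<in> p" "x \<in> block p x"
proof -
  obtain b where "b \<in> p" "x \<in> b" using assms partition_onD1 by blast
  with block_eq[OF assms(1)] show "block p x \<in> p" "x \<in> block p x" by auto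
qed

lemma block_image:
  assumes p: "partition_on X p" shows "block p ` X = p"
proof (intro equalityI subsetI)
  fix b assume b: "b \<in> p"
  then obtain x where x: "x \<in> b" using partition_onD3[OF p] by (metis all_not_in_conv)
  then have "x \<in> X" using b partition_onD1[OF p] by auto
  then show "b \<in> block p ` X" using block_eq[OF p b x] by blast
qed (use block_in[OF p] in auto)

lemma blockconst_iff_factors:
  assumes "partition_on X p"
  shows "blockconst p I \<longleftrightarrow> (\<exists>\<phi>. \<forall>x\<in>X. I x = \<phi> (block p x))"
proof
  assume r: "blockconst p I"
  have "I x = I (SOME y. y \<in> block p x)" if "x \<in> X" for x
    using r block_in[OF assms that] someI[of "\<lambda>y. y \<in> block p x" x] unfolding blockconst_def by blast
  then show "\<exists>\<phi>. \<forall>x\<in>X. I x = \<phi> (block p x)"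
    by (intro exI[of _ "\<lambda>b. I (SOME y. y \<in> b)"]) auto
next
  assume "\<exists>\<phi>. \<forall>x\<in>X. I x = \<phi> (block p x)"
  then show "blockconst p I"
    unfolding blockconst_def using block_eq[OF assms] partition_onD1[OF assms] by (metis UnionI)
qed

lemma blockconst_bij:
  assumes p: "partition_on X p"
  shows "bij_betw (\<lambda>\<phi>. \<lambda>x\<in>X. \<phi> (block p x)) (p \<rightarrow>\<^sub>E T) {I \<in> X \<rightarrow>\<^sub>E T. blockconst p I}"
  unfolding bij_betw_def
proof
  show "inj_on (\<lambda>\<phi>. \<lambda>x\<in>X. \<phi> (block p x)) (p \<rightarrow>\<^sub>E T)"
  proof (rule inj_onI)
    fix \<phi> \<psi> assume *: "\<phi> \<in> p \<rightarrow>\<^sub>E T" "\<psi> \<in> p \<rightarrow>\<^sub>E T"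
      "(\<lambda>x\<in>X. \<phi> (block p x)) = (\<lambda>x\<in>X. \<psi> (block p x))"
    show "\<phi> = \<psi>"
    proof (rule PiE_ext[OF *(1,2)])
      fix b assume b: "b \<in> p"
      then obtain x where x: "x \<in> b" using partition_onD3[OF p] by (metis all_not_in_conv)
      then have "x \<in> X" using b partition_onD1[OF p] by auto
      then show "\<phi> b = \<psi> b"
        using fun_cong[OF *(3), of x] block_eq[OF p b x] by simp
    qed
  qed
  show "(\<lambda>\<phi>. \<lambda>x\<in>X. \<phi> (block p x)) ` (p \<rightarrow>\<^sub>E T) = {I \<in> X \<rightarrow>\<^sub>E T. blockconst p I}" (is "?f ` _ = ?R")
  proof (intro equalityI subsetI)
    fix I assume "I \<in> ?f ` (p \<rightarrow>\<^sub>E T)"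
    then obtain \<phi> where \<phi>: "\<phi> \<in> p \<rightarrow>\<^sub>E T" "I = ?f \<phi>" by auto
    then have "I \<in> X \<rightarrow>\<^sub>E T" using block_in[OF p] by auto
    moreover have "blockconst p I"
      unfolding blockconst_iff_factors[OF p] using \<phi>(2) by (intro exI[of _ \<phi>]) auto
    ultimately show "I \<in> ?R" by auto
  next
    fix I assume I: "I \<in> ?R"
    then obtain \<phi> where \<phi>: "\<forall>x\<in>X. I x = \<phi> (block p x)"
      using blockconst_iff_factors[OF p, of I] by blast
    have "restrict \<phi> p \<in> p \<rightarrow>\<^sub>E T"
    proof (intro restrict_PiE_iff[THEN iffD2] ballI)
      fix b assume b: "b \<in> p"
      then obtain x where x: "x \<in> b" using partition_onD3[OF p] by (metis all_not_in_conv)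
      then have "x \<in> X" using b partition_onD1[OF p] by auto
      then show "\<phi> b \<in> T" using I \<phi> block_eq[OF p b x] by (auto simp: PiE_iff)
    qed
    moreover have "I = ?f (restrict \<phi> p)"
      using I \<phi> block_in[OF p] by (auto simp: PiE_iff extensional_def restrict_def)
    ultimately show "I \<in> ?f ` (p \<rightarrow>\<^sub>E T)" by blast
  qed
qed

text \<open>
  A function constant on the blocks is a function on the set of blocks, so the sum factorizes over the
  blocks. With all factors equal to 1 it counts such functions; with matrix entries as factors it
  computes the action of a group element on \<open>rho\<close>.
\<close>

lemma sum_blockconst_prod:
  fixes f :: "point \<Rightarrow> 'v \<Rightarrow> 'c :: comm_semiring_1"
  assumes p: "partition_on X p" and X: "finite X" and T: "finite T"
  shows "(\<Sum>I | I \<in> X \<rightarrow>\<^sub>E T \<and> blockconst p I. \<Prod>a\<in>X. f a (I a)) = (\<Prod>b\<in>p. \<Sum>x\<in>T. \<Prod>a\<in>b. f a x)"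
proof -
  have fp: "finite p" using finite_elements[OF X p] .
  have fb: "finite b" if "b \<in> p" for b
    using that X partition_onD1[OF p] by (metis Sup_upper finite_subset)
  have "(\<Sum>I | I \<in> X \<rightarrow>\<^sub>E T \<and> blockconst p I. \<Prod>a\<in>X. f a (I a)) =
     (\<Sum>\<phi>\<in>p \<rightarrow>\<^sub>E T. \<Prod>a\<in>X. f a (\<phi> (block p a)))"
    by (subst sum.reindex_bij_betw[OF blockconst_bij[OF p], symmetric]) simp
  also have "\<dots> = (\<Sum>\<phi>\<in>p \<rightarrow>\<^sub>E T. \<Prod>b\<in>p. \<Prod>a\<in>b. f a (\<phi> b))"
  proof (rule sum.cong[OF refl])
    fix \<phi> assume "\<phi> \<in> p \<rightarrow>\<^sub>E T"
    have "(\<Prod>a\<in>X. f a (\<phi> (block p a))) = (\<Prod>a\<in>\<Union>p. f a (\<phi> (block p a)))"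
      using partition_onD1[OF p] by simp
    also have "\<dots> = (\<Prod>b\<in>p. \<Prod>a\<in>b. f a (\<phi> (block p a)))"
      using partition_onD2[OF p] fb
      by (subst prod.Union_disjoint) (auto simp: disjoint_def)
    also have "\<dots> = (\<Prod>b\<in>p. \<Prod>a\<in>b. f a (\<phi> b))"
      by (intro prod.cong refl) (simp add: block_eq[OF p])
    finally show "(\<Prod>a\<in>X. f a (\<phi> (block p a))) = (\<Prod>b\<in>p. \<Prod>a\<in>b. f a (\<phi> b))" .
  qed
  also have "\<dots> = (\<Prod>b\<in>p. \<Sum>x\<in>T. \<Prod>a\<in>b. f a x)"
    by (rule prod_sum_PiE[symmetric]) (use fp T in auto)
  finally show ?thesis .
qed

lemma card_blockconst:
  assumes "partition_on X p" "finite X" "finite T"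
  shows "card {I \<in> X \<rightarrow>\<^sub>E T. blockconst p I} = card T ^ card p"
  using sum_blockconst_prod[OF assms, of "\<lambda>_ _. 1 :: nat"] by simp

lemma finite_points [simp]: "finite (points k)"
  by (simp add: points_def)

lemma points_simps [simp]: "Inl i \<in> points k \<longleftrightarrow> i < k" "Inr i \<in> points k \<longleftrightarrow> i < k"
  by (auto simp: points_def)

lemma card_points: "card (points k) = 2 * k"
  by (simp add: points_def card_Plus)

lemma finite_partitions [simp]: "finite (partitions k)"
  unfolding partitions_def by (rule finitely_many_partition_on) simp

lemma finite_blocks: "p \<in> partitions k \<Longrightarrow> finite p"
  unfolding partitions_def using finite_elements finite_points by blast

lemma nc_le: 
  assumes "p \<in> partitions k" shows "nc p \<le> 2 * k"
proof -
  have p: "partition_on (points k) p" using assms by (simp add: partitions_def)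
  show ?thesis unfolding nc_def
    using card_image_le[of "points k" "block p"] block_image[OF p] card_points by simp
qed

lemma Ker_partition: "Ker k I \<in> partitions k"
  unfolding partitions_def Ker_def by (auto simp: partition_on_def disjoint_def)

lemma Ker_block: "a \<in> points k \<Longrightarrow> block (Ker k I) a = {b \<in> points k. I b = I a}"
  using Ker_partition[of k I] unfolding partitions_def
  by (intro block_eq[where X = "points k"]) (auto simp: Ker_def)

lemma coarser_Ker_iff:
  assumes "p \<in> partitions k"
  shows "coarser k p (Ker k I) \<longleftrightarrow> blockconst p I"
proof
  assume c: "coarser k p (Ker k I)"
  show "blockconst p I"
    unfolding blockconst_def
  proof (intro ballI)
    fix b x y assume b: "b \<in> p" "x \<in> b" "y \<in> b"
    then obtain Y where "Y \<in> Ker k I" "b \<subseteq> Y" using c unfolding coarser_def refines_def by blast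
    then obtain a where "b \<subseteq> {z \<in> points k. I z = I a}" unfolding Ker_def by blast
    from subsetD[OF this b(2)] subsetD[OF this b(3)] show "I x = I y" by simp
  qed
next
  assume r: "blockconst p I"
  have p: "partition_on (points k) p" using assms by (simp add: partitions_def)
  have "\<exists>Y\<in>Ker k I. b \<subseteq> Y" if b: "b \<in> p" for b
  proof -
    obtain x where x: "x \<in> b" using b partition_onD3[OF p] by (metis all_not_in_conv)
    have bX: "b \<subseteq> points k" using b partition_onD1[OF p] by auto
    then have "b \<subseteq> {y \<in> points k. I y = I x}" using r b x unfolding blockconst_def by blast
    with x bX show ?thesis unfolding Ker_def by blast
  qed
  then show "coarser k p (Ker k I)"
    using assms Ker_partition[of k I] by (auto simp: coarser_def refines_def partitions_def)
qed

lemma blockconst_coarser: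
  assumes "coarser k p q" "blockconst q I" shows "blockconst p I"
  unfolding blockconst_def
proof (intro ballI)
  fix b x y assume b: "b \<in> p" "x \<in> b" "y \<in> b"
  then obtain c where "c \<in> q" "b \<subseteq> c" using assms(1) unfolding coarser_def refines_def by blast
  then show "I x = I y" using assms(2) b unfolding blockconst_def by blast
qed

lemma exists_Ker:
  assumes "p \<in> partitions k" "nc p \<le> N"
  obtains I where "I \<in> double_index N k" "Ker k I = p"
proof -
  have p: "partition_on (points k) p" using assms by (simp add: partitions_def)
  obtain f where f: "f ` p \<subseteq> {..<N}" "inj_on f p"
    using assms finite_blocks[OF assms(1)] card_le_inj[of p "{..<N}"] by (auto simp: nc_def)
  define I where "I = (\<lambda>x\<in>points k. f (block p x))"
  have eq: "{b \<in> points k. I b = I a} = block p a" if "a \<in> points k" for a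
  proof -
    have "I b = I a \<longleftrightarrow> block p b = block p a" if "b \<in> points k" for b
      using inj_onD[OF f(2), of "block p b" "block p a"] block_in[OF p] that \<open>a \<in> points k\<close>
      by (auto simp: I_def)
    moreover have "block p a \<subseteq> points k" using block_in[OF p that] partition_onD1[OF p] by auto
    ultimately show ?thesis
      using block_in[OF p] block_eq[OF p] that by (auto; metis)
  qed
  have "Ker k I = block p ` points k"
    unfolding Ker_def using eq by (auto simp: image_iff)
  also have "\<dots> = p" by (rule block_image[OF p])
  finally have "Ker k I = p" .
  moreover have "I \<in> double_index N k"
    using f block_in[OF p] by (auto simp: double_index_def I_def)
  ultimately show ?thesis using that by blast
qed

lemma coarser_refl: "p \<in> partitions k \<Longrightarrow> coarser k p p"
  by (simp add: coarser_def partitions_def refines_refl)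

lemma coarser_antisym: "coarser k p q \<Longrightarrow> coarser k q p \<Longrightarrow> p = q"
  by (simp add: coarser_def refines_asym)

lemma coarser_partitions: "coarser k p q \<Longrightarrow> p \<in> partitions k \<and> q \<in> partitions k"
  by (simp add: coarser_def refines_def partitions_def)

text \<open>
  The functions constant on \<open>q\<close> are among those constant on \<open>p\<close>, and a function with kernel exactly \<open>p\<close>
  is not one of them; the numbers of these functions are powers of \<open>N\<close> with exponents \<open>nc q\<close> and
  \<open>nc p\<close>.
\<close>

lemma nc_strict_mono:
  assumes "coarser k p q" "p \<noteq> q"
  shows "nc q < nc p"
proof -
  have pq: "p \<in> partitions k" "q \<in> partitions k" using coarser_partitions[OF assms(1)] by auto
  define N where "N = 2 * k + 2"
  define R where "R r = {I \<in> points k \<rightarrow>\<^sub>E {..<N}. blockconst r I}" for r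
  have card: "card (R r) = N ^ nc r" if "r \<in> partitions k" for r
    using card_blockconst[of "points k" r "{..<N}"] that by (simp add: R_def nc_def partitions_def)
  obtain I where I: "I \<in> double_index N k" "Ker k I = p"
    using exists_Ker[OF pq(1), of N] nc_le[OF pq(1)] N_def by auto
  have fin: "finite (R p)" unfolding R_def by (simp add: finite_PiE)
  have "R q \<subseteq> R p" unfolding R_def using blockconst_coarser[OF assms(1)] by auto
  moreover have "I \<in> R p"
    using I coarser_Ker_iff[OF pq(1), of I] coarser_refl[OF pq(1)] by (simp add: R_def double_index_def)
  moreover have "I \<notin> R q"
    using I coarser_Ker_iff[OF pq(2), of I] coarser_antisym[OF assms(1)] assms(2) by (auto simp: R_def)
  ultimately have "R q \<subset> R p" by blast
  then have "N ^ nc q < N ^ nc p"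
    using psubset_card_mono[OF fin] card pq by metis
  then show ?thesis using N_def by (simp add: power_less_imp_less_exp)
qed

lemma nc_mono: "coarser k p q \<Longrightarrow> nc q \<le> nc p"
  using nc_strict_mono[of k p q] by (cases "p = q") auto

section \<open>Joins and semimodularity\<close>

text \<open>
  The join is the common refinement of all partitions coarser than both; there is at least one, the
  kernel of a constant function.
\<close>

lemma pjoin_props:
  assumes "p \<in> partitions k" "q \<in> partitions k"
  shows "coarser k p (pjoin k p q)" "coarser k q (pjoin k p q)"
    "\<And>r. coarser k p r \<Longrightarrow> coarser k q r \<Longrightarrow> coarser k (pjoin k p q) r"
proof -
  define U where "U = {r. coarser k p r \<and> coarser k q r}"
  define j where "j = common_refinement U"
  have part: "partition_on (points k) r" if "r \<in> U" for r
    using that coarser_partitions by (auto simp: U_def partitions_def)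
  have ind: "coarser k r (Ker k (\<lambda>_. 0 :: nat))" if "r \<in> partitions k" for r
    using coarser_Ker_iff[OF that, of "\<lambda>_. 0::nat"] by (simp add: blockconst_def)
  then have ne: "U \<noteq> {}" unfolding U_def using assms by blast
  have 1: "coarser k r j" if "r \<in> {p, q}" for r
    unfolding coarser_def j_def
    by (rule common_refinement_coarsest) (use that part ne assms in \<open>auto simp: U_def coarser_def partitions_def\<close>)
  have 2: "coarser k j r" if "coarser k p r" "coarser k q r" for r
    unfolding coarser_def j_def
    by (rule refines_common_refinement) (use that part in \<open>auto simp: U_def\<close>)
  have "pjoin k p q = j"
    unfolding pjoin_def
  proof (rule the_equality)
    show "coarser k p j \<and> coarser k q j \<and> (\<forall>r. coarser k p r \<and> coarser k q r \<longrightarrow> coarser k j r)"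
      using 1 2 by simp
    fix i assume "coarser k p i \<and> coarser k q i \<and> (\<forall>r. coarser k p r \<and> coarser k q r \<longrightarrow> coarser k i r)"
    then show "i = j" using 1 2[of i] coarser_antisym[of k i j] by simp
  qed
  with 1 2 show "coarser k p (pjoin k p q)" "coarser k q (pjoin k p q)"
    "\<And>r. coarser k p r \<Longrightarrow> coarser k q r \<Longrightarrow> coarser k (pjoin k p q) r" by auto
qed

lemma pjoin_commute: "pjoin k p q = pjoin k q p"
  unfolding pjoin_def by (rule arg_cong[where f = The]) auto

lemma pjoin_partitions:
  assumes "p \<in> partitions k" "q \<in> partitions k" shows "pjoin k p q \<in> partitions k"
  using pjoin_props[OF assms] coarser_partitions by blast

lemma pjoin_absorb:
  assumes "coarser k p q" shows "pjoin k p q = q"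
proof -
  have pq: "p \<in> partitions k" "q \<in> partitions k" using coarser_partitions[OF assms] by auto
  show ?thesis
    using pjoin_props[OF pq] assms coarser_refl[OF pq(2)] by (intro coarser_antisym) auto
qed

lemma blockconst_pjoin:
  fixes I :: "point \<Rightarrow> nat"
  assumes "p \<in> partitions k" "q \<in> partitions k"
  shows "blockconst (pjoin k p q) I \<longleftrightarrow> blockconst p I \<and> blockconst q I"
proof
  assume "blockconst (pjoin k p q) I"
  then show "blockconst p I \<and> blockconst q I"
    using pjoin_props[OF assms] blockconst_coarser by blast
next
  assume "blockconst p I \<and> blockconst q I"
  then have "coarser k p (Ker k I)" "coarser k q (Ker k I)"
    using coarser_Ker_iff assms by auto
  then show "blockconst (pjoin k p q) I"
    using pjoin_props(3)[OF assms] coarser_Ker_iff[OF pjoin_partitions[OF assms]] by blast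
qed

text \<open>
  This is the triangle inequality \<open>d(p, r) \<le> d(p, q) + d(q, r)\<close>. The Boolean functions constant on the
  blocks of \<open>s\<close> form a vector space \<open>V s\<close> over the field with two elements, of dimension \<open>nc s\<close>, and
  \<open>V (s \<or> t) = V s \<inter> V t\<close>. Since \<open>V (p \<or> q) + V (q \<or> r) \<subseteq> V q\<close> and
  \<open>V (p \<or> q) \<inter> V (q \<or> r) \<subseteq> V (p \<or> r)\<close>, the claim is the dimension formula for a sum of two
  subspaces, obtained here by counting.
\<close>

lemma nc_semimodular:
  assumes P: "p \<in> partitions k" "q \<in> partitions k" "r \<in> partitions k"
  shows "nc (pjoin k p q) + nc (pjoin k q r) \<le> nc q + nc (pjoin k p r)"
proof -
  let ?D = "points k \<rightarrow>\<^sub>E (UNIV :: bool set)"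
  define R where "R s = {I \<in> ?D. blockconst s I}" for s
  have fin: "finite (R s)" for s unfolding R_def by (simp add: finite_PiE)
  have card: "card (R s) = 2 ^ nc s" if "s \<in> partitions k" for s
    using card_blockconst[of "points k" s "UNIV :: bool set"] that by (simp add: R_def nc_def partitions_def)
  let ?A = "R (pjoin k p q)" and ?B = "R (pjoin k q r)"
  have rp: "blockconst (pjoin k s t) I \<longleftrightarrow> blockconst s I \<and> blockconst t I" if "s \<in> {p,q,r}" "t \<in> {p,q,r}"
    for s t and I :: "point \<Rightarrow> bool"
  proof -
    have "blockconst u I \<longleftrightarrow> blockconst u (\<lambda>x. of_bool (I x) :: nat)" for u
      unfolding blockconst_def by (simp only: of_bool_eq_iff)
    then show ?thesis
      using blockconst_pjoin[of s k t "\<lambda>x. of_bool (I x) :: nat"] P that by blast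
  qed
  define xor where "xor a b = (\<lambda>x\<in>points k. a x \<noteq> b x)" for a b :: "point \<Rightarrow> bool"
  have sub: "b \<subseteq> points k" if "b \<in> s" "s \<in> {p,q,r}" for b s
    using that P partition_onD1 unfolding partitions_def by blast
  have xor_resp: "blockconst s (xor a b)" if "blockconst s a" "blockconst s b" "s \<in> {p,q,r}" for s a b
    using that sub[OF _ that(3)] unfolding blockconst_def xor_def restrict_def by (metis subsetD)
  have xorD: "xor a b \<in> ?D" for a b by (simp add: xor_def)
  \<comment> \<open>The sum map is split by choosing a preimage for every value; the remaining freedom is the intersection.\<close>
  define choice where "choice c = (SOME (a, b). a \<in> ?A \<and> b \<in> ?B \<and> xor a b = c)" for c
  have ch: "fst (choice (xor a b)) \<in> ?A \<and> snd (choice (xor a b)) \<in> ?B \<and>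
     xor (fst (choice (xor a b))) (snd (choice (xor a b))) = xor a b" if "a \<in> ?A" "b \<in> ?B" for a b
    unfolding choice_def split_def
    by (rule someI[of "\<lambda>z. fst z \<in> ?A \<and> snd z \<in> ?B \<and> xor (fst z) (snd z) = xor a b" "(a, b)"])
       (use that in simp)
  define h where "h = (\<lambda>(a, b). (xor a b, xor a (fst (choice (xor a b)))))"
  have cancel: "a = a'" if "xor a c = xor a' c" "a \<in> ?D" "a' \<in> ?D" for a a' c
  proof (rule PiE_ext[OF that(2,3)])
    fix x assume "x \<in> points k"
    then show "a x = a' x" using fun_cong[OF that(1), of x] by (auto simp: xor_def)
  qed
  have comm: "xor a b = xor b a" for a b by (auto simp: xor_def)
  have "inj_on h (?A \<times> ?B)"
  proof (rule inj_onI, clarify)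
    fix a b a' b' assume *: "a \<in> ?A" "b \<in> ?B" "a' \<in> ?A" "b' \<in> ?B" "h (a, b) = h (a', b')"
    then have x: "xor a b = xor a' b'" "xor a (fst (choice (xor a b))) = xor a' (fst (choice (xor a b)))"
      by (auto simp: h_def)
    have "a = a'" using cancel[OF x(2)] * by (auto simp: R_def)
    moreover have "b = b'" using cancel[of b a b'] x(1) \<open>a = a'\<close> * comm by (auto simp: R_def)
    ultimately show "a = a' \<and> b = b'" by simp
  qed
  moreover have "h ` (?A \<times> ?B) \<subseteq> R q \<times> R (pjoin k p r)"
  proof clarify
    fix a b a' b' assume *: "a \<in> ?A" "b \<in> ?B" "(a', b') = h (a, b)"
    define c where "c = choice (xor a b)"
    have c: "fst c \<in> ?A" "snd c \<in> ?B" "xor (fst c) (snd c) = xor a b"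
      using ch[OF *(1,2)] by (auto simp: c_def)
    have "xor a (fst c) = xor b (snd c)"
    proof
      fix x show "xor a (fst c) x = xor b (snd c) x"
        using fun_cong[OF c(3), of x] by (auto simp: xor_def restrict_def split: if_splits)
    qed
    moreover have "blockconst p (xor a (fst c))" "blockconst r (xor b (snd c))" "blockconst q (xor a b)"
      by (rule xor_resp; use * c rp in \<open>auto simp: R_def\<close>)+
    ultimately have "xor a b \<in> R q" "xor a (fst c) \<in> R (pjoin k p r)"
      using xorD rp by (auto simp: R_def)
    then show "a' \<in> R q \<and> b' \<in> R (pjoin k p r)" using *(3) by (simp add: h_def c_def)
  qed
  ultimately have "card (?A \<times> ?B) \<le> card (R q \<times> R (pjoin k p r))"
    by (intro card_inj_on_le) (auto simp: fin)
  then have "(2::nat) ^ (nc (pjoin k p q) + nc (pjoin k q r)) \<le> 2 ^ (nc q + nc (pjoin k p r))"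
    using card pjoin_partitions P by (simp add: card_cartesian_product power_add)
  then show ?thesis by simp
qed

section \<open>Transposition and the five classes\<close>

definition flip :: "point \<Rightarrow> point" where
  "flip = case_sum Inr Inl"

lemma flip_simps [simp]: "flip (Inl i) = Inr i" "flip (Inr i) = Inl i"
  by (simp_all add: flip_def)

lemma flip_flip [simp]: "flip (flip a) = a"
  by (cases a) auto

lemma flip_points [simp]: "flip a \<in> points k \<longleftrightarrow> a \<in> points k"
  by (cases a) auto

lemma flip_image_points: "flip ` points k = points k"
proof (intro equalityI subsetI)
  fix x assume "x \<in> points k"
  then show "x \<in> flip ` points k" by (intro image_eqI[of _ _ "flip x"]) simp_all
qed auto

lemma inj_flip: "inj flip"
  by (rule inj_on_inverseI[of _ flip]) simp

lemma ptn_transpose_flip: "ptn_transpose p = (`) flip ` p"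
  by (simp add: ptn_transpose_def flip_def)

lemma blockconst_transpose: "blockconst (ptn_transpose p) I \<longleftrightarrow> blockconst p (I \<circ> flip)"
  by (simp add: blockconst_def ptn_transpose_flip)

lemma ptn_transpose_transpose: "ptn_transpose (ptn_transpose p) = p"
  by (simp add: ptn_transpose_flip image_image)

lemma ptn_transpose_partitions: "p \<in> partitions k \<Longrightarrow> ptn_transpose p \<in> partitions k"
proof -
  assume "p \<in> partitions k"
  then have p: "partition_on (points k) p" by (simp add: partitions_def)
  have "partition_on (flip ` points k) ((`) flip ` p - {{}})"
    by (rule partition_on_inj_image[OF p]) (rule inj_on_subset[OF inj_flip], simp)
  moreover have "(`) flip ` p - {{}} = ptn_transpose p"
    using partition_onD3[OF p] by (auto simp: ptn_transpose_flip)
  ultimately show ?thesis by (simp add: partitions_def flip_image_points)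
qed

lemma Ker_flip: "Ker k (I \<circ> flip) = ptn_transpose (Ker k I)"
proof -
  have *: "{b \<in> points k. I (flip b) = I (flip a)} = flip ` {b \<in> points k. I b = I (flip a)}" for a
  proof (intro equalityI subsetI)
    fix b assume "b \<in> {b \<in> points k. I (flip b) = I (flip a)}"
    then show "b \<in> flip ` {b \<in> points k. I b = I (flip a)}"
      by (intro image_eqI[of _ _ "flip b"]) simp_all
  qed auto
  have "Ker k (I \<circ> flip) = (\<lambda>a. flip ` {b \<in> points k. I b = I (flip a)}) ` points k"
    unfolding Ker_def by (simp only: * comp_def image_def) blast
  also have "\<dots> = (\<lambda>a. flip ` {b \<in> points k. I b = I a}) ` flip ` points k"
    by (simp add: image_image)
  also have "\<dots> = (`) flip ` (\<lambda>a. {b \<in> points k. I b = I a}) ` points k"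
    unfolding flip_image_points by (simp only: image_image)
  also have "\<dots> = ptn_transpose (Ker k I)"
    unfolding ptn_transpose_flip Ker_def by (rule arg_cong[where f = "image ((`) flip)"]) blast
  finally show ?thesis .
qed

lemma id_ptn_eq: "id_ptn k = perm_ptn k id"
  by (simp add: id_ptn_def perm_ptn_def)

lemma perm_ptn_partitions:
  assumes "\<sigma> permutes {..<k}"
  shows "perm_ptn k \<sigma> \<in> partitions k"
proof -
  have im: "\<sigma> ` {..<k} = {..<k}" by (rule permutes_image[OF assms])
  have "\<Union>(perm_ptn k \<sigma>) = points k"
  proof (intro equalityI subsetI)
    fix a assume "a \<in> points k"
    then show "a \<in> \<Union>(perm_ptn k \<sigma>)"
    proof (cases a)
      case (Inr j)
      with \<open>a \<in> points k\<close> have "j \<in> \<sigma> ` {..<k}" using im by simp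
      then show ?thesis using Inr by (auto simp: perm_ptn_def)
    qed (auto simp: perm_ptn_def)
  qed (use im in \<open>auto simp: perm_ptn_def\<close>)
  moreover have "disjoint (perm_ptn k \<sigma>)" unfolding disjoint_def
  proof (intro ballI impI)
    fix a b assume "a \<in> perm_ptn k \<sigma>" "b \<in> perm_ptn k \<sigma>" "a \<noteq> b"
    then obtain i j where ij: "a = {Inl i, Inr (\<sigma> i)}" "b = {Inl j, Inr (\<sigma> j)}" "i \<noteq> j"
      unfolding perm_ptn_def by blast
    then have "\<sigma> i \<noteq> \<sigma> j" using permutes_inj[OF assms] by (auto dest: injD)
    with ij show "a \<inter> b = {}" by simp
  qed
  moreover have "{} \<notin> perm_ptn k \<sigma>" by (auto simp: perm_ptn_def)
  ultimately show ?thesis by (simp add: partitions_def partition_on_def)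
qed

lemma id_ptn_partitions: "id_ptn k \<in> partitions k"
  unfolding id_ptn_eq by (rule perm_ptn_partitions) (rule permutes_id)

text \<open>
  A perfect matching of the unprimed with the primed points is the graph of a permutation. Described by
  its blocks, this class becomes comparable with the other four.
\<close>

lemma class_S_eq:
  "class_ptns Class_S k = {p \<in> partitions k. \<forall>b\<in>p. \<exists>i j. b = {Inl i, Inr j}}"
proof (intro equalityI subsetI)
  fix p assume "p \<in> class_ptns Class_S k"
  then obtain \<sigma> where "p = perm_ptn k \<sigma>" "\<sigma> permutes {..<k}" by auto
  moreover from this have "p \<in> partitions k" using perm_ptn_partitions by simp
  ultimately show "p \<in> {p \<in> partitions k. \<forall>b\<in>p. \<exists>i j. b = {Inl i, Inr j}}"
    unfolding perm_ptn_def by blast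
next
  fix p assume "p \<in> {p \<in> partitions k. \<forall>b\<in>p. \<exists>i j. b = {Inl i, Inr j}}"
  then have p: "partition_on (points k) p" and b: "\<And>b. b \<in> p \<Longrightarrow> \<exists>i j. b = {Inl i, Inr j}"
    by (auto simp: partitions_def)
  define \<sigma> where "\<sigma> i = (if i < k then THE j. Inr j \<in> block p (Inl i) else i)" for i
  have blk: "block p (Inl i) = {Inl i, Inr (\<sigma> i)} \<and> \<sigma> i < k" if i: "i < k" for i
  proof -
    have i': "Inl i \<in> points k" using i by simp
    obtain i0 j where ij: "block p (Inl i) = {Inl i0, Inr j}" using b[OF block_in(1)[OF p i']] by blast
    then have "i0 = i" using block_in(2)[OF p i'] by auto
    moreover have "\<sigma> i = j" using i ij by (simp add: \<sigma>_def)
    moreover have "Inr j \<in> points k"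
      using ij block_in(1)[OF p i'] partition_onD1[OF p] by auto
    ultimately show ?thesis using ij by auto
  qed
  have "inj_on \<sigma> {..<k}"
  proof (rule inj_onI)
    fix i j assume *: "i \<in> {..<k}" "j \<in> {..<k}" "\<sigma> i = \<sigma> j"
    then have "Inr (\<sigma> i) \<in> block p (Inl i)" "Inr (\<sigma> i) \<in> block p (Inl j)"
      "block p (Inl i) \<in> p" "block p (Inl j) \<in> p"
      using blk[of i] blk[of j] block_in(1)[OF p, of "Inl i"] block_in(1)[OF p, of "Inl j"]
      by auto
    then have "block p (Inl i) = block p (Inl j)" using block_eq[OF p] by metis
    then show "i = j" using blk[of i] blk[of j] * by auto
  qed
  moreover have "\<sigma> ` {..<k} \<subseteq> {..<k}" using blk by auto
  ultimately have "bij_betw \<sigma> {..<k} {..<k}"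
    unfolding bij_betw_def using endo_inj_surj[of "{..<k}" \<sigma>] by simp
  then have "\<sigma> permutes {..<k}" by (rule bij_imp_permutes) (simp add: \<sigma>_def)
  moreover have "p = perm_ptn k \<sigma>"
  proof (intro equalityI subsetI)
    fix c assume c: "c \<in> p"
    then obtain i j where ij: "c = {Inl i, Inr j}" using b by blast
    then have "Inl i \<in> points k" using c partition_onD1[OF p] by blast
    then have "i < k" by simp
    moreover have "c = block p (Inl i)" using block_eq[OF p c, of "Inl i"] ij by simp
    ultimately show "c \<in> perm_ptn k \<sigma>" using blk unfolding perm_ptn_def by auto
  next
    fix c assume "c \<in> perm_ptn k \<sigma>"
    then obtain i where "i < k" "c = {Inl i, Inr (\<sigma> i)}" by (auto simp: perm_ptn_def)
    then show "c \<in> p" using blk[of i] block_in(1)[OF p, of "Inl i"] by auto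
  qed
  ultimately show "p \<in> class_ptns Class_S k" by auto
qed

lemma class_ptns_partitions: "class_ptns A k \<subseteq> partitions k"
proof (cases A)
  case Class_S
  then show ?thesis unfolding Class_S class_S_eq by blast
qed auto

lemma finite_class_ptns [simp]: "finite (class_ptns A k)"
  using class_ptns_partitions finite_partitions by (rule finite_subset)

section \<open>The geodesic order\<close>

text \<open>
  The excess \<open>d(id, q) + d(q, p) - d(id, p)\<close> in the triangle inequality. By semimodularity the
  subtraction does not truncate; the contribution of the cumulant of \<open>q\<close> to the moment of \<open>p\<close> carries the
  factor \<open>N\<close> to the power of minus the defect.
\<close>

definition defect :: "nat \<Rightarrow> ptn \<Rightarrow> ptn \<Rightarrow> nat" where
  "defect k q p = nc q + nc (pjoin k p (id_ptn k)) - (nc (pjoin k q (id_ptn k)) + nc (pjoin k p q))"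

lemma defect_eq:
  assumes "p \<in> partitions k" "q \<in> partitions k"
  shows "int (defect k q p) =
    int (nc q) + int (nc (pjoin k p (id_ptn k))) - int (nc (pjoin k q (id_ptn k))) - int (nc (pjoin k p q))"
  using nc_semimodular[OF assms id_ptn_partitions] unfolding defect_def by simp

lemma ptn_le_iff_defect:
  assumes "p \<in> partitions k" "q \<in> partitions k"
  shows "ptn_le k q p \<longleftrightarrow> defect k q p = 0"
proof -
  have "real (defect k q p) =
    real (nc q) + real (nc (pjoin k p (id_ptn k))) - real (nc (pjoin k q (id_ptn k))) - real (nc (pjoin k p q))"
    using defect_eq[OF assms] by linarith
  moreover have "defect k q p = 0 \<longleftrightarrow> real (defect k q p) = 0" by simp
  ultimately show ?thesis
    unfolding ptn_le_def ptn_dist_def pjoin_commute[of k "id_ptn k"] pjoin_commute[of k q p]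
    by (simp add: field_simps) linarith
qed

lemma ptn_le_refl: "p \<in> partitions k \<Longrightarrow> ptn_le k p p"
  by (simp add: ptn_le_def ptn_dist_def pjoin_absorb coarser_refl)

text \<open>
  A positive distance between distinct partitions makes the distance to the identity a rank function
  for the order, so the moment-cumulant relation is unitriangular.
\<close>

lemma ptn_le_dist_less:
  assumes "p \<in> partitions k" "q \<in> partitions k" "ptn_le k q p" "q \<noteq> p"
  shows "ptn_dist k (id_ptn k) q < ptn_dist k (id_ptn k) p"
proof -
  note j = pjoin_props[OF assms(2,1)]
  have "nc (pjoin k q p) \<le> nc q" "nc (pjoin k q p) \<le> nc p"
    using j(1,2) by (auto intro: nc_mono)
  moreover have "nc (pjoin k q p) < nc q \<or> nc (pjoin k q p) < nc p"
    using nc_strict_mono[OF j(1)] nc_strict_mono[OF j(2)] assms(4) by fastforce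
  ultimately have "ptn_dist k q p > 0" by (auto simp: ptn_dist_def)
  then show ?thesis using assms(3) by (simp add: ptn_le_def)
qed

text \<open>
  Among the partitions \<open>q\<close> finer than \<open>p\<close> the join of \<open>p\<close> and \<open>q\<close> is \<open>p\<close>, so the relation for exclusive
  moments singles out the same geodesic condition as the order for moments.
\<close>

lemma ptn_sqsup_iff_defect:
  assumes "coarser k q p"
  shows "ptn_sqsup k q p \<longleftrightarrow> defect k q p = 0"
proof -
  have pq: "p \<in> partitions k" "q \<in> partitions k" using coarser_partitions[OF assms] by auto
  have "int (defect k q p) =
    int (nc q) + int (nc (pjoin k p (id_ptn k))) - int (nc (pjoin k q (id_ptn k))) - int (nc p)"
    using defect_eq[OF pq] by (simp add: pjoin_commute[of k p q] pjoin_absorb[OF assms])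
  then show ?thesis unfolding ptn_sqsup_def using assms by auto
qed

lemma ptn_sqsup_refl: "p \<in> partitions k \<Longrightarrow> ptn_sqsup k p p"
  by (simp add: ptn_sqsup_def coarser_refl)

section \<open>Operators as tensors with one index per point\<close>

text \<open>
  Conjugating an operator by a unitary \<open>g\<close> multiplies each row index by \<open>g\<close> and each column index by
  the complex conjugate of \<open>g\<close>; \<open>Inr\<close> points carry row indices and \<open>Inl\<close> points column indices.
\<close>

definition entry :: "complex mat \<Rightarrow> point \<Rightarrow> nat \<Rightarrow> nat \<Rightarrow> complex" where
  "entry g a x y = (case a of Inl _ \<Rightarrow> cnj (g $$ (x, y)) | Inr _ \<Rightarrow> g $$ (x, y))"

lemma entry_simps [simp]: "entry g (Inl i) x y = cnj (g $$ (x, y))" "entry g (Inr i) x y = g $$ (x, y)"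
  by (simp_all add: entry_def)

text \<open>
  The conjugation of an operator by the tensor power of \<open>g\<close>, seen as a diagonal action on tensors with
  \<open>2 * k\<close> indices. In this form rows and columns are treated alike, and only the entries remember on
  which side a point lies.
\<close>

definition group_act :: "nat \<Rightarrow> nat \<Rightarrow> complex mat \<Rightarrow> ((point \<Rightarrow> nat) \<Rightarrow> complex) \<Rightarrow> (point \<Rightarrow> nat) \<Rightarrow> complex" where
  "group_act N k g v I = (\<Sum>J\<in>double_index N k. (\<Prod>a\<in>points k. entry g a (I a) (J a)) * v J)"

definition row_index :: "nat \<Rightarrow> (point \<Rightarrow> nat) \<Rightarrow> nat \<Rightarrow> nat" where
  "row_index k I = (\<lambda>l\<in>{..<k}. I (Inr l))"

definition col_index :: "nat \<Rightarrow> (point \<Rightarrow> nat) \<Rightarrow> nat \<Rightarrow> nat" where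
  "col_index k I = (\<lambda>l\<in>{..<k}. I (Inl l))"

definition joint :: "nat \<Rightarrow> (nat \<Rightarrow> nat) \<Rightarrow> (nat \<Rightarrow> nat) \<Rightarrow> point \<Rightarrow> nat" where
  "joint k r c = (\<lambda>a\<in>points k. case a of Inl l \<Rightarrow> c l | Inr l \<Rightarrow> r l)"

definition op_vec :: "nat \<Rightarrow> tensor_op \<Rightarrow> (point \<Rightarrow> nat) \<Rightarrow> complex" where
  "op_vec k T I = T (row_index k I) (col_index k I)"

lemma finite_double_index [simp]: "finite (double_index N k)"
  unfolding double_index_def by (intro finite_PiE) auto

lemma finite_multi_index [simp]: "finite (multi_index N k)"
  unfolding multi_index_def by (intro finite_PiE) auto

lemma double_index_less: "I \<in> double_index N k \<Longrightarrow> a \<in> points k \<Longrightarrow> I a < N"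
  unfolding double_index_def by auto

lemma joint_simps [simp]: "l < k \<Longrightarrow> joint k r c (Inl l) = c l" "l < k \<Longrightarrow> joint k r c (Inr l) = r l"
  by (simp_all add: joint_def)

lemma joint_in: "r \<in> multi_index N k \<Longrightarrow> c \<in> multi_index N k \<Longrightarrow> joint k r c \<in> double_index N k"
  unfolding double_index_def
proof (rule PiE_I)
  fix a assume rc: "r \<in> multi_index N k" "c \<in> multi_index N k" and "a \<in> points k"
  then show "joint k r c a \<in> {..<N}"
    using PiE_mem[OF rc(1)[unfolded multi_index_def]] PiE_mem[OF rc(2)[unfolded multi_index_def]]
    by (cases a) auto
qed (simp add: joint_def)

lemma row_col_in: 
  assumes "I \<in> double_index N k"
  shows "row_index k I \<in> multi_index N k" "col_index k I \<in> multi_index N k"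
  using double_index_less[OF assms] by (auto simp: row_index_def col_index_def multi_index_def)

lemma row_col_joint: 
  assumes "r \<in> multi_index N k" "c \<in> multi_index N k"
  shows "row_index k (joint k r c) = r" "col_index k (joint k r c) = c"
proof -
  show "row_index k (joint k r c) = r"
  proof
    fix l show "row_index k (joint k r c) l = r l"
      using assms(1) PiE_arb[of r "{..<k}" _ l] by (cases "l < k") (auto simp: row_index_def multi_index_def)
  qed
  show "col_index k (joint k r c) = c"
  proof
    fix l show "col_index k (joint k r c) l = c l"
      using assms(2) PiE_arb[of c "{..<k}" _ l] by (cases "l < k") (auto simp: col_index_def multi_index_def)
  qed
qed

lemma double_index_eqI:
  assumes "I \<in> double_index N k" "J \<in> double_index N k" "\<And>a. a \<in> points k \<Longrightarrow> I a = J a"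
  shows "I = J"
  using assms unfolding double_index_def by (rule PiE_ext)

lemma joint_row_col: 
  assumes "I \<in> double_index N k"
  shows "joint k (row_index k I) (col_index k I) = I"
proof (rule double_index_eqI[OF joint_in[OF row_col_in[OF assms]] assms])
  fix a assume "a \<in> points k"
  then show "joint k (row_index k I) (col_index k I) a = I a"
    by (cases a) (simp_all add: row_index_def col_index_def)
qed

lemma joint_flip: "joint k r c \<circ> flip = joint k c r"
proof
  fix a show "(joint k r c \<circ> flip) a = joint k c r a"
    by (cases a) (simp_all add: joint_def)
qed

lemma sum_double_index:
  "(\<Sum>I\<in>double_index N k. F I) = (\<Sum>r\<in>multi_index N k. \<Sum>c\<in>multi_index N k. F (joint k r c))"
proof -
  have "bij_betw (\<lambda>(r, c). joint k r c) (multi_index N k \<times> multi_index N k) (double_index N k)"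
    by (rule bij_betw_byWitness[of _ "\<lambda>I. (row_index k I, col_index k I)"])
       (auto simp: row_col_joint joint_row_col joint_in row_col_in)
  from sum.reindex_bij_betw[OF this, of F] show ?thesis
    by (simp add: sum.cartesian_product split_def)
qed

lemma prod_points: "(\<Prod>a\<in>points k. f a) = (\<Prod>l<k. f (Inl l)) * (\<Prod>l<k. f (Inr l))"
  unfolding points_def by (simp add: prod.Plus)

lemma sum_double_index_prod:
  fixes f :: "point \<Rightarrow> nat \<Rightarrow> complex"
  shows "(\<Sum>J\<in>double_index N k. \<Prod>a\<in>points k. f a (J a)) = (\<Prod>a\<in>points k. \<Sum>x<N. f a x)"
  unfolding double_index_def by (rule prod_sum_PiE[symmetric]) auto

text \<open>
  An elementary tensor has a single non-zero coefficient, at the row and column read off its index.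
\<close>

lemma elem_tensor_sum:
  assumes "r \<in> multi_index N k" "c \<in> multi_index N k"
  shows "(\<Sum>I | I \<in> double_index N k \<and> Q I. elem_tensor N k I r c) = of_bool (Q (joint k r c))"
proof -
  have rc: "r l < N" "c l < N" if "l < k" for l using assms that by (auto simp: multi_index_def)
  have *: "elem_tensor N k I r c = of_bool (I = joint k r c)" if I: "I \<in> double_index N k" for I
  proof -
    have "elem_tensor N k I r c = (\<Prod>l<k. of_bool (r l = I (Inr l) \<and> c l = I (Inl l)))"
      unfolding elem_tensor_def tensor_def using rc by (auto simp: elem_mat_def intro!: prod.cong)
    also have "\<dots> = of_bool (\<forall>l<k. r l = I (Inr l) \<and> c l = I (Inl l))"
      by (subst prod_of_bool) auto
    also have "(\<forall>l<k. r l = I (Inr l) \<and> c l = I (Inl l)) \<longleftrightarrow> I = joint k r c"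
    proof
      assume h: "\<forall>l<k. r l = I (Inr l) \<and> c l = I (Inl l)"
      show "I = joint k r c"
      proof (rule double_index_eqI[OF I joint_in[OF assms]])
        fix a assume "a \<in> points k"
        then show "I a = joint k r c a" using h by (cases a) auto
      qed
    qed auto
    finally show ?thesis .
  qed
  have "(\<Sum>I | I \<in> double_index N k \<and> Q I. elem_tensor N k I r c) =
    (\<Sum>I | I \<in> double_index N k \<and> Q I. if I = joint k r c then 1 else 0)"
    by (rule sum.cong) (auto simp: *)
  also have "\<dots> = of_bool (Q (joint k r c))"
    using joint_in[OF assms] by (simp add: sum.delta')
  finally show ?thesis .
qed

lemma rho_eq:
  assumes "p \<in> partitions k" "r \<in> multi_index N k" "c \<in> multi_index N k"
  shows "rho N k p r c = of_bool (blockconst p (joint k r c))"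
  unfolding rho_def coarser_Ker_iff[OF assms(1)] by (rule elem_tensor_sum[OF assms(2,3)])

lemma rho_excl_eq:
  assumes "r \<in> multi_index N k" "c \<in> multi_index N k"
  shows "rho_excl N k p r c = of_bool (Ker k (joint k r c) = p)"
  unfolding rho_excl_def by (rule elem_tensor_sum[OF assms])

lemma op_trace_op_mult:
  "op_trace N k (op_mult N k T R) =
     (\<Sum>I\<in>double_index N k. op_vec k T I * R (col_index k I) (row_index k I))"
  unfolding op_trace_def op_mult_def sum_double_index
  by (intro sum.cong refl) (simp add: op_vec_def row_col_joint)

text \<open>
  The transposition cancels the exchange of rows and columns in the trace of a product, so moments are
  sums of the coefficients over all indices constant on the blocks of \<open>p\<close>.
\<close>

lemma op_trace_rho_transpose:
  assumes "p \<in> partitions k"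
  shows "op_trace N k (op_mult N k T (rho N k (ptn_transpose p))) =
     (\<Sum>I\<in>double_index N k. op_vec k T I * of_bool (blockconst p I))"
  unfolding op_trace_op_mult
proof (rule sum.cong[OF refl])
  fix I assume I: "I \<in> double_index N k"
  have "joint k (col_index k I) (row_index k I) \<circ> flip = I"
    by (simp add: joint_flip joint_row_col[OF I])
  then show "op_vec k T I * rho N k (ptn_transpose p) (col_index k I) (row_index k I) =
      op_vec k T I * of_bool (blockconst p I)"
    by (simp add: rho_eq[OF ptn_transpose_partitions[OF assms] row_col_in(2,1)[OF I]] blockconst_transpose)
qed

lemma op_trace_rho_excl_transpose:
  "op_trace N k (op_mult N k T (rho_excl N k (ptn_transpose p))) =
     (\<Sum>I\<in>double_index N k. op_vec k T I * of_bool (Ker k I = p))"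
  unfolding op_trace_op_mult
proof (rule sum.cong[OF refl])
  fix I assume I: "I \<in> double_index N k"
  define J where "J = joint k (col_index k I) (row_index k I)"
  have "J \<circ> flip = I" by (simp add: J_def joint_flip joint_row_col[OF I])
  then have "Ker k I = ptn_transpose (Ker k J)" using Ker_flip[of k J] by simp
  then have "Ker k J = ptn_transpose p \<longleftrightarrow> Ker k I = p"
    using ptn_transpose_transpose by metis
  then show "op_vec k T I * rho_excl N k (ptn_transpose p) (col_index k I) (row_index k I) =
      op_vec k T I * of_bool (Ker k I = p)"
    by (simp add: rho_excl_eq[OF row_col_in(2,1)[OF I]] flip: J_def)
qed

section \<open>Unitary matrices acting on tensors\<close>

text \<open>
  Coincides with \<open>mat_adjoint\<close>, and with the transpose on real matrices, so that the five groups share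
  one notation for the inverse.
\<close>

definition dagger :: "complex mat \<Rightarrow> complex mat" where
  "dagger g = Matrix.mat (dim_col g) (dim_row g) (\<lambda>(i, j). cnj (g $$ (j, i)))"

definition unitary_mats :: "nat \<Rightarrow> complex mat set" where
  "unitary_mats N = {g \<in> carrier_mat N N. g * dagger g = 1\<^sub>m N}"

definition real_mats :: "nat \<Rightarrow> complex mat set" where
  "real_mats N = {g \<in> carrier_mat N N. \<forall>i<N. \<forall>j<N. g $$ (i, j) \<in> \<real>}"

lemma dagger_carrier [simp]: "g \<in> carrier_mat N N \<Longrightarrow> dagger g \<in> carrier_mat N N"
  by (auto simp: dagger_def)

lemma dagger_index [simp]: "g \<in> carrier_mat N N \<Longrightarrow> i < N \<Longrightarrow> j < N \<Longrightarrow> dagger g $$ (i, j) = cnj (g $$ (j, i))"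
  by (auto simp: dagger_def)

lemma dagger_dagger: "g \<in> carrier_mat N N \<Longrightarrow> dagger (dagger g) = g"
  by (rule eq_matI) (auto simp: dagger_def)

lemma mult_index:
  assumes "g \<in> carrier_mat N N" "h \<in> carrier_mat N N" "i < N" "j < N"
  shows "(g * h) $$ (i, j) = (\<Sum>l<N. g $$ (i, l) * h $$ (l, j))"
  using assms by (simp add: scalar_prod_def atLeast0LessThan)

lemma dagger_mult:
  assumes "g \<in> carrier_mat N N" "h \<in> carrier_mat N N"
  shows "dagger (g * h) = dagger h * dagger g"
proof (rule eq_matI)
  fix i j assume "i < dim_row (dagger h * dagger g)" "j < dim_col (dagger h * dagger g)"
  then have ij: "i < N" "j < N" using assms by (auto simp: dagger_def)
  have "dagger (g * h) $$ (i, j) = cnj ((g * h) $$ (j, i))"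
    using assms ij by (intro dagger_index) auto
  also have "\<dots> = (dagger h * dagger g) $$ (i, j)"
    using assms ij by (simp add: mult_index[of _ N] mult.commute del: index_mult_mat)
  finally show "dagger (g * h) $$ (i, j) = (dagger h * dagger g) $$ (i, j)" .
qed (use assms in \<open>auto simp: dagger_def\<close>)

lemma mat_adjoint_dagger: "g \<in> carrier_mat N N \<Longrightarrow> mat_adjoint g = dagger g"
  by (rule eq_matI) (auto simp: mat_adjoint_def dagger_def mat_of_rows_def)

lemma transpose_dagger: "g \<in> real_mats N \<Longrightarrow> transpose_mat g = dagger g"
  by (rule eq_matI) (auto simp: real_mats_def dagger_def Reals_cnj_iff)

lemma unitary_left:
  assumes "g \<in> unitary_mats N" shows "dagger g * g = 1\<^sub>m N"
  using assms mat_mult_left_right_inverse[of g N "dagger g"] by (simp add: unitary_mats_def)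

lemma unitary_dagger: "g \<in> unitary_mats N \<Longrightarrow> dagger g \<in> unitary_mats N"
  using unitary_left dagger_dagger by (auto simp: unitary_mats_def)

lemma unitary_mult:
  assumes "g \<in> unitary_mats N" "h \<in> unitary_mats N" shows "g * h \<in> unitary_mats N"
proof -
  have c: "g \<in> carrier_mat N N" "h \<in> carrier_mat N N" using assms by (auto simp: unitary_mats_def)
  note d = dagger_carrier[OF c(1)] dagger_carrier[OF c(2)]
  have "h * (dagger h * dagger g) = (h * dagger h) * dagger g"
    by (rule assoc_mult_mat[symmetric, of _ N N _ N _ N]) (use c d in auto)
  also have "\<dots> = dagger g" using assms(2) d by (simp add: unitary_mats_def)
  finally have *: "h * (dagger h * dagger g) = dagger g" .
  have "(g * h) * dagger (g * h) = g * (h * (dagger h * dagger g))"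
    unfolding dagger_mult[OF c] by (rule assoc_mult_mat[of _ N N _ N _ N]) (use c d mult_carrier_mat[OF d(2,1)] in auto)
  also have "\<dots> = 1\<^sub>m N" unfolding * using assms(1) by (simp add: unitary_mats_def)
  finally show ?thesis using c by (simp add: unitary_mats_def)
qed

lemma unitary_rows:
  assumes "g \<in> unitary_mats N" "i < N" "j < N"
  shows "(\<Sum>x<N. g $$ (i, x) * cnj (g $$ (j, x))) = of_bool (i = j)"
proof -
  have c: "g \<in> carrier_mat N N" using assms by (simp add: unitary_mats_def)
  have "(\<Sum>x<N. g $$ (i, x) * cnj (g $$ (j, x))) = (g * dagger g) $$ (i, j)"
    using c assms by (simp add: mult_index[of _ N] del: index_mult_mat)
  then show ?thesis using assms by (simp add: unitary_mats_def)
qed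

text \<open>
  Boundedness of the entries makes every polynomial in them integrable over the group.
\<close>

lemma unitary_entry_le_1:
  assumes "g \<in> unitary_mats N" "i < N" "j < N"
  shows "norm (g $$ (i, j)) \<le> 1"
proof -
  have "(\<Sum>x<N. complex_of_real ((norm (g $$ (i, x)))\<^sup>2)) = 1"
    unfolding complex_norm_square using unitary_rows[OF assms(1,2,2)] by simp
  then have s: "(\<Sum>x<N. (norm (g $$ (i, x)))\<^sup>2) = 1"
    by (metis of_real_sum of_real_eq_1_iff)
  have "(norm (g $$ (i, j)))\<^sup>2 \<le> (\<Sum>x<N. (norm (g $$ (i, x)))\<^sup>2)"
    using assms by (intro member_le_sum) auto
  then show ?thesis using s by (simp add: abs_square_le_1)
qed

lemma unitary_inverse:
  assumes "g \<in> unitary_mats N"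
  shows "the (mat_inverse g) = dagger g"
proof -
  have c: "g \<in> carrier_mat N N" "dagger g \<in> carrier_mat N N" using assms by (auto simp: unitary_mats_def)
  have "g \<in> Units (ring_mat TYPE(complex) N ())"
    using c assms unitary_left[OF assms] by (auto simp: Units_def ring_mat_def unitary_mats_def)
  then obtain B where B: "mat_inverse g = Some B"
    using mat_inverse(1)[OF c(1), of "()"] by (cases "mat_inverse g") auto
  from mat_inverse(2)[OF c(1) B] have b: "g * B = 1\<^sub>m N" "B \<in> carrier_mat N N" by auto
  have "dagger g = dagger g * (g * B)" using b right_mult_one_mat[OF c(2)] by simp
  also have "\<dots> = (dagger g * g) * B" using b c by (simp add: assoc_mult_mat[of _ N N _ N _ N])
  finally have "dagger g = B" using b unitary_left[OF assms] by simp
  then show ?thesis using B by simp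
qed

lemma group_act_mult:
  assumes g: "g \<in> carrier_mat N N" and h: "h \<in> carrier_mat N N" and I: "I \<in> double_index N k"
  shows "group_act N k g (group_act N k h v) I = group_act N k (g * h) v I"
proof -
  let ?D = "double_index N k" and ?X = "points k"
  have "group_act N k g (group_act N k h v) I =
     (\<Sum>J\<in>?D. \<Sum>K\<in>?D. (\<Prod>a\<in>?X. entry g a (I a) (J a) * entry h a (J a) (K a)) * v K)"
    unfolding group_act_def sum_distrib_left prod.distrib by (simp add: mult.assoc)
  also have "\<dots> = (\<Sum>K\<in>?D. (\<Sum>J\<in>?D. \<Prod>a\<in>?X. entry g a (I a) (J a) * entry h a (J a) (K a)) * v K)"
    by (subst sum.swap) (simp add: sum_distrib_right)
  also have "\<dots> = (\<Sum>K\<in>?D. (\<Prod>a\<in>?X. entry (g * h) a (I a) (K a)) * v K)"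
  proof (rule sum.cong[OF refl])
    fix K assume K: "K \<in> ?D"
    have "(\<Sum>J\<in>?D. \<Prod>a\<in>?X. entry g a (I a) (J a) * entry h a (J a) (K a)) =
      (\<Prod>a\<in>?X. \<Sum>x<N. entry g a (I a) x * entry h a x (K a))"
      by (rule sum_double_index_prod)
    also have "\<dots> = (\<Prod>a\<in>?X. entry (g * h) a (I a) (K a))"
    proof (rule prod.cong[OF refl])
      fix a assume "a \<in> ?X"
      then have "I a < N" "K a < N" using double_index_less I K by auto
      then show "(\<Sum>x<N. entry g a (I a) x * entry h a x (K a)) = entry (g * h) a (I a) (K a)"
        by (cases a) (simp_all add: mult_index[OF g h] del: index_mult_mat)
    qed
    finally show "(\<Sum>J\<in>?D. \<Prod>a\<in>?X. entry g a (I a) (J a) * entry h a (J a) (K a)) * v K =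
       (\<Prod>a\<in>?X. entry (g * h) a (I a) (K a)) * v K" by simp
  qed
  finally show ?thesis unfolding group_act_def .
qed

lemma conjugation_eq_group_act:
  assumes g: "g \<in> unitary_mats N" and I: "I \<in> double_index N k"
  shows "op_mult N k (op_mult N k (tensor (replicate k g)) T)
       (tensor (replicate k (the (mat_inverse g)))) (row_index k I) (col_index k I) =
     group_act N k g (op_vec k T) I"
proof -
  have c: "g \<in> carrier_mat N N" using g by (simp add: unitary_mats_def)
  have t: "tensor (replicate k h) r c = (\<Prod>l<k. h $$ (r l, c l))" for h r c
    by (simp add: tensor_def)
  have "op_mult N k (op_mult N k (tensor (replicate k g)) T)
       (tensor (replicate k (the (mat_inverse g)))) (row_index k I) (col_index k I) =
     (\<Sum>t\<in>multi_index N k. \<Sum>s\<in>multi_index N k. (\<Prod>l<k. g $$ (I (Inr l), s l)) * T s t *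
        (\<Prod>l<k. dagger g $$ (t l, I (Inl l))))"
    unfolding op_mult_def t unitary_inverse[OF g] sum_distrib_right
    by (simp add: row_index_def col_index_def)
  also have "\<dots> = (\<Sum>s\<in>multi_index N k. \<Sum>t\<in>multi_index N k. (\<Prod>l<k. g $$ (I (Inr l), s l)) * T s t *
        (\<Prod>l<k. dagger g $$ (t l, I (Inl l))))"
    by (rule sum.swap)
  also have "\<dots> = group_act N k g (op_vec k T) I"
    unfolding group_act_def sum_double_index
  proof (intro sum.cong refl)
    fix s t assume st: "s \<in> multi_index N k" "t \<in> multi_index N k"
    have "(\<Prod>l<k. dagger g $$ (t l, I (Inl l))) = (\<Prod>l<k. cnj (g $$ (I (Inl l), t l)))"
    proof (rule prod.cong[OF refl])
      fix l assume l: "l \<in> {..<k}"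
      then have "t l < N" "I (Inl l) < N" using st double_index_less[OF I] by (auto simp: multi_index_def)
      then show "dagger g $$ (t l, I (Inl l)) = cnj (g $$ (I (Inl l), t l))" by (rule dagger_index[OF c])
    qed
    then show "(\<Prod>l<k. g $$ (I (Inr l), s l)) * T s t * (\<Prod>l<k. dagger g $$ (t l, I (Inl l))) =
        (\<Prod>a\<in>points k. entry g a (I a) (joint k s t a)) * op_vec k T (joint k s t)"
      using st by (simp add: prod_points op_vec_def row_col_joint mult.assoc mult.commute mult.left_commute)
  qed
  finally show ?thesis .
qed

section \<open>The five matrix groups\<close>

definition signed_perm_mat :: "nat \<Rightarrow> (nat \<Rightarrow> nat) \<Rightarrow> (nat \<Rightarrow> complex) \<Rightarrow> complex mat" where
  "signed_perm_mat N \<sigma> \<epsilon> = Matrix.mat N N (\<lambda>(i, j). if i = \<sigma> j then \<epsilon> j else 0)"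

lemma signed_perm_mat_carrier [simp]: "signed_perm_mat N \<sigma> \<epsilon> \<in> carrier_mat N N"
  by (simp add: signed_perm_mat_def)

lemma signed_perm_mat_index [simp]:
  "i < N \<Longrightarrow> j < N \<Longrightarrow> signed_perm_mat N \<sigma> \<epsilon> $$ (i, j) = (if i = \<sigma> j then \<epsilon> j else 0)"
  by (simp add: signed_perm_mat_def)

lemma permutes_less: "\<sigma> permutes {..<N} \<Longrightarrow> \<sigma> i < N \<longleftrightarrow> i < (N :: nat)"
  using permutes_in_image[of \<sigma> "{..<N}" i] by simp

lemma signed_perm_mat_mult:
  assumes "\<tau> permutes {..<N}"
  shows "signed_perm_mat N \<sigma> \<epsilon> * signed_perm_mat N \<tau> \<delta> = signed_perm_mat N (\<sigma> \<circ> \<tau>) (\<lambda>j. \<epsilon> (\<tau> j) * \<delta> j)"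
proof (rule eq_matI)
  fix i j assume "i < dim_row (signed_perm_mat N (\<sigma> \<circ> \<tau>) (\<lambda>j. \<epsilon> (\<tau> j) * \<delta> j))"
    "j < dim_col (signed_perm_mat N (\<sigma> \<circ> \<tau>) (\<lambda>j. \<epsilon> (\<tau> j) * \<delta> j))"
  then have ij: "i < N" "j < N" by (auto simp: signed_perm_mat_def)
  have "(signed_perm_mat N \<sigma> \<epsilon> * signed_perm_mat N \<tau> \<delta>) $$ (i, j) =
     (\<Sum>l<N. if l = \<tau> j then (if i = \<sigma> l then \<epsilon> l * \<delta> j else 0) else 0)"
    unfolding mult_index[OF signed_perm_mat_carrier signed_perm_mat_carrier ij]
    using ij by (intro sum.cong) auto
  also have "\<dots> = signed_perm_mat N (\<sigma> \<circ> \<tau>) (\<lambda>j. \<epsilon> (\<tau> j) * \<delta> j) $$ (i, j)"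
    using ij permutes_less[OF assms, of j] by (simp add: sum.delta')
  finally show "(signed_perm_mat N \<sigma> \<epsilon> * signed_perm_mat N \<tau> \<delta>) $$ (i, j) =
    signed_perm_mat N (\<sigma> \<circ> \<tau>) (\<lambda>j. \<epsilon> (\<tau> j) * \<delta> j) $$ (i, j)" .
qed (auto simp: signed_perm_mat_def)

lemma signed_perm_mat_dagger:
  assumes "\<sigma> permutes {..<N}"
  shows "dagger (signed_perm_mat N \<sigma> \<epsilon>) = signed_perm_mat N (inv_into UNIV \<sigma>) (\<lambda>j. cnj (\<epsilon> (inv_into UNIV \<sigma> j)))"
proof (rule eq_matI)
  fix i j assume "i < dim_row (signed_perm_mat N (inv_into UNIV \<sigma>) (\<lambda>j. cnj (\<epsilon> (inv_into UNIV \<sigma> j))))"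
    "j < dim_col (signed_perm_mat N (inv_into UNIV \<sigma>) (\<lambda>j. cnj (\<epsilon> (inv_into UNIV \<sigma> j))))"
  then have ij: "i < N" "j < N" by (auto simp: signed_perm_mat_def)
  have "j = \<sigma> i \<longleftrightarrow> i = inv_into UNIV \<sigma> j" using permutes_inverses[OF assms] by metis
  then show "dagger (signed_perm_mat N \<sigma> \<epsilon>) $$ (i, j) =
      signed_perm_mat N (inv_into UNIV \<sigma>) (\<lambda>j. cnj (\<epsilon> (inv_into UNIV \<sigma> j))) $$ (i, j)"
    using ij by (simp add: dagger_index[of _ N])
qed (auto simp: signed_perm_mat_def dagger_def)

lemma signed_perm_mat_unitary:
  assumes "\<sigma> permutes {..<N}" "\<And>j. j < N \<Longrightarrow> \<epsilon> j * cnj (\<epsilon> j) = 1"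
  shows "signed_perm_mat N \<sigma> \<epsilon> \<in> unitary_mats N"
proof -
  have i: "inv_into UNIV \<sigma> permutes {..<N}" by (rule permutes_inv[OF assms(1)])
  have "signed_perm_mat N \<sigma> \<epsilon> * dagger (signed_perm_mat N \<sigma> \<epsilon>) = 1\<^sub>m N"
    unfolding signed_perm_mat_dagger[OF assms(1)] signed_perm_mat_mult[OF i]
    by (rule eq_matI)
       (use assms(2) permutes_less[OF i] permutes_inverses[OF assms(1)] in \<open>auto simp: signed_perm_mat_def\<close>)
  then show ?thesis by (simp add: unitary_mats_def)
qed

lemma class_group_S: "class_group Class_S N = unitary_mats N"
  by (auto simp: unitary_mats_def mat_adjoint_dagger)

lemma class_group_B: "class_group Class_B N = unitary_mats N \<inter> real_mats N"
proof -
  have "g \<in> orthogonal_group N \<longleftrightarrow> g \<in> unitary_mats N \<inter> real_mats N" for g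
    using transpose_dagger[of g N] by (auto simp: orthogonal_group_def unitary_mats_def real_mats_def)
  then show ?thesis by auto
qed

lemma class_group_Bs: "class_group Class_Bs N = {g \<in> unitary_mats N \<inter> real_mats N.
     (\<forall>i<N. (\<Sum>j<N. g $$ (i, j)) = 1) \<and> (\<forall>j<N. (\<Sum>i<N. g $$ (i, j)) = 1)}"
  using class_group_B[of N] by simp

lemma class_group_H: "class_group Class_H N =
    {signed_perm_mat N \<sigma> \<epsilon> | \<sigma> \<epsilon>. \<sigma> permutes {..<N} \<and> (\<forall>j<N. \<epsilon> j \<in> {1, -1})}"
  by (simp add: signed_perm_mat_def)

lemma class_group_P: "class_group Class_P N = {signed_perm_mat N \<sigma> (\<lambda>_. 1) | \<sigma>. \<sigma> permutes {..<N}}"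
  by (simp add: signed_perm_mat_def)

lemmas class_group_eqs = class_group_S class_group_B class_group_Bs class_group_H class_group_P

declare class_group.simps [simp del]

text \<open>
  Unitarity is what turns conjugation by a group element into \<open>group_act\<close>.
\<close>

lemma class_group_unitary: "class_group A N \<subseteq> unitary_mats N"
proof (cases A)
  case Class_H
  then show ?thesis unfolding Class_H class_group_H
    by (auto intro!: signed_perm_mat_unitary)
next
  case Class_P
  then show ?thesis unfolding Class_P class_group_P by (auto intro!: signed_perm_mat_unitary)
qed (auto simp: class_group_eqs)

lemma class_group_carrier: "g \<in> class_group A N \<Longrightarrow> g \<in> carrier_mat N N"
  using class_group_unitary by (auto simp: unitary_mats_def)

lemma real_mats_mult:
  assumes "g \<in> real_mats N" "h \<in> real_mats N" shows "g * h \<in> real_mats N"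
proof -
  have c: "g \<in> carrier_mat N N" "h \<in> carrier_mat N N" using assms by (auto simp: real_mats_def)
  have "(g * h) $$ (i, j) \<in> \<real>" if "i < N" "j < N" for i j
    unfolding mult_index[OF c that] using assms that
    by (intro sum_in_Reals Reals_mult) (auto simp: real_mats_def)
  then show ?thesis using c by (auto simp: real_mats_def)
qed

lemma real_mats_dagger: 
  assumes "g \<in> real_mats N" shows "dagger g \<in> real_mats N"
proof -
  have c: "g \<in> carrier_mat N N" using assms by (auto simp: real_mats_def)
  have "dagger g $$ (i, j) \<in> \<real>" if "i < N" "j < N" for i j
    unfolding dagger_index[OF c that] using assms that by (simp add: real_mats_def Reals_cnj_iff)
  then show ?thesis using c by (auto simp: real_mats_def)
qed

lemma class_group_mult:
  assumes "g \<in> class_group A N" "h \<in> class_group A N"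
  shows "g * h \<in> class_group A N"
proof (cases A)
  case Class_S
  with assms show ?thesis by (simp add: class_group_S unitary_mult)
next
  case Class_B
  with assms show ?thesis by (simp add: class_group_B unitary_mult real_mats_mult)
next
  case Class_Bs
  note c = assms[THEN class_group_carrier]
  have r: "(\<Sum>j<N. (g * h) $$ (i, j)) = 1" if i: "i < N" for i
  proof -
    have "(\<Sum>j<N. (g * h) $$ (i, j)) = (\<Sum>j<N. \<Sum>l<N. g $$ (i, l) * h $$ (l, j))"
      using i by (intro sum.cong) (auto simp: mult_index[OF c] simp del: index_mult_mat)
    also have "\<dots> = (\<Sum>l<N. g $$ (i, l) * (\<Sum>j<N. h $$ (l, j)))"
      by (subst sum.swap) (simp add: sum_distrib_left)
    finally show ?thesis using assms i by (simp add: Class_Bs class_group_Bs)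
  qed
  have s: "(\<Sum>i<N. (g * h) $$ (i, j)) = 1" if j: "j < N" for j
  proof -
    have "(\<Sum>i<N. (g * h) $$ (i, j)) = (\<Sum>i<N. \<Sum>l<N. g $$ (i, l) * h $$ (l, j))"
      using j by (intro sum.cong) (auto simp: mult_index[OF c] simp del: index_mult_mat)
    also have "\<dots> = (\<Sum>l<N. (\<Sum>i<N. g $$ (i, l)) * h $$ (l, j))"
      by (subst sum.swap) (simp add: sum_distrib_right)
    finally show ?thesis using assms j by (simp add: Class_Bs class_group_Bs)
  qed
  show ?thesis using assms r s
    by (simp add: Class_Bs class_group_Bs unitary_mult real_mats_mult del: index_mult_mat)
next
  case Class_H
  from assms obtain \<sigma> \<epsilon> \<tau> \<delta> where gh: "g = signed_perm_mat N \<sigma> \<epsilon>" "h = signed_perm_mat N \<tau> \<delta>"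
    and p: "\<sigma> permutes {..<N}" "\<tau> permutes {..<N}"
    and e: "\<forall>j<N. \<epsilon> j \<in> {1, -1}" "\<forall>j<N. \<delta> j \<in> {1, -1}"
    by (auto simp: Class_H class_group_H)
  have "\<forall>j<N. \<epsilon> (\<tau> j) * \<delta> j \<in> {1, -1}"
  proof (intro allI impI)
    fix j assume "j < N"
    then have "\<epsilon> (\<tau> j) \<in> {1, -1}" "\<delta> j \<in> {1, -1}" using e permutes_less[OF p(2)] by simp_all
    then show "\<epsilon> (\<tau> j) * \<delta> j \<in> {1, -1}" by auto
  qed
  then show ?thesis
    unfolding gh signed_perm_mat_mult[OF p(2)] Class_H class_group_H
    using permutes_compose[OF p(2,1)] by blast
next
  case Class_P
  from assms obtain \<sigma> \<tau> where gh: "g = signed_perm_mat N \<sigma> (\<lambda>_. 1)" "h = signed_perm_mat N \<tau> (\<lambda>_. 1)"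
    and p: "\<sigma> permutes {..<N}" "\<tau> permutes {..<N}"
    by (auto simp: Class_P class_group_P)
  show ?thesis
    unfolding gh signed_perm_mat_mult[OF p(2)] Class_P class_group_P
    using permutes_compose[OF p(2,1)] by auto
qed

lemma class_group_dagger:
  assumes "g \<in> class_group A N"
  shows "dagger g \<in> class_group A N"
proof (cases A)
  case Class_S
  with assms show ?thesis by (simp add: class_group_S unitary_dagger)
next
  case Class_B
  with assms show ?thesis by (simp add: class_group_B unitary_dagger real_mats_dagger)
next
  case Class_Bs
  note c = class_group_carrier[OF assms]
  have "(\<Sum>j<N. dagger g $$ (i, j)) = 1" if "i < N" for i
  proof -
    have "(\<Sum>j<N. dagger g $$ (i, j)) = cnj (\<Sum>j<N. g $$ (j, i))" using that c by simp
    then show ?thesis using assms that by (simp add: Class_Bs class_group_Bs del: cnj_sum)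
  qed
  moreover have "(\<Sum>i<N. dagger g $$ (i, j)) = 1" if "j < N" for j
  proof -
    have "(\<Sum>i<N. dagger g $$ (i, j)) = cnj (\<Sum>i<N. g $$ (j, i))" using that c by simp
    then show ?thesis using assms that by (simp add: Class_Bs class_group_Bs del: cnj_sum)
  qed
  ultimately show ?thesis using assms
    by (simp add: Class_Bs class_group_Bs unitary_dagger real_mats_dagger)
next
  case Class_H
  from assms obtain \<sigma> \<epsilon> where g: "g = signed_perm_mat N \<sigma> \<epsilon>" and p: "\<sigma> permutes {..<N}"
    and e: "\<forall>j<N. \<epsilon> j \<in> {1, -1}"
    by (auto simp: Class_H class_group_H)
  have i: "inv_into UNIV \<sigma> permutes {..<N}" by (rule permutes_inv[OF p])
  have "\<forall>j<N. cnj (\<epsilon> (inv_into UNIV \<sigma> j)) \<in> {1, -1}"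
  proof (intro allI impI)
    fix j assume "j < N"
    then have "\<epsilon> (inv_into UNIV \<sigma> j) \<in> {1, -1}" using e permutes_less[OF i] by simp
    then show "cnj (\<epsilon> (inv_into UNIV \<sigma> j)) \<in> {1, -1}" by auto
  qed
  then show ?thesis
    unfolding g signed_perm_mat_dagger[OF p] Class_H class_group_H using i by blast
next
  case Class_P
  from assms obtain \<sigma> where g: "g = signed_perm_mat N \<sigma> (\<lambda>_. 1)" and p: "\<sigma> permutes {..<N}"
    by (auto simp: Class_P class_group_P)
  have i: "inv_into UNIV \<sigma> permutes {..<N}" by (rule permutes_inv[OF p])
  then show ?thesis
    unfolding g signed_perm_mat_dagger[OF p] Class_P class_group_P by auto
qed

section \<open>Partitions of a class are fixed by its group\<close>

lemma entry_real: "g \<in> real_mats N \<Longrightarrow> x < N \<Longrightarrow> y < N \<Longrightarrow> entry g a x y = g $$ (x, y)"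
  by (cases a) (auto simp: real_mats_def Reals_cnj_iff)

text \<open>
  Orthonormality of the rows. Without reality of the entries the two points must lie on opposite sides,
  so that exactly one of the two factors is conjugated.
\<close>

lemma pair_block_sum:
  assumes g: "g \<in> unitary_mats N" and r: "g \<in> real_mats N \<or> (\<exists>i j. b = {Inl i, Inr j})"
    and b: "card b = 2" and I: "\<And>a. a \<in> b \<Longrightarrow> I a < N"
  shows "(\<Sum>x<N. \<Prod>a\<in>b. entry g a (I a) x) = of_bool (\<forall>x\<in>b. \<forall>y\<in>b. I x = I y)"
proof -
  have *: "(\<Sum>x<N. entry g a (I a) x * entry g c (I c) x) = of_bool (I a = I c)"
    if ab: "a \<in> b" and cb: "c \<in> b" and ac: "g \<in> real_mats N \<or> (\<exists>i j. a = Inr i \<and> c = Inl j)" for a c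
  proof -
    have "entry g a (I a) x * entry g c (I c) x = g $$ (I a, x) * cnj (g $$ (I c, x))" if "x < N" for x
      using ac
    proof
      assume "g \<in> real_mats N"
      moreover from this have "cnj (g $$ (I c, x)) = g $$ (I c, x)"
        using I[OF cb] \<open>x < N\<close> by (simp add: real_mats_def Reals_cnj_iff)
      ultimately show ?thesis using entry_real I[OF ab] I[OF cb] \<open>x < N\<close> by metis
    qed auto
    then show ?thesis using unitary_rows[OF g I[OF ab] I[OF cb]] by simp
  qed
  obtain a c where ac: "b = {a, c}" "a \<noteq> c" "g \<in> real_mats N \<or> (\<exists>i j. a = Inr i \<and> c = Inl j)"
  proof (cases "g \<in> real_mats N")
    case True
    then show ?thesis using b that unfolding card_2_iff by blast
  next
    case False
    then obtain i j where "b = {Inl i, Inr j}" using r by blast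
    then show ?thesis using that[of "Inr j" "Inl i"] by blast
  qed
  have "(\<Sum>x<N. \<Prod>a\<in>b. entry g a (I a) x) = (\<Sum>x<N. entry g a (I a) x * entry g c (I c) x)"
    using ac by simp
  also have "\<dots> = of_bool (I a = I c)" by (rule *) (use ac in simp_all)
  also have "I a = I c \<longleftrightarrow> (\<forall>x\<in>b. \<forall>y\<in>b. I x = I y)" unfolding ac(1) by auto
  finally show ?thesis .
qed

text \<open>
  A signed permutation matrix has one non-zero entry in each row; the signs cancel in blocks of even
  size.
\<close>

lemma signed_perm_block_sum:
  assumes \<sigma>: "\<sigma> permutes {..<N}" and \<epsilon>: "\<And>j. j < N \<Longrightarrow> \<epsilon> j \<in> {1, -1}"
    and e: "even (card b) \<or> (\<forall>j<N. \<epsilon> j = 1)"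
    and b: "b \<noteq> {}" "finite b" and I: "\<And>a. a \<in> b \<Longrightarrow> I a < N"
  shows "(\<Sum>x<N. \<Prod>a\<in>b. entry (signed_perm_mat N \<sigma> \<epsilon>) a (I a) x) = of_bool (\<forall>x\<in>b. \<forall>y\<in>b. I x = I y)"
proof -
  obtain a0 where a0: "a0 \<in> b" using b by auto
  have pr: "(\<Prod>a\<in>b. entry (signed_perm_mat N \<sigma> \<epsilon>) a (I a) x) = of_bool (\<forall>a\<in>b. I a = \<sigma> x)"
    if x: "x < N" for x
  proof -
    have "(\<Prod>a\<in>b. entry (signed_perm_mat N \<sigma> \<epsilon>) a (I a) x) =
        (\<Prod>a\<in>b. if I a = \<sigma> x then \<epsilon> x else 0)"
    proof (rule prod.cong[OF refl])
      fix a assume "a \<in> b"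
      then show "entry (signed_perm_mat N \<sigma> \<epsilon>) a (I a) x = (if I a = \<sigma> x then \<epsilon> x else 0)"
        using I[of a] \<epsilon>[OF x] x by (cases a) auto
    qed
    also have "\<dots> = of_bool (\<forall>a\<in>b. I a = \<sigma> x)"
    proof (cases "\<forall>a\<in>b. I a = \<sigma> x")
      case True
      then have "(\<Prod>a\<in>b. if I a = \<sigma> x then \<epsilon> x else 0) = \<epsilon> x ^ card b" by simp
      also have "\<dots> = 1" using e \<epsilon>[OF x] x by (auto simp: uminus_power_if)
      finally show ?thesis using True by simp
    next
      case False
      then show ?thesis using b by (auto intro!: prod_zero)
    qed
    finally show ?thesis .
  qed
  have "(\<Sum>x<N. \<Prod>a\<in>b. entry (signed_perm_mat N \<sigma> \<epsilon>) a (I a) x) =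
     (\<Sum>x<N. if x = inv_into UNIV \<sigma> (I a0) then of_bool (\<forall>x\<in>b. \<forall>y\<in>b. I x = I y) else 0)"
  proof (rule sum.cong[OF refl])
    fix x assume "x \<in> {..<N}"
    have "x = inv_into UNIV \<sigma> (I a0) \<longleftrightarrow> I a0 = \<sigma> x" using permutes_inverses[OF \<sigma>] by metis
    then have "(\<forall>a\<in>b. I a = \<sigma> x) \<longleftrightarrow> x = inv_into UNIV \<sigma> (I a0) \<and> (\<forall>x\<in>b. \<forall>y\<in>b. I x = I y)"
      using a0 by metis
    then show "(\<Prod>a\<in>b. entry (signed_perm_mat N \<sigma> \<epsilon>) a (I a) x) =
       (if x = inv_into UNIV \<sigma> (I a0) then of_bool (\<forall>x\<in>b. \<forall>y\<in>b. I x = I y) else 0)"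
      using pr[of x] \<open>x \<in> {..<N}\<close> by simp
  qed
  also have "\<dots> = of_bool (\<forall>x\<in>b. \<forall>y\<in>b. I x = I y)"
    using permutes_less[OF permutes_inv[OF \<sigma>]] I[OF a0] by (simp add: sum.delta)
  finally show ?thesis .
qed

text \<open>
  The condition that defines each class is what makes this identity hold: orthonormal rows allow
  blocks of size 2 (with one point on each side in the unitary case), unit row sums allow singletons,
  monomial matrices with signs allow all even blocks, and without signs all blocks.
\<close>

lemma class_block_sum:
  assumes g: "g \<in> class_group A N" and p: "p \<in> class_ptns A k" and b: "b \<in> p"
    and I: "\<And>a. a \<in> b \<Longrightarrow> I a < N"
  shows "(\<Sum>x<N. \<Prod>a\<in>b. entry g a (I a) x) = of_bool (\<forall>x\<in>b. \<forall>y\<in>b. I x = I y)"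
proof -
  have P: "partition_on (points k) p" using p class_ptns_partitions by (auto simp: partitions_def)
  have bn: "b \<noteq> {}" using partition_onD3[OF P] b by auto
  have bf: "finite b" using partition_onD1[OF P] b finite_points by (metis Sup_upper finite_subset)
  note u = subsetD[OF class_group_unitary g]
  show ?thesis
  proof (cases A)
    case Class_S
    then obtain i j where ij: "b = {Inl i, Inr j}" using p b unfolding Class_S class_S_eq by blast
    show ?thesis by (rule pair_block_sum[OF u _ _ I]) (use ij in auto)
  next
    case Class_B
    show ?thesis by (rule pair_block_sum[OF u _ _ I]) (use p b g in \<open>auto simp: Class_B class_group_B\<close>)
  next
    case Class_Bs
    have r: "g \<in> real_mats N" and s: "\<forall>i<N. (\<Sum>j<N. g $$ (i, j)) = 1"
      using g by (auto simp: Class_Bs class_group_Bs)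
    have "card b \<le> 2" using p b by (simp add: Class_Bs)
    moreover have "card b \<noteq> 0" using bn bf by simp
    ultimately consider "card b = 2" | "card b = 1" by linarith
    then show ?thesis
    proof cases
      case 1
      show ?thesis by (rule pair_block_sum[OF u _ 1 I]) (use r in auto)
    next
      case 2
      then obtain a where a: "b = {a}" by (auto simp: card_1_singleton_iff)
      then show ?thesis using I[of a] s entry_real[OF r, of "I a"] by simp
    qed
  next
    case Class_H
    from g obtain \<sigma> \<epsilon> where *: "g = signed_perm_mat N \<sigma> \<epsilon>" "\<sigma> permutes {..<N}" "\<forall>j<N. \<epsilon> j \<in> {1, -1}"
      by (auto simp: Class_H class_group_H)
    show ?thesis unfolding *(1)
      by (rule signed_perm_block_sum[OF *(2) _ _ bn bf I]) (use * p b in \<open>auto simp: Class_H\<close>)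
  next
    case Class_P
    from g obtain \<sigma> where *: "g = signed_perm_mat N \<sigma> (\<lambda>_. 1)" "\<sigma> permutes {..<N}"
      by (auto simp: Class_P class_group_P)
    show ?thesis unfolding *(1)
      by (rule signed_perm_block_sum[OF *(2) _ _ bn bf I]) auto
  qed
qed

text \<open>
  The operators \<open>rho N k p\<close> for \<open>p\<close> in the class commute with the tensor powers of the group elements.
\<close>

lemma group_act_blockconst:
  assumes g: "g \<in> class_group A N" and p: "p \<in> class_ptns A k" and I: "I \<in> double_index N k"
  shows "group_act N k g (\<lambda>J. of_bool (blockconst p J)) I = of_bool (blockconst p I)"
proof -
  have P: "partition_on (points k) p" using p class_ptns_partitions by (auto simp: partitions_def)
  have fp: "finite p" using finite_elements[OF _ P] by simp
  have "group_act N k g (\<lambda>J. of_bool (blockconst p J)) I =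
      (\<Sum>J\<in>double_index N k. if blockconst p J then \<Prod>a\<in>points k. entry g a (I a) (J a) else 0)"
    unfolding group_act_def
  proof (rule sum.cong[OF refl])
    fix J show "(\<Prod>a\<in>points k. entry g a (I a) (J a)) * of_bool (blockconst p J) =
        (if blockconst p J then \<Prod>a\<in>points k. entry g a (I a) (J a) else 0)"
      by (cases "blockconst p J") simp_all
  qed
  also have "\<dots> = (\<Sum>J | J \<in> points k \<rightarrow>\<^sub>E {..<N} \<and> blockconst p J. \<Prod>a\<in>points k. entry g a (I a) (J a))"
    unfolding double_index_def by (rule sum.inter_filter[symmetric]) (auto intro: finite_PiE)
  also have "\<dots> = (\<Prod>b\<in>p. \<Sum>x<N. \<Prod>a\<in>b. entry g a (I a) x)"
    by (rule sum_blockconst_prod[OF P]) auto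
  also have "\<dots> = (\<Prod>b\<in>p. of_bool (\<forall>x\<in>b. \<forall>y\<in>b. I x = I y))"
  proof (rule prod.cong[OF refl])
    fix b assume b: "b \<in> p"
    then have "b \<subseteq> points k" using partition_onD1[OF P] by auto
    then show "(\<Sum>x<N. \<Prod>a\<in>b. entry g a (I a) x) = of_bool (\<forall>x\<in>b. \<forall>y\<in>b. I x = I y)"
      using double_index_less[OF I] by (intro class_block_sum[OF g p b]) blast
  qed
  also have "\<dots> = of_bool (blockconst p I)"
    unfolding blockconst_def by (rule prod_of_bool[OF fp])
  finally show ?thesis .
qed

text \<open>
  The same invariance moved to the other side of the pairing, by applying it to the adjoint of \<open>g\<close>.
\<close>

lemma blockconst_group_act_pairing:
  assumes g: "g \<in> class_group A N" and p: "p \<in> class_ptns A k"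
  shows "(\<Sum>I\<in>double_index N k. group_act N k g v I * of_bool (blockconst p I)) =
    (\<Sum>J\<in>double_index N k. v J * of_bool (blockconst p J))"
proof -
  let ?D = "double_index N k"
  note c = class_group_carrier[OF g]
  have *: "(\<Sum>I\<in>?D. (\<Prod>a\<in>points k. entry g a (I a) (J a)) * of_bool (blockconst p I)) = of_bool (blockconst p J)"
    if J: "J \<in> ?D" for J
  proof -
    have e: "entry g a x y = cnj (entry (dagger g) a y x)" if "x < N" "y < N" for a x y
      using that c by (cases a) auto
    have "(\<Sum>I\<in>?D. (\<Prod>a\<in>points k. entry g a (I a) (J a)) * of_bool (blockconst p I)) =
      (\<Sum>I\<in>?D. cnj ((\<Prod>a\<in>points k. entry (dagger g) a (J a) (I a)) * of_bool (blockconst p I)))"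
      using e double_index_less[OF J] double_index_less by (intro sum.cong) auto
    also have "\<dots> = cnj (group_act N k (dagger g) (\<lambda>J. of_bool (blockconst p J)) J)"
      by (simp only: group_act_def cnj_sum)
    finally show ?thesis
      unfolding group_act_blockconst[OF class_group_dagger[OF g] p J] by simp
  qed
  have "(\<Sum>I\<in>?D. group_act N k g v I * of_bool (blockconst p I)) =
     (\<Sum>I\<in>?D. \<Sum>J\<in>?D. v J * ((\<Prod>a\<in>points k. entry g a (I a) (J a)) * of_bool (blockconst p I)))"
    unfolding group_act_def sum_distrib_right by (intro sum.cong refl) (simp add: mult_ac)
  also have "\<dots> = (\<Sum>J\<in>?D. v J * (\<Sum>I\<in>?D. (\<Prod>a\<in>points k. entry g a (I a) (J a)) * of_bool (blockconst p I)))"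
    by (subst sum.swap) (simp only: sum_distrib_left)
  also have "\<dots> = (\<Sum>J\<in>?D. v J * of_bool (blockconst p J))"
    by (rule sum.cong[OF refl]) (simp only: *)
  finally show ?thesis .
qed

section \<open>Invariant tensors: permutations and phases\<close>

definition invariant_vec :: "ptn_class \<Rightarrow> nat \<Rightarrow> nat \<Rightarrow> ((point \<Rightarrow> nat) \<Rightarrow> complex) \<Rightarrow> bool" where
  "invariant_vec A N k v \<longleftrightarrow>
     (\<forall>g\<in>class_group A N. \<forall>I\<in>double_index N k. group_act N k g v I = v I)"

lemma invariant_vecD:
  "invariant_vec A N k v \<Longrightarrow> g \<in> class_group A N \<Longrightarrow> I \<in> double_index N k \<Longrightarrow> group_act N k g v I = v I"
  by (simp add: invariant_vec_def)

definition phase :: "point \<Rightarrow> complex \<Rightarrow> complex" where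
  "phase a z = (case a of Inl _ \<Rightarrow> cnj z | Inr _ \<Rightarrow> z)"

lemma phase_simps [simp]: "phase (Inl i) z = cnj z" "phase (Inr i) z = z"
  by (simp_all add: phase_def)

lemma phase_1 [simp]: "phase a 1 = 1"
  by (cases a) auto

lemma group_act_monomial:
  assumes \<sigma>: "\<sigma> permutes {..<N}" and I: "I \<in> double_index N k"
  shows "group_act N k (signed_perm_mat N \<sigma> \<epsilon>) v I =
    (\<Prod>a\<in>points k. phase a (\<epsilon> (inv_into UNIV \<sigma> (I a)))) * v (\<lambda>a\<in>points k. inv_into UNIV \<sigma> (I a))"
proof -
  let ?i = "inv_into UNIV \<sigma>"
  define J0 where "J0 = (\<lambda>a\<in>points k. ?i (I a))"
  have J0: "J0 \<in> double_index N k"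
    unfolding double_index_def J0_def
    using permutes_less[OF permutes_inv[OF \<sigma>]] double_index_less[OF I] by simp
  have inv: "x = \<sigma> y \<longleftrightarrow> y = ?i x" for x y using permutes_inverses[OF \<sigma>] by metis
  have "(\<Prod>a\<in>points k. entry (signed_perm_mat N \<sigma> \<epsilon>) a (I a) (J a)) * v J =
      (if J = J0 then (\<Prod>a\<in>points k. phase a (\<epsilon> (?i (I a)))) * v J else 0)" if J: "J \<in> double_index N k" for J
  proof -
    have e: "entry (signed_perm_mat N \<sigma> \<epsilon>) a (I a) (J a) = (if J a = J0 a then phase a (\<epsilon> (?i (I a))) else 0)"
      if a: "a \<in> points k" for a
      using double_index_less[OF I a] double_index_less[OF J a] a by (cases a) (auto simp: J0_def inv)
    show ?thesis
    proof (cases "J = J0")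
      case True
      then have "(\<Prod>a\<in>points k. entry (signed_perm_mat N \<sigma> \<epsilon>) a (I a) (J a)) =
         (\<Prod>a\<in>points k. phase a (\<epsilon> (?i (I a))))"
      proof (intro prod.cong refl)
        fix a assume "a \<in> points k"
        then show "entry (signed_perm_mat N \<sigma> \<epsilon>) a (I a) (J a) = phase a (\<epsilon> (?i (I a)))"
          using e[of a] True by simp
      qed
      with True show ?thesis by simp
    next
      case False
      then obtain a where "a \<in> points k" "J a \<noteq> J0 a" using double_index_eqI[OF J J0] by metis
      then have "(\<Prod>a\<in>points k. entry (signed_perm_mat N \<sigma> \<epsilon>) a (I a) (J a)) = 0"
        using e by (intro prod_zero) (simp, metis)
      with False show ?thesis by simp
    qed
  qed
  then have "group_act N k (signed_perm_mat N \<sigma> \<epsilon>) v I =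
     (\<Sum>J\<in>double_index N k. if J = J0 then (\<Prod>a\<in>points k. phase a (\<epsilon> (?i (I a)))) * v J else 0)"
    unfolding group_act_def by (rule sum.cong[OF refl])
  also have "\<dots> = (\<Prod>a\<in>points k. phase a (\<epsilon> (?i (I a)))) * v J0"
    using J0 by (simp add: sum.delta)
  finally show ?thesis by (simp add: J0_def)
qed

text \<open>
  This is why the coefficients of invariant tensors depend on kernels only.
\<close>

lemma permutation_mat_in_class_group:
  assumes "\<sigma> permutes {..<N}"
  shows "signed_perm_mat N \<sigma> (\<lambda>_. 1) \<in> class_group A N"
proof -
  let ?g = "signed_perm_mat N \<sigma> (\<lambda>_. 1)"
  have u: "?g \<in> unitary_mats N" by (rule signed_perm_mat_unitary[OF assms]) simp
  have r: "?g \<in> real_mats N" by (simp add: real_mats_def)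
  have inv: "i = \<sigma> j \<longleftrightarrow> j = inv_into UNIV \<sigma> i" for i j using permutes_inverses[OF assms] by metis
  have "(\<Sum>j<N. ?g $$ (i, j)) = 1" if i: "i < N" for i
  proof -
    have "(\<Sum>j<N. ?g $$ (i, j)) = (\<Sum>j<N. if j = inv_into UNIV \<sigma> i then 1 else 0)"
      using i by (intro sum.cong) (auto simp: inv)
    then show ?thesis using permutes_less[OF permutes_inv[OF assms], of i] i by simp
  qed
  moreover have "(\<Sum>i<N. ?g $$ (i, j)) = 1" if j: "j < N" for j
    using permutes_less[OF assms, of j] j by simp
  ultimately show ?thesis using u r assms
    by (cases A) (auto simp: class_group_eqs)
qed

text \<open>
  The bijection between the sets of values of \<open>J\<close> and \<open>I\<close> extends to \<open>{..<N}\<close>, because the two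
  complements have the same size.
\<close>

lemma exists_permutation_between:
  assumes I: "I \<in> double_index N k" and J: "J \<in> double_index N k" and K: "Ker k I = Ker k J"
  obtains \<sigma> where "\<sigma> permutes {..<N}" "\<And>a. a \<in> points k \<Longrightarrow> \<sigma> (J a) = I a"
proof -
  let ?X = "points k"
  have eq: "I a = I b \<longleftrightarrow> J a = J b" if ab: "a \<in> ?X" "b \<in> ?X" for a b
    using Ker_block[of a k I] Ker_block[of a k J] K ab by (metis (mono_tags, lifting) mem_Collect_eq)
  define f where "f y = I (SOME a. a \<in> ?X \<and> J a = y)" for y
  have f: "f (J a) = I a" if "a \<in> ?X" for a
  proof -
    have "(SOME b. b \<in> ?X \<and> J b = J a) \<in> ?X \<and> J (SOME b. b \<in> ?X \<and> J b = J a) = J a"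
      by (rule someI[of "\<lambda>b. b \<in> ?X \<and> J b = J a" a]) (use that in simp)
    then show ?thesis unfolding f_def using eq that by blast
  qed
  have "bij_betw f (J ` ?X) (I ` ?X)"
  proof (rule bij_betw_imageI)
    show "inj_on f (J ` ?X)"
    proof (rule inj_onI)
      fix x y assume "x \<in> J ` ?X" "y \<in> J ` ?X" "f x = f y"
      then obtain a b where "a \<in> ?X" "b \<in> ?X" "x = J a" "y = J b" "I a = I b" using f by (metis imageE)
      then show "x = y" using eq by simp
    qed
    show "f ` J ` ?X = I ` ?X" using f by (simp add: image_image)
  qed
  moreover obtain h where h: "bij_betw h ({..<N} - J ` ?X) ({..<N} - I ` ?X)"
  proof -
    have sub: "J ` ?X \<subseteq> {..<N}" "I ` ?X \<subseteq> {..<N}" using double_index_less I J by blast+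
    have "card (J ` ?X) = card (I ` ?X)" using bij_betw_same_card[OF calculation] .
    then have "card ({..<N} - J ` ?X) = card ({..<N} - I ` ?X)"
      using sub by (simp add: card_Diff_subset finite_subset)
    then show ?thesis using that finite_same_card_bij[of "{..<N} - J ` ?X" "{..<N} - I ` ?X"] by auto
  qed
  define \<sigma> where "\<sigma> y = (if y \<in> J ` ?X then f y else if y < N then h y else y)" for y
  have "bij_betw \<sigma> (J ` ?X \<union> ({..<N} - J ` ?X)) (I ` ?X \<union> ({..<N} - I ` ?X))"
  proof (rule bij_betw_combine)
    show "bij_betw \<sigma> (J ` ?X) (I ` ?X)"
      using calculation by (subst bij_betw_cong[of _ _ f]) (auto simp: \<sigma>_def)
    show "bij_betw \<sigma> ({..<N} - J ` ?X) ({..<N} - I ` ?X)"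
      using h by (subst bij_betw_cong[of _ _ h]) (auto simp: \<sigma>_def)
  qed auto
  moreover have "J ` ?X \<union> ({..<N} - J ` ?X) = {..<N}" "I ` ?X \<union> ({..<N} - I ` ?X) = {..<N}"
    using double_index_less I J by blast+
  ultimately have "bij_betw \<sigma> {..<N} {..<N}" by simp
  moreover have "\<sigma> y = y" if "y \<notin> {..<N}" for y
    using that double_index_less[OF J] by (auto simp: \<sigma>_def)
  ultimately have "\<sigma> permutes {..<N}" by (rule bij_imp_permutes)
  moreover have "\<sigma> (J a) = I a" if "a \<in> ?X" for a using that f by (simp add: \<sigma>_def)
  ultimately show ?thesis using that by blast
qed

lemma invariant_vec_Ker:
  assumes v: "invariant_vec A N k v" and I: "I \<in> double_index N k" and J: "J \<in> double_index N k"
    and K: "Ker k I = Ker k J"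
  shows "v I = v J"
proof -
  obtain \<sigma> where \<sigma>: "\<sigma> permutes {..<N}" "\<And>a. a \<in> points k \<Longrightarrow> \<sigma> (J a) = I a"
    using exists_permutation_between[OF I J K] by metis
  have "(\<lambda>a\<in>points k. inv_into UNIV \<sigma> (I a)) = J"
  proof
    fix a show "(\<lambda>a\<in>points k. inv_into UNIV \<sigma> (I a)) a = J a"
    proof (cases "a \<in> points k")
      case True
      have "inv_into UNIV \<sigma> (I a) = inv_into UNIV \<sigma> (\<sigma> (J a))" using \<sigma>(2)[OF True] by simp
      also have "\<dots> = J a" by (rule permutes_inverses(2)[OF \<sigma>(1)])
      finally show ?thesis using True by simp
    next
      case False
      then show ?thesis using J PiE_arb[of J "points k"] by (simp add: double_index_def)
    qed
  qed
  then have "group_act N k (signed_perm_mat N \<sigma> (\<lambda>_. 1)) v I = v J"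
    unfolding group_act_monomial[OF \<sigma>(1) I] by simp
  then show ?thesis
    using invariant_vecD[OF v permutation_mat_in_class_group[OF \<sigma>(1)] I] by simp
qed

text \<open>
  The diagonal matrix with entry \<open>z\<close> at \<open>x\<close> and 1 elsewhere multiplies the coefficient at \<open>I\<close> by one
  factor \<open>z\<close> or its conjugate for each point where \<open>I\<close> takes the value \<open>x\<close>.
\<close>

lemma invariant_vec_phase_zero:
  assumes v: "invariant_vec A N k v" and I: "I \<in> double_index N k"
    and g: "signed_perm_mat N id ((\<lambda>_. 1)(x := z)) \<in> class_group A N"
    and z: "(\<Prod>a | a \<in> points k \<and> I a = x. phase a z) \<noteq> 1"
  shows "v I = 0"
proof -
  have i: "inv_into UNIV (id :: nat \<Rightarrow> nat) = id" by (rule inv_id)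
  have "(\<lambda>a\<in>points k. I a) = I"
    using I unfolding double_index_def by (simp add: PiE_restrict restrict_def PiE_iff extensional_def fun_eq_iff)
  then have "v I = (\<Prod>a\<in>points k. phase a (((\<lambda>_. 1)(x := z)) (I a))) * v I"
    using invariant_vecD[OF v g I] group_act_monomial[OF permutes_id I, of "(\<lambda>_. 1)(x := z)" v] i by simp
  also have "(\<Prod>a\<in>points k. phase a (((\<lambda>_. 1)(x := z)) (I a))) = (\<Prod>a\<in>points k. if I a = x then phase a z else 1)"
    by (intro prod.cong) auto
  also have "\<dots> = (\<Prod>a | a \<in> points k \<and> I a = x. phase a z)"
    by (rule prod.inter_filter[symmetric]) simp
  finally show ?thesis using z by simp
qed

section \<open>Infinitesimal invariance\<close>

lemma sum_single_change:
  assumes I: "I \<in> double_index N k" and a: "a \<in> points k"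
  shows "(\<Sum>J\<in>double_index N k. f (J a) * (\<Prod>b\<in>points k - {a}. of_bool (I b = J b)) * v J) =
    (\<Sum>j<N. f j * v (I(a := j)) :: complex)"
proof -
  let ?D = "double_index N k"
  let ?S = "(\<lambda>j. I(a := j)) ` {..<N}"
  have upd: "I(a := j) \<in> ?D" if "j < N" for j
    unfolding double_index_def
  proof (rule PiE_I)
    fix b assume "b \<in> points k"
    then show "(I(a := j)) b \<in> {..<N}" using that double_index_less[OF I] by simp
  next
    fix b assume "b \<notin> points k"
    then show "(I(a := j)) b = undefined" using a I PiE_arb[of I "points k"] by (auto simp: double_index_def)
  qed
  have "(\<Sum>J\<in>?D. f (J a) * (\<Prod>b\<in>points k - {a}. of_bool (I b = J b)) * v J) =
     (\<Sum>J\<in>?S. f (J a) * (\<Prod>b\<in>points k - {a}. of_bool (I b = J b)) * v J)"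
  proof (rule sum.mono_neutral_right)
    show "\<forall>J\<in>?D - ?S. f (J a) * (\<Prod>b\<in>points k - {a}. of_bool (I b = J b)) * v J = 0"
    proof
      fix J assume J: "J \<in> ?D - ?S"
      have "\<exists>b\<in>points k - {a}. I b \<noteq> J b"
      proof (rule ccontr)
        assume "\<not> ?thesis"
        then have *: "\<And>b. b \<in> points k \<Longrightarrow> b \<noteq> a \<Longrightarrow> I b = J b" by blast
        have Ja: "J a < N" using J double_index_less a by blast
        have "J = I(a := J a)"
          by (rule double_index_eqI[OF _ upd[OF Ja]]) (use J * in auto)
        then show False using J Ja by blast
      qed
      then show "f (J a) * (\<Prod>b\<in>points k - {a}. of_bool (I b = J b)) * v J = 0"
        by (subst prod_of_bool) auto
    qed
    show "?S \<subseteq> ?D" using upd by blast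
  qed simp
  also have "\<dots> = (\<Sum>j<N. f j * v (I(a := j)))"
  proof (subst sum.reindex)
    show "inj_on (\<lambda>j. I(a := j)) {..<N}" by (rule inj_onI) (metis fun_upd_same)
    have "(\<Prod>b\<in>points k - {a}. of_bool (I b = (I(a := j)) b)) = (1 :: complex)" for j
      by (rule prod.neutral) simp
    then show "sum ((\<lambda>J. f (J a) * (\<Prod>b\<in>points k - {a}. of_bool (I b = J b)) * v J) \<circ> (\<lambda>j. I(a := j))) {..<N} =
      (\<Sum>j<N. f j * v (I(a := j)))" by simp
  qed
  finally show ?thesis .
qed

text \<open>
  Differentiating the invariance along a curve through the identity: by the product rule the generator
  \<open>X\<close> acts on one point at a time. Along a real curve the conjugation in \<open>entry\<close>
  disappears.
\<close>

lemma invariant_vec_infinitesimal: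
  fixes c :: "nat \<Rightarrow> nat \<Rightarrow> real \<Rightarrow> real"
  assumes v: "invariant_vec A N k v" and I: "I \<in> double_index N k"
    and g: "\<And>t. Matrix.mat N N (\<lambda>(i, j). complex_of_real (c i j t)) \<in> class_group A N"
    and c0: "\<And>i j. c i j 0 = of_bool (i = j)"
    and X: "\<And>i j. (c i j has_field_derivative X i j) (at 0)"
  shows "(\<Sum>a\<in>points k. \<Sum>j<N. of_real (X (I a) j) * v (I(a := j))) = 0"
proof -
  let ?D = "double_index N k"
  define F where "F t = (\<Sum>J\<in>?D. complex_of_real (\<Prod>a\<in>points k. c (I a) (J a) t) * v J)" for t
  have "F t = v I" for t
  proof -
    let ?g = "Matrix.mat N N (\<lambda>(i, j). complex_of_real (c i j t))"
    have "entry ?g a (I a) (J a) = of_real (c (I a) (J a) t)" if "a \<in> points k" "J \<in> ?D" for a J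
      using double_index_less[OF I that(1)] double_index_less[OF that(2,1)] by (cases a) auto
    then have "group_act N k ?g v I = F t"
      unfolding group_act_def F_def by (intro sum.cong refl) simp
    then show ?thesis using invariant_vecD[OF v g I] by simp
  qed
  then have "F = (\<lambda>t. v I)" by auto
  then have "(F has_vector_derivative 0) (at 0)" by simp
  moreover have "(F has_vector_derivative
      (\<Sum>J\<in>?D. complex_of_real (\<Sum>a\<in>points k. X (I a) (J a) * (\<Prod>b\<in>points k - {a}. c (I b) (J b) 0)) * v J)) (at 0)"
    unfolding F_def
    by (intro has_vector_derivative_sum has_vector_derivative_mult_left has_vector_derivative_of_real
          has_field_derivative_prod X)
  ultimately have "0 = (\<Sum>J\<in>?D. complex_of_real (\<Sum>a\<in>points k. X (I a) (J a) * (\<Prod>b\<in>points k - {a}. c (I b) (J b) 0)) * v J)"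
    by (rule vector_derivative_unique_at)
  also have "\<dots> = (\<Sum>J\<in>?D. \<Sum>a\<in>points k.
      complex_of_real (X (I a) (J a)) * (\<Prod>b\<in>points k - {a}. of_bool (I b = J b)) * v J)"
  proof -
    have "complex_of_real (of_bool Q) = of_bool Q" for Q by (cases Q) auto
    then show ?thesis
      by (intro sum.cong refl) (simp only: c0 of_real_sum of_real_mult of_real_prod sum_distrib_right)
  qed
  also have "\<dots> = (\<Sum>a\<in>points k. \<Sum>J\<in>?D.
      of_real (X (I a) (J a)) * (\<Prod>b\<in>points k - {a}. of_bool (I b = J b)) * v J)"
    by (rule sum.swap)
  also have "\<dots> = (\<Sum>a\<in>points k. \<Sum>j<N. of_real (X (I a) j) * v (I(a := j)))"
    by (intro sum.cong refl sum_single_change[OF I, of _ "\<lambda>j. of_real (X (I a) j)" for a])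
  finally show ?thesis by simp
qed

text \<open>
  The splitting step for a block of at least three points, with value \<open>x\<close>. One of them, \<open>a0\<close>, is moved to
  a fresh value \<open>y\<close>, and the infinitesimal relation is evaluated there. Moving \<open>a0\<close> back to \<open>x\<close> recovers
  \<open>I0\<close>. Every other term with a non-zero coefficient displaces at most two points of the block, so the
  value \<open>x\<close> survives, a fresh value is taken in addition, and the coefficient vanishes by the assumption
  on indices with more values.
\<close>

lemma infinitesimal_reduction:
  fixes X :: "nat \<Rightarrow> nat \<Rightarrow> real"
  assumes I0: "I0 \<in> double_index N k"
    and b: "3 \<le> card {a \<in> points k. I0 a = x}"
    and yz: "y \<notin> I0 ` points k" "z \<notin> I0 ` points k" "y < N" "z < N"
    and rel: "\<And>I. I \<in> double_index N k \<Longrightarrow>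
       (\<Sum>a\<in>points k. \<Sum>j<N. of_real (X (I a) j) * v (I(a := j))) = (0 :: complex)"
    and IH: "\<And>J. J \<in> double_index N k \<Longrightarrow> card (I0 ` points k) < card (J ` points k) \<Longrightarrow> v J = 0"
    and X0: "\<And>i j. i \<notin> {x, y, z} \<or> j \<notin> {x, y, z} \<Longrightarrow> X i j = 0"
    and X1: "X x x = 0" "X y y = 0" "X y x = 1"
  shows "v I0 = 0"
proof -
  let ?b = "{a \<in> points k. I0 a = x}"
  obtain a0 where a0: "a0 \<in> points k" "I0 a0 = x"
    using b by (metis (mono_tags, lifting) Collect_empty_eq card.empty not_numeral_le_zero)
  have third: "\<exists>a'\<in>points k. I0 a' = x \<and> a' \<noteq> a0 \<and> a' \<noteq> a" for a
  proof (rule ccontr)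
    assume "\<not> ?thesis"
    then have "?b \<subseteq> {a0, a}" by blast
    then have "card ?b \<le> card {a0, a}" by (intro card_mono) auto
    also have "\<dots> \<le> 2" by (simp add: card_insert_if)
    finally show False using b by simp
  qed
  have xy: "x \<noteq> y" "x \<noteq> z" "x < N" using a0 yz double_index_less[OF I0] by blast+
  have upd: "J(a := j) \<in> double_index N k" if "J \<in> double_index N k" "a \<in> points k" "j < N" for J a j
    using that unfolding double_index_def by (auto simp: PiE_iff extensional_def)
  have more: "v J = 0" if J: "J \<in> double_index N k" and same: "\<And>a. a \<in> points k \<Longrightarrow> I0 a \<noteq> x \<Longrightarrow> J a = I0 a"
    and keep: "a' \<in> points k" "J a' = x" and new: "a'' \<in> points k" "J a'' \<in> {y, z}" for J a' a''
  proof (rule IH[OF J])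
    have "insert (J a'') (I0 ` points k) \<subseteq> J ` points k"
    proof
      fix w assume w: "w \<in> insert (J a'') (I0 ` points k)"
      show "w \<in> J ` points k"
      proof (cases "w = J a'' \<or> w = x")
        case True
        then show ?thesis using keep new by blast
      next
        case False
        then obtain a where "a \<in> points k" "w = I0 a" "I0 a \<noteq> x" using w by blast
        then show ?thesis using same[of a] by (metis image_eqI)
      qed
    qed
    then have "card (insert (J a'') (I0 ` points k)) \<le> card (J ` points k)" by (intro card_mono) auto
    moreover have "J a'' \<notin> I0 ` points k" using new yz by auto
    ultimately show "card (I0 ` points k) < card (J ` points k)" by simp
  qed
  \<comment> \<open>The relation is used at this index, not at \<open>I0\<close> itself.\<close>
  define I where "I = I0(a0 := y)"
  have I: "I \<in> double_index N k" unfolding I_def by (rule upd[OF I0 a0(1) yz(3)])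
  have summand: "of_real (X (I a) j) * v (I(a := j)) = (if a = a0 \<and> j = x then v I0 else 0)"
    if a: "a \<in> points k" and j: "j < N" for a j
  proof (cases "a = a0")
    case True
    have Ia: "I a = y" "I(a := j) = I0(a0 := j)" using True by (auto simp: I_def)
    consider "j = x" | "j = z" "j \<noteq> y" | "j = y" | "j \<notin> {x, y, z}" by blast
    then show ?thesis
    proof cases
      case 1
      then show ?thesis using Ia True X1 a0 by (simp add: fun_upd_idem)
    next
      case 2
      obtain a' where a': "a' \<in> points k" "I0 a' = x" "a' \<noteq> a0" using third by blast
      have "v (I0(a0 := j)) = 0"
        by (rule more[OF upd[OF I0 a0(1) j] _ a'(1) _ a0(1)]) (use a' a0 2 in auto)
      then show ?thesis using Ia 2 xy by simp
    next
      case 3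
      then show ?thesis using Ia X1 xy by simp
    next
      case 4
      then show ?thesis using X0 by simp
    qed
  next
    case False
    then have Ia: "I a = I0 a" by (simp add: I_def)
    show ?thesis
    proof (cases "I0 a = x")
      case True
      consider "j = x" | "j \<in> {y, z}" | "j \<notin> {x, y, z}" by blast
      then show ?thesis
      proof cases
        case 1
        then show ?thesis using Ia True False X1 by simp
      next
        case 2
        obtain a' where a': "a' \<in> points k" "I0 a' = x" "a' \<noteq> a0" "a' \<noteq> a" using third by blast
        have "v (I(a := j)) = 0"
          by (rule more[OF upd[OF I a j] _ a'(1) _ a]) (use a' a0 True 2 in \<open>auto simp: I_def\<close>)
        then show ?thesis using False by simp
      next
        case 3
        then show ?thesis using X0 False by simp
      qed
    next
      case nx: False
      have "I0 a \<notin> {x, y, z}" using nx a yz by auto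
      then show ?thesis using X0 Ia False by simp
    qed
  qed
  have "0 = (\<Sum>a\<in>points k. \<Sum>j<N. of_real (X (I a) j) * v (I(a := j)))" using rel[OF I] by simp
  also have "\<dots> = (\<Sum>a\<in>points k. \<Sum>j<N. if a = a0 then if j = x then v I0 else 0 else 0)"
    by (intro sum.cong refl) (simp add: summand)
  also have "\<dots> = (\<Sum>a\<in>points k. if a = a0 then v I0 else 0)"
    using xy(3) by (intro sum.cong refl) simp
  also have "\<dots> = v I0" using a0(1) by simp
  finally show ?thesis by simp
qed

section \<open>Rotations of three coordinates\<close>

text \<open>
  The matrix \<open>m\<close> on the coordinates \<open>x\<close>, \<open>y\<close>, \<open>z\<close> (numbered 0, 1, 2) and the identity on the others.
  Rotations of the plane spanned by \<open>x\<close> and \<open>y\<close> are put in the same form, leaving \<open>z\<close> fixed, so that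
  both kinds of rotation share their proofs.
\<close>

definition embed3 :: "nat \<Rightarrow> nat \<Rightarrow> nat \<Rightarrow> (nat \<Rightarrow> nat \<Rightarrow> real) \<Rightarrow> nat \<Rightarrow> nat \<Rightarrow> real" where
  "embed3 x y z m i j = (let n = (\<lambda>i. if i = x then 0 else if i = y then 1 else 2 :: nat) in
     if i \<in> {x, y, z} \<and> j \<in> {x, y, z} then m (n i) (n j) else of_bool (i = j))"

lemma embed3_sum:
  assumes "x \<noteq> y" "x \<noteq> z" "y \<noteq> z" "x < N" "y < N" "z < N" "i < N"
  shows "(\<Sum>l<N. embed3 x y z m i l * f l) =
    (if i \<in> {x, y, z} then embed3 x y z m i x * f x + embed3 x y z m i y * f y + embed3 x y z m i z * f z else f i)"
proof (cases "i \<in> {x, y, z}")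
  case True
  have "(\<Sum>l<N. embed3 x y z m i l * f l) = (\<Sum>l\<in>{x, y, z}. embed3 x y z m i l * f l)"
    by (rule sum.mono_neutral_right) (use True assms in \<open>auto simp: embed3_def Let_def\<close>)
  also have "\<dots> = embed3 x y z m i x * f x + embed3 x y z m i y * f y + embed3 x y z m i z * f z"
    using assms(1-3) by simp
  finally show ?thesis using True by simp
next
  case False
  have "(\<Sum>l<N. embed3 x y z m i l * f l) = (\<Sum>l<N. if i = l then f l else 0)"
    by (rule sum.cong) (use False in \<open>auto simp: embed3_def\<close>)
  then show ?thesis using False assms(7) by simp
qed

lemma embed3_transpose: "embed3 x y z (\<lambda>i j. m j i) i j = embed3 x y z m j i"
  by (auto simp: embed3_def Let_def)

lemma embed3_unitary:
  assumes xyz: "x \<noteq> y" "x \<noteq> z" "y \<noteq> z" "x < N" "y < N" "z < N"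
    and m: "\<And>i j. i < 3 \<Longrightarrow> j < 3 \<Longrightarrow> m i 0 * m j 0 + m i 1 * m j 1 + m i 2 * m j 2 = of_bool (i = j)"
  shows "Matrix.mat N N (\<lambda>(i, j). complex_of_real (embed3 x y z m i j)) \<in> unitary_mats N \<inter> real_mats N"
proof -
  let ?g = "Matrix.mat N N (\<lambda>(i, j). complex_of_real (embed3 x y z m i j))"
  have o: "(\<Sum>l<N. embed3 x y z m i l * embed3 x y z m j l) = of_bool (i = j)" if "i < N" "j < N" for i j
  proof -
    consider "i \<in> {x, y, z}" "j \<in> {x, y, z}" | "i \<in> {x, y, z}" "j \<notin> {x, y, z}" | "i \<notin> {x, y, z}" by blast
    then show ?thesis
    proof cases
      case 1
      then show ?thesis
        unfolding embed3_sum[OF xyz that(1)]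
        using xyz m[of 0 0] m[of 0 1] m[of 0 2] m[of 1 0] m[of 1 1] m[of 1 2] m[of 2 0] m[of 2 1] m[of 2 2]
        by (auto simp: embed3_def)
    next
      case 2
      then show ?thesis unfolding embed3_sum[OF xyz that(1)] by (auto simp: embed3_def)
    next
      case 3
      then show ?thesis unfolding embed3_sum[OF xyz that(1)] by (auto simp: embed3_def)
    qed
  qed
  have c: "?g \<in> carrier_mat N N" by simp
  have "?g * dagger ?g = 1\<^sub>m N"
  proof (rule eq_matI)
    fix i j assume "i < dim_row (1\<^sub>m N)" "j < dim_col (1\<^sub>m N)"
    then have ij: "i < N" "j < N" by auto
    have "(?g * dagger ?g) $$ (i, j) = (\<Sum>l<N. ?g $$ (i, l) * dagger ?g $$ (l, j))"
      by (rule mult_index[OF c dagger_carrier[OF c] ij])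
    also have "\<dots> = complex_of_real (\<Sum>l<N. embed3 x y z m i l * embed3 x y z m j l)"
      using ij by (simp add: dagger_index[OF c])
    finally show "(?g * dagger ?g) $$ (i, j) = 1\<^sub>m N $$ (i, j)" using ij o[OF ij] by simp
  qed (auto simp: dagger_def)
  then show ?thesis by (simp add: unitary_mats_def real_mats_def)
qed

lemma embed3_row_sum:
  assumes xyz: "x \<noteq> y" "x \<noteq> z" "y \<noteq> z" "x < N" "y < N" "z < N" and "i < N"
    and m: "\<And>i. i < 3 \<Longrightarrow> m i 0 + m i 1 + m i 2 = 1"
  shows "(\<Sum>j<N. embed3 x y z m i j) = 1"
  using embed3_sum[OF xyz assms(7), of m "\<lambda>_. 1"] xyz m[of 0] m[of 1] m[of 2]
  by (auto simp: embed3_def split: if_splits)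

lemma embed3_derivative:
  assumes "\<And>i j. ((\<lambda>t. m t i j) has_field_derivative X i j) (at 0)"
  shows "((\<lambda>t. embed3 x y z (m t) i j) has_field_derivative
    (if i \<in> {x, y, z} \<and> j \<in> {x, y, z} then embed3 x y z X i j else 0)) (at 0)"
  using assms by (auto simp: embed3_def Let_def)

definition rotation3 :: "real \<Rightarrow> nat \<Rightarrow> nat \<Rightarrow> real" where
  "rotation3 t i j = (if i = 2 \<or> j = 2 then of_bool (i = j) else if i = j then cos t
     else if i = 0 then - sin t else sin t)"

text \<open>
  The rotation about the axis \<open>(1, 1, 1)\<close>, which fixes the all-ones vector and thus keeps all row and
  column sums equal to 1. The angle is scaled by \<open>sqrt 3\<close> to make the entries of the generator
  integers.
\<close>

definition circulant3 :: "real \<Rightarrow> nat \<Rightarrow> nat \<Rightarrow> real" where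
  "circulant3 t i j = (let s = sqrt 3 * t in
     if i = j then (1 + 2 * cos s) / 3
     else if (i, j) \<in> {(0, 1), (1, 2), (2, 0)} then (1 - cos s - sqrt 3 * sin s) / 3
     else (1 - cos s + sqrt 3 * sin s) / 3)"

lemma less_3_cases: "i < 3 \<Longrightarrow> (i = 0 \<Longrightarrow> P) \<Longrightarrow> (i = 1 \<Longrightarrow> P) \<Longrightarrow> (i = 2 \<Longrightarrow> P) \<Longrightarrow> P" for i :: nat
  by linarith

lemma rotation3_orthogonal:
  assumes "i < 3" "j < 3"
  shows "rotation3 t i 0 * rotation3 t j 0 + rotation3 t i 1 * rotation3 t j 1 + rotation3 t i 2 * rotation3 t j 2 =
    of_bool (i = j)"
proof -
  have "cos t * cos t + sin t * sin t = 1" using sin_cos_squared_add2[of t] by (simp add: power2_eq_square)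
  then show ?thesis
    using assms by (elim less_3_cases) (auto simp: rotation3_def algebra_simps)
qed

lemma circulant3_orthogonal:
  assumes "i < 3" "j < 3"
  shows "circulant3 t i 0 * circulant3 t j 0 + circulant3 t i 1 * circulant3 t j 1 + circulant3 t i 2 * circulant3 t j 2 =
    of_bool (i = j)"
proof -
  define c where "c = cos (sqrt 3 * t)"
  define s where "s = sqrt 3 * sin (sqrt 3 * t)"
  define \<alpha> \<beta> \<gamma> where abc: "\<alpha> = (1 + 2 * c) / 3" "\<beta> = (1 - c - s) / 3" "\<gamma> = (1 - c + s) / 3"
  have "s * s = 3 * (sin (sqrt 3 * t))\<^sup>2" by (simp add: s_def power2_eq_square)
  then have ss: "s * s = 3 - 3 * (c * c)"
    using sin_squared_eq[of "sqrt 3 * t"] by (simp add: c_def power2_eq_square)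
  have 1: "\<alpha> * \<alpha> + \<beta> * \<beta> + \<gamma> * \<gamma> = 1" using ss unfolding abc by (simp add: field_simps)
  have 2: "\<alpha> * \<beta> + \<beta> * \<gamma> + \<gamma> * \<alpha> = 0" using ss unfolding abc by (simp add: field_simps)
  have cv: "circulant3 t i j =
      (if i = j then \<alpha> else if (i, j) \<in> {(0, 1), (1, 2), (2, 0)} then \<beta> else \<gamma>)" for i j
    by (simp add: circulant3_def Let_def abc c_def s_def)
  show ?thesis
    using assms 1 2 by (elim less_3_cases) (simp_all add: cv algebra_simps)
qed

lemma circulant3_sums:
  assumes "i < 3"
  shows "circulant3 t i 0 + circulant3 t i 1 + circulant3 t i 2 = 1"
    "circulant3 t 0 i + circulant3 t 1 i + circulant3 t 2 i = 1"
  using assms by (elim less_3_cases; simp add: circulant3_def Let_def field_simps)+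

definition rotation3_gen :: "nat \<Rightarrow> nat \<Rightarrow> real" where
  "rotation3_gen i j = (if i = 2 \<or> j = 2 \<or> i = j then 0 else if i = 0 then -1 else 1)"

definition circulant3_gen :: "nat \<Rightarrow> nat \<Rightarrow> real" where
  "circulant3_gen i j = (if i = j then 0 else if (i, j) \<in> {(0, 1), (1, 2), (2, 0)} then -1 else 1)"

lemma rotation3_derivative: "((\<lambda>t. rotation3 t i j) has_field_derivative rotation3_gen i j) (at 0)"
  by (cases "i = 2 \<or> j = 2"; cases "i = j"; cases "i = 0"; simp add: rotation3_def rotation3_gen_def;
      (auto intro!: derivative_eq_intros)?)

lemma circulant3_derivative: "((\<lambda>t. circulant3 t i j) has_field_derivative circulant3_gen i j) (at 0)"
  by (cases "i = j"; cases "(i, j) \<in> {(0, 1), (1, 2), (2, 0)}"; simp only: circulant3_def circulant3_gen_def Let_def if_True if_False;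
      (auto intro!: derivative_eq_intros)?)

section \<open>Invariant tensors are spanned by the partitions of the class\<close>

text \<open>
  Two fresh values exist because \<open>I0\<close> takes at most \<open>2 * k\<close> values. The unitary and the orthogonal
  group contain the plane rotations, the group with unit row and column sums the rotations that fix the
  all-ones vector.
\<close>

lemma block3_reduction:
  assumes I0: "I0 \<in> double_index N k" and N: "2 * k + 2 \<le> N"
    and b: "3 \<le> card {a \<in> points k. I0 a = x}"
    and v: "invariant_vec A N k v" and A: "A \<in> {Class_S, Class_B, Class_Bs}"
    and IH: "\<And>J. J \<in> double_index N k \<Longrightarrow> card (I0 ` points k) < card (J ` points k) \<Longrightarrow> v J = 0"
  shows "v I0 = 0"
proof -
  have "card (I0 ` points k) \<le> 2 * k" using card_image_le[of "points k" I0] by (simp add: card_points)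
  then have "2 \<le> card ({..<N} - I0 ` points k)"
    using N diff_card_le_card_Diff[of "I0 ` points k" "{..<N}"] by simp
  then obtain T where "T \<subseteq> {..<N} - I0 ` points k" "card T = 2" by (meson obtain_subset_with_card_n)
  then obtain y z where yz: "y \<notin> I0 ` points k" "z \<notin> I0 ` points k" "y < N" "z < N" "y \<noteq> z"
    unfolding card_2_iff by blast
  obtain a0 where a0: "a0 \<in> points k" "I0 a0 = x"
    using b by (metis (mono_tags, lifting) Collect_empty_eq card.empty not_numeral_le_zero)
  have x: "x < N" "x \<noteq> y" "x \<noteq> z" using a0 yz double_index_less[OF I0] by blast+
  note xyz = x(2,3) yz(5) x(1) yz(3,4)
  obtain m X where m: "\<And>t. Matrix.mat N N (\<lambda>(i, j). complex_of_real (embed3 x y z (m t) i j)) \<in> class_group A N"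
    and m0: "\<And>i j. m 0 i j = of_bool (i = j)"
    and mX: "\<And>i j. ((\<lambda>t. m t i j) has_field_derivative X i j) (at 0)"
    and X1: "X 0 0 = 0" "X 1 1 = 0" "X 1 0 = 1"
  proof (cases "A = Class_Bs")
    case True
    have "Matrix.mat N N (\<lambda>(i, j). complex_of_real (embed3 x y z (circulant3 t) i j)) \<in> class_group A N" for t
    proof -
      have 1: "Matrix.mat N N (\<lambda>(i, j). complex_of_real (embed3 x y z (circulant3 t) i j)) \<in> unitary_mats N \<inter> real_mats N"
        by (rule embed3_unitary[OF xyz circulant3_orthogonal])
      have 2: "(\<Sum>j<N. embed3 x y z (circulant3 t) i j) = 1" if "i < N" for i
        by (rule embed3_row_sum[OF xyz that circulant3_sums(1)])
      have 3: "(\<Sum>i<N. embed3 x y z (circulant3 t) i j) = 1" if "j < N" for j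
      proof -
        have "(\<Sum>i<N. embed3 x y z (\<lambda>i j. circulant3 t j i) j i) = 1"
          by (rule embed3_row_sum[OF xyz that circulant3_sums(2)])
        then show ?thesis by (simp only: embed3_transpose[of x y z "circulant3 t"])
      qed
      show ?thesis unfolding True class_group_Bs
        using 1 2 3 by (simp flip: of_real_sum)
    qed
    moreover have "circulant3 0 i j = of_bool (i = j)" for i j by (simp add: circulant3_def)
    ultimately show ?thesis
      by (rule that[OF _ _ circulant3_derivative]) (simp_all add: circulant3_gen_def)
  next
    case False
    have "Matrix.mat N N (\<lambda>(i, j). complex_of_real (embed3 x y z (rotation3 t) i j)) \<in> unitary_mats N \<inter> real_mats N" for t
      by (rule embed3_unitary[OF xyz rotation3_orthogonal])
    then have "Matrix.mat N N (\<lambda>(i, j). complex_of_real (embed3 x y z (rotation3 t) i j)) \<in> class_group A N" for t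
      using A False by (auto simp: class_group_S class_group_B)
    moreover have "rotation3 0 i j = of_bool (i = j)" for i j by (simp add: rotation3_def)
    ultimately show ?thesis
      by (rule that[OF _ _ rotation3_derivative]) (simp_all add: rotation3_gen_def)
  qed
  define Y where "Y i j = (if i \<in> {x, y, z} \<and> j \<in> {x, y, z} then embed3 x y z X i j else 0)" for i j
  show ?thesis
  proof (rule infinitesimal_reduction[OF I0 b yz(1-4) _ IH, of Y])
    fix I assume I: "I \<in> double_index N k"
    show "(\<Sum>a\<in>points k. \<Sum>j<N. of_real (Y (I a) j) * v (I(a := j))) = 0"
    proof (rule invariant_vec_infinitesimal[OF v I m])
      show "embed3 x y z (m 0) i j = of_bool (i = j)" for i j
        using xyz by (auto simp: embed3_def Let_def m0)
      show "((\<lambda>t. embed3 x y z (m t) i j) has_field_derivative Y i j) (at 0)" for i j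
        unfolding Y_def by (rule embed3_derivative[OF mX])
    qed
  qed (use X1 xyz in \<open>auto simp: Y_def embed3_def Let_def\<close>)
qed

text \<open>
  A single sign \<open>-1\<close> on the diagonal detects blocks of odd size.
\<close>

lemma phase_block_zero:
  assumes v: "invariant_vec A N k v" and I: "I \<in> double_index N k" and A: "A \<in> {Class_S, Class_B, Class_H}"
    and b: "b \<in> Ker k I" and odd: "odd (card b)"
  shows "v I = 0"
proof -
  obtain a0 where a0: "b = {a \<in> points k. I a = I a0}" using b by (auto simp: Ker_def)
  let ?\<epsilon> = "(\<lambda>_. 1)(I a0 := -1 :: complex)"
  have u: "signed_perm_mat N id ?\<epsilon> \<in> unitary_mats N" by (rule signed_perm_mat_unitary[OF permutes_id]) simp
  moreover have "signed_perm_mat N id ?\<epsilon> \<in> real_mats N" by (simp add: real_mats_def)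
  moreover have "signed_perm_mat N id ?\<epsilon> \<in> class_group Class_H N"
    unfolding class_group_H using permutes_id[of "{..<N}"] by (auto intro!: exI[of _ id] exI[of _ ?\<epsilon>])
  ultimately have g: "signed_perm_mat N id ?\<epsilon> \<in> class_group A N"
    using A by (auto simp: class_group_S class_group_B)
  have ph: "phase a (-1) = -1" for a by (cases a) auto
  have "(\<Prod>a | a \<in> points k \<and> I a = I a0. phase a (-1)) = (-1) ^ card b"
    unfolding ph by (simp add: a0)
  then show ?thesis
    using odd by (intro invariant_vec_phase_zero[OF v I g]) simp
qed

text \<open>
  The phase \<open>\<i>\<close> detects pairs on the same side: \<open>\<i>\<close> and its conjugate both have square \<open>-1\<close>.
\<close>

lemma unitary_phase_block_zero:
  assumes v: "invariant_vec Class_S N k v" and I: "I \<in> double_index N k"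
    and b: "b \<in> Ker k I" and card: "card b = 2" and n: "\<nexists>i j. b = {Inl i, Inr j}"
  shows "v I = 0"
proof -
  obtain a0 where a0: "b = {a \<in> points k. I a = I a0}" using b by (auto simp: Ker_def)
  let ?\<epsilon> = "(\<lambda>_. 1)(I a0 := \<i>)"
  have g: "signed_perm_mat N id ?\<epsilon> \<in> class_group Class_S N"
    unfolding class_group_S by (rule signed_perm_mat_unitary[OF permutes_id]) simp
  obtain a c where ac: "b = {a, c}" "a \<noteq> c" using card unfolding card_2_iff by blast
  have "(\<Prod>a\<in>b. phase a \<i>) = phase a \<i> * phase c \<i>" using ac by simp
  also have "\<dots> = -1"
  proof (cases a; cases c)
    fix i j assume "a = Inl i" "c = Inr j"
    then show ?thesis using ac n by blast
  next
    fix i j assume "a = Inr i" "c = Inl j"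
    then show ?thesis using ac n by (metis insert_commute)
  qed simp_all
  finally have "(\<Prod>a | a \<in> points k \<and> I a = I a0. phase a \<i>) = -1" by (simp add: a0)
  then show ?thesis by (intro invariant_vec_phase_zero[OF v I g]) simp
qed

text \<open>
  Induction on the number of distinct values of the index, from many to few. If the kernel is outside
  the class, some block violates its condition: either a phase annihilates the coefficient, or the
  block has at least three points and is split.
\<close>

lemma invariant_vec_eq_0:
  assumes v: "invariant_vec A N k v" and N: "2 * k + 2 \<le> N"
    and zero: "\<And>I. I \<in> double_index N k \<Longrightarrow> Ker k I \<in> class_ptns A k \<Longrightarrow> v I = 0"
    and I: "I \<in> double_index N k"
  shows "v I = 0"
  using I
proof (induction "2 * k - card (I ` points k)" arbitrary: I rule: less_induct)
  case less
  note I = less.prems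
  have card_le: "card (J ` points k) \<le> 2 * k" for J :: "point \<Rightarrow> nat"
    using card_image_le[of "points k" J] by (simp add: card_points)
  have IH: "v J = 0" if "J \<in> double_index N k" "card (I ` points k) < card (J ` points k)" for J
    using less.hyps[OF _ that(1)] that(2) card_le[of J] by linarith
  show ?case
  proof (cases "Ker k I \<in> class_ptns A k")
    case False
    have Kp: "Ker k I \<in> partitions k" by (rule Ker_partition)
    have pos: "card b \<noteq> 0" if "b \<in> Ker k I" for b
    proof -
      have "partition_on (points k) (Ker k I)" using Kp by (simp add: partitions_def)
      then have "b \<noteq> {}" "b \<subseteq> points k" using that partition_onD1 partition_onD3 by blast+
      then show ?thesis using finite_subset[OF _ finite_points] by auto
    qed
    have big: ?thesis if b: "b \<in> Ker k I" "3 \<le> card b" and A: "A \<in> {Class_S, Class_B, Class_Bs}" for b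
    proof -
      obtain a0 where a0: "b = {a \<in> points k. I a = I a0}" using b by (auto simp: Ker_def)
      show ?thesis by (rule block3_reduction[OF I N _ v A IH]) (use a0 b in auto)
    qed
    show ?thesis
    proof (cases A)
      case Class_S
      then obtain b where b: "b \<in> Ker k I" "\<nexists>i j. b = {Inl i, Inr j}"
        using False Kp unfolding Class_S class_S_eq by blast
      consider "card b = 1" | "card b = 2" | "3 \<le> card b" using pos[OF b(1)] by linarith
      then show ?thesis
      proof cases
        case 1
        then show ?thesis by (intro phase_block_zero[OF v I _ b(1)]) (simp_all add: Class_S)
      next
        case 2
        then show ?thesis using unitary_phase_block_zero[OF _ I b(1) 2 b(2)] v Class_S by simp
      next
        case 3
        then show ?thesis using big[OF b(1)] Class_S by simp
      qed
    next
      case Class_B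
      then obtain b where b: "b \<in> Ker k I" "card b \<noteq> 2" using False Kp by auto
      consider "card b = 1" | "3 \<le> card b" using pos[OF b(1)] b(2) by linarith
      then show ?thesis
      proof cases
        case 1
        then show ?thesis by (intro phase_block_zero[OF v I _ b(1)]) (simp_all add: Class_B)
      next
        case 2
        then show ?thesis using big[OF b(1)] Class_B by simp
      qed
    next
      case Class_Bs
      then obtain b where b: "b \<in> Ker k I" "\<not> card b \<le> 2" using False Kp by auto
      then show ?thesis using big[OF b(1)] Class_Bs by simp
    next
      case Class_H
      then obtain b where b: "b \<in> Ker k I" "odd (card b)" using False Kp by auto
      then show ?thesis by (intro phase_block_zero[OF v I _ b(1)]) (simp_all add: Class_H)
    next
      case Class_P
      then show ?thesis using False Kp by simp
    qed
  qed (rule zero[OF I])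
qed

text \<open>
  The analogue of Schur-Weyl duality for the five groups. Refinement makes the values of the
  \<open>rho\<close> on kernels in the class a unitriangular matrix, so some combination of them agrees
  with \<open>v\<close> there; the difference is invariant, hence zero.
\<close>

theorem invariant_vec_spanned:
  assumes v: "invariant_vec A N k v" and N: "2 * k + 2 \<le> N"
  shows "\<exists>\<kappa>. \<forall>I\<in>double_index N k. v I = (\<Sum>p\<in>class_ptns A k. \<kappa> p * of_bool (blockconst p I))"
proof -
  let ?S = "class_ptns A k"
  have P: "p \<in> partitions k" if "p \<in> ?S" for p using that class_ptns_partitions by blast
  define rep where "rep q = (SOME I. I \<in> double_index N k \<and> Ker k I = q)" for q
  have rep: "rep q \<in> double_index N k \<and> Ker k (rep q) = q" if q: "q \<in> ?S" for q
  proof -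
    obtain I where "I \<in> double_index N k \<and> Ker k I = q"
      using exists_Ker[OF P[OF q], of N] nc_le[OF P[OF q]] N by (metis add_leE le_trans)
    then show ?thesis
      unfolding rep_def by (rule someI[of "\<lambda>I. I \<in> double_index N k \<and> Ker k I = q"])
  qed
  \<comment> \<open>Coarser partitions have fewer blocks, so the number of blocks is negated to rank the unknowns.\<close>
  have "\<exists>\<kappa>. \<forall>q\<in>?S. (\<Sum>p\<in>?S. of_bool (coarser k p q) * \<kappa> p) = v (rep q)"
    by (rule unitriangular_solvable[where r = "\<lambda>p. - int (nc p)"])
       (use P coarser_refl nc_strict_mono in \<open>auto split: if_splits\<close>)
  then obtain \<kappa> where \<kappa>: "\<And>q. q \<in> ?S \<Longrightarrow> (\<Sum>p\<in>?S. of_bool (coarser k p q) * \<kappa> p) = v (rep q)" by blast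
  define w where "w I = v I - (\<Sum>p\<in>?S. \<kappa> p * of_bool (blockconst p I))" for I
  have w: "invariant_vec A N k w"
    unfolding invariant_vec_def
  proof (intro ballI)
    fix g I assume g: "g \<in> class_group A N" and I: "I \<in> double_index N k"
    have "group_act N k g w I = group_act N k g v I -
        (\<Sum>J\<in>double_index N k. \<Sum>p\<in>?S. (\<Prod>a\<in>points k. entry g a (I a) (J a)) * (\<kappa> p * of_bool (blockconst p J)))"
      by (simp only: group_act_def w_def right_diff_distrib sum_subtractf sum_distrib_left)
    also have "(\<Sum>J\<in>double_index N k. \<Sum>p\<in>?S. (\<Prod>a\<in>points k. entry g a (I a) (J a)) * (\<kappa> p * of_bool (blockconst p J))) =
      (\<Sum>p\<in>?S. \<kappa> p * group_act N k g (\<lambda>J. of_bool (blockconst p J)) I)"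
      by (subst sum.swap) (simp only: group_act_def sum_distrib_left mult_ac)
    also have "\<dots> = (\<Sum>p\<in>?S. \<kappa> p * of_bool (blockconst p I))"
      by (intro sum.cong refl) (simp only: group_act_blockconst[OF g _ I])
    finally show "group_act N k g w I = w I"
      by (simp only: invariant_vecD[OF v g I] w_def[of I])
  qed
  have "w I = 0" if I: "I \<in> double_index N k" for I
  proof (rule invariant_vec_eq_0[OF w N _ I])
    fix I assume I: "I \<in> double_index N k" and K: "Ker k I \<in> ?S"
    have "v I = v (rep (Ker k I))"
      by (rule invariant_vec_Ker[OF v I]) (use rep[OF K] in simp_all)
    also have "\<dots> = (\<Sum>p\<in>?S. of_bool (coarser k p (Ker k I)) * \<kappa> p)" using \<kappa>[OF K] by simp
    also have "\<dots> = (\<Sum>p\<in>?S. \<kappa> p * of_bool (blockconst p I))"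
      by (intro sum.cong refl) (simp only: coarser_Ker_iff[OF P] mult.commute)
    finally show "w I = 0" by (simp only: w_def diff_self)
  qed
  then show ?thesis by (auto simp: w_def)
qed

section \<open>Averaging over the group\<close>

lemma measurable_entry_borel_mat:
  assumes "i < N" "j < N"
  shows "(\<lambda>g. g $$ (i, j)) \<in> borel_measurable (borel_mat N)"
proof (rule borel_measurableI)
  fix S :: "complex set" assume S: "open S"
  have sp: "space (borel_mat N) = carrier_mat N N"
    unfolding borel_mat_def by (rule space_measure_of) auto
  have "{A \<in> carrier_mat N N. A $$ (i, j) \<in> S} \<in> sets (borel_mat N)"
    unfolding borel_mat_def using assms S by (intro in_measure_of) auto
  moreover have "(\<lambda>g. g $$ (i, j)) -` S \<inter> space (borel_mat N) = {A \<in> carrier_mat N N. A $$ (i, j) \<in> S}"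
    using sp by auto
  ultimately show "(\<lambda>g. g $$ (i, j)) -` S \<inter> space (borel_mat N) \<in> sets (borel_mat N)" by simp
qed

lemma measurable_borel_matI:
  assumes c: "\<And>x. x \<in> space Q \<Longrightarrow> f x \<in> carrier_mat N N"
    and e: "\<And>i j. i < N \<Longrightarrow> j < N \<Longrightarrow> (\<lambda>x. f x $$ (i, j)) \<in> borel_measurable Q"
  shows "f \<in> measurable Q (borel_mat N)"
  unfolding borel_mat_def
proof (rule measurable_measure_of)
  fix Y :: "complex mat set" assume "Y \<in> {{A \<in> carrier_mat N N. A $$ (i, j) \<in> S} | i j S. i < N \<and> j < N \<and> open S}"
  then obtain i j S where Y: "Y = {A \<in> carrier_mat N N. A $$ (i, j) \<in> S}" "i < N" "j < N" "open S" by blast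
  have "f -` Y \<inter> space Q = (\<lambda>x. f x $$ (i, j)) -` S \<inter> space Q" using c Y(1) by auto
  also have "\<dots> \<in> sets Q" by (rule measurable_sets[OF e[OF Y(2,3)]]) (use Y in simp)
  finally show "f -` Y \<inter> space Q \<in> sets Q" .
qed (use c in auto)

locale haar_class =
  fixes A :: ptn_class and N :: nat and \<mu> :: "complex mat measure"
  assumes haar: "haar_prob N (class_group A N) \<mu>"
begin

abbreviation "G \<equiv> class_group A N"

sublocale prob_space \<mu>
  using haar by (simp add: haar_prob_def)

lemma space_eq: "space \<mu> = G"
  using haar by (simp add: haar_prob_def)

lemma sets_eq: "sets \<mu> = sets (restrict_space (borel_mat N) G)"
  using haar by (simp add: haar_prob_def)

lemma measurable_entry:
  assumes "i < N" "j < N"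
  shows "(\<lambda>g. g $$ (i, j)) \<in> borel_measurable \<mu>"
  unfolding measurable_cong_sets[OF sets_eq refl]
  by (rule measurable_restrict_space1[OF measurable_entry_borel_mat[OF assms]])

lemma measurable_left_mult:
  assumes g: "g \<in> G"
  shows "(\<lambda>h. g * h) \<in> measurable \<mu> \<mu>"
proof -
  note c = class_group_carrier[OF g]
  have "(\<lambda>h. g * h) \<in> measurable \<mu> (borel_mat N)"
  proof (rule measurable_borel_matI)
    fix h assume "h \<in> space \<mu>"
    then show "g * h \<in> carrier_mat N N" using c class_group_carrier space_eq by simp
  next
    fix i j assume ij: "i < N" "j < N"
    have "(\<lambda>h. \<Sum>l<N. g $$ (i, l) * h $$ (l, j)) \<in> borel_measurable \<mu>"
      using ij by (intro borel_measurable_sum borel_measurable_times borel_measurable_const measurable_entry) auto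
    also have "?this \<longleftrightarrow> (\<lambda>h. (g * h) $$ (i, j)) \<in> borel_measurable \<mu>"
      by (rule measurable_cong) (use mult_index[OF c _ ij] class_group_carrier space_eq in simp)
    finally show "(\<lambda>h. (g * h) $$ (i, j)) \<in> borel_measurable \<mu>" .
  qed
  moreover have "(\<lambda>h. g * h) \<in> space \<mu> \<rightarrow> G"
    unfolding space_eq using class_group_mult[OF g] by blast
  ultimately have "(\<lambda>h. g * h) \<in> measurable \<mu> (restrict_space (borel_mat N) G)"
    by (intro measurable_restrict_space2)
  then show ?thesis by (subst measurable_cong_sets[OF refl sets_eq])
qed

lemma integrable_group_act:
  assumes I: "I \<in> double_index N k"
  shows "integrable \<mu> (\<lambda>g. group_act N k g v I)"
proof (rule integrable_const_bound[where B = "\<Sum>J\<in>double_index N k. norm (v J)"])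
  have "(\<lambda>g. entry g a (I a) (J a)) \<in> borel_measurable \<mu>"
    if "a \<in> points k" "J \<in> double_index N k" for a J
  proof -
    have m: "(\<lambda>g. g $$ (I a, J a)) \<in> borel_measurable \<mu>"
      using double_index_less[OF I that(1)] double_index_less[OF that(2,1)] by (rule measurable_entry)
    show ?thesis
    proof (cases a)
      case (Inl l)
      have "(\<lambda>g. cnj (g $$ (I a, J a))) \<in> borel_measurable \<mu>"
        by (rule measurable_compose[OF m]) (intro borel_measurable_continuous_onI continuous_intros)
      then show ?thesis using Inl by simp
    next
      case (Inr l)
      then show ?thesis using m by simp
    qed
  qed
  then show "(\<lambda>g. group_act N k g v I) \<in> borel_measurable \<mu>"
    unfolding group_act_def
    by (intro borel_measurable_sum borel_measurable_times borel_measurable_prod borel_measurable_const)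
  show "AE g in \<mu>. norm (group_act N k g v I) \<le> (\<Sum>J\<in>double_index N k. norm (v J))"
  proof (rule AE_I2)
    fix g assume "g \<in> space \<mu>"
    then have u: "g \<in> unitary_mats N" using class_group_unitary space_eq by blast
    have "norm (\<Prod>a\<in>points k. entry g a (I a) (J a)) \<le> 1" if J: "J \<in> double_index N k" for J
      unfolding prod_norm [symmetric]
    proof (rule prod_le_1)
      fix a assume a: "a \<in> points k"
      have "norm (g $$ (I a, J a)) \<le> 1"
        by (rule unitary_entry_le_1[OF u double_index_less[OF I a] double_index_less[OF J a]])
      then show "0 \<le> norm (entry g a (I a) (J a)) \<and> norm (entry g a (I a) (J a)) \<le> 1"
        by (cases a) auto
    qed
    then show "norm (group_act N k g v I) \<le> (\<Sum>J\<in>double_index N k. norm (v J))"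
      unfolding group_act_def
      by (intro order_trans[OF norm_sum] sum_mono) (simp add: norm_mult mult_left_le_one_le)
  qed
qed

definition average :: "nat \<Rightarrow> ((point \<Rightarrow> nat) \<Rightarrow> complex) \<Rightarrow> (point \<Rightarrow> nat) \<Rightarrow> complex" where
  "average k v I = (LINT g|\<mu>. group_act N k g v I)"

lemma haar_average_eq:
  assumes I: "I \<in> double_index N k"
  shows "op_vec k (haar_average \<mu> N k T) I = average k (op_vec k T) I"
proof -
  have "op_vec k (haar_average \<mu> N k T) I = haar_average \<mu> N k T (row_index k I) (col_index k I)"
    by (rule op_vec_def)
  also have "\<dots> = average k (op_vec k T) I"
    unfolding haar_average_def average_def
    by (rule Bochner_Integration.integral_cong[OF refl], rule conjugation_eq_group_act[OF _ I])
       (use class_group_unitary space_eq in blast)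
  finally show ?thesis .
qed

text \<open>
  Left translation invariance of the measure, after the linear map given by \<open>g\<close> is taken under the
  integral.
\<close>

lemma average_invariant: "invariant_vec A N k (average k v)"
  unfolding invariant_vec_def
proof (intro ballI)
  fix g I assume g: "g \<in> G" and I: "I \<in> double_index N k"
  note c = class_group_carrier[OF g]
  have "group_act N k g (average k v) I =
      (\<Sum>J\<in>double_index N k. (LINT h|\<mu>. (\<Prod>a\<in>points k. entry g a (I a) (J a)) * group_act N k h v J))"
    unfolding group_act_def[of N k g] average_def by simp
  also have "\<dots> = (LINT h|\<mu>. group_act N k g (group_act N k h v) I)"
    unfolding group_act_def[of N k g]
    by (rule Bochner_Integration.integral_sum[symmetric])
       (intro integrable_mult_right integrable_group_act)
  also have "\<dots> = (LINT h|\<mu>. group_act N k (g * h) v I)"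
    by (rule Bochner_Integration.integral_cong[OF refl], rule group_act_mult[OF c _ I])
       (use class_group_carrier space_eq in blast)
  also have "\<dots> = (LINT h|distr \<mu> \<mu> (\<lambda>h. g * h). group_act N k h v I)"
    by (rule integral_distr[OF measurable_left_mult[OF g], symmetric])
       (rule borel_measurable_integrable[OF integrable_group_act[OF I]])
  also have "distr \<mu> \<mu> (\<lambda>h. g * h) = \<mu>"
    using haar g by (simp add: haar_prob_def)
  finally show "group_act N k g (average k v) I = average k v I"
    by (simp only: average_def[of k v I])
qed

text \<open>
  Averaging does not change moments indexed by the class, since these are pairings with invariant
  tensors.
\<close>

lemma average_pairing:
  assumes p: "p \<in> class_ptns A k"
  shows "(\<Sum>I\<in>double_index N k. average k v I * of_bool (blockconst p I)) =
    (\<Sum>I\<in>double_index N k. v I * of_bool (blockconst p I))"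
proof -
  have "(\<Sum>I\<in>double_index N k. average k v I * of_bool (blockconst p I)) =
      (\<Sum>I\<in>double_index N k. (LINT g|\<mu>. group_act N k g v I * of_bool (blockconst p I)))"
    unfolding average_def by (simp only: integral_mult_left_zero)
  also have "\<dots> = (LINT g|\<mu>. (\<Sum>I\<in>double_index N k. group_act N k g v I * of_bool (blockconst p I)))"
    by (rule Bochner_Integration.integral_sum[symmetric]) (intro integrable_mult_left integrable_group_act)
  also have "\<dots> = (LINT g|\<mu>. (\<Sum>I\<in>double_index N k. v I * of_bool (blockconst p I)))"
    by (rule Bochner_Integration.integral_cong[OF refl], rule blockconst_group_act_pairing[OF _ p])
       (use space_eq in blast)
  also have "\<dots> = (\<Sum>I\<in>double_index N k. v I * of_bool (blockconst p I))"
    by (simp add: prob_space del: sum_mult_of_bool_eq)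
  finally show ?thesis .
qed

end

section \<open>Mean moments as pairings\<close>

text \<open>
  A product of \<open>k\<close> non-negative numbers is at most the \<open>k\<close>-th power of the largest, hence at most the
  sum of the \<open>k\<close>-th powers.
\<close>

lemma integrable_prod_of_moments:
  fixes f :: "nat \<Rightarrow> 'w \<Rightarrow> complex"
  assumes "prob_space Q"
    and f: "\<And>l. l < k \<Longrightarrow> f l \<in> borel_measurable Q"
    and mom: "\<And>l n. l < k \<Longrightarrow> integrable Q (\<lambda>w. norm (f l w) ^ n)"
  shows "integrable Q (\<lambda>w. \<Prod>l<k. f l w)"
proof (cases "k = 0")
  case True
  interpret prob_space Q by fact
  show ?thesis using True by simp
next
  case False
  have bound: "norm (\<Prod>l<k. f l w) \<le> (\<Sum>l<k. norm (f l w) ^ k)" for w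
  proof -
    have ne: "{..<k} \<noteq> {}" using False by auto
    obtain l where l: "l < k" "\<And>m. m < k \<Longrightarrow> norm (f m w) \<le> norm (f l w)"
    proof -
      have "Max ((\<lambda>l. norm (f l w)) ` {..<k}) \<in> (\<lambda>l. norm (f l w)) ` {..<k}"
        using ne by (intro Max_in) auto
      then obtain l where "l < k" "Max ((\<lambda>l. norm (f l w)) ` {..<k}) = norm (f l w)" by auto
      moreover have "norm (f m w) \<le> Max ((\<lambda>l. norm (f l w)) ` {..<k})" if "m < k" for m
        using that by (intro Max_ge) auto
      ultimately show ?thesis using that by metis
    qed
    have "norm (\<Prod>l<k. f l w) \<le> (\<Prod>m<k. norm (f l w))"
      unfolding prod_norm[symmetric] by (rule prod_mono) (use l in auto)
    also have "\<dots> = norm (f l w) ^ k" by simp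
    also have "\<dots> \<le> (\<Sum>l<k. norm (f l w) ^ k)"
      using l(1) by (intro member_le_sum[where f = "\<lambda>l. norm (f l w) ^ k"]) auto
    finally show ?thesis .
  qed
  show ?thesis
  proof (rule Bochner_Integration.integrable_bound)
    show "integrable Q (\<lambda>w. \<Sum>l<k. norm (f l w) ^ k)"
      using mom by (intro Bochner_Integration.integrable_sum) auto
    show "(\<lambda>w. \<Prod>l<k. f l w) \<in> borel_measurable Q"
      using f by (intro borel_measurable_prod) auto
    show "AE w in Q. norm (\<Prod>l<k. f l w) \<le> norm (\<Sum>l<k. norm (f l w) ^ k)"
      using bound by (intro AE_I2) (simp add: order_trans[OF _ abs_ge_self])
  qed
qed

lemma integrable_tensor:
  assumes Q: "prob_space Q" and X: "\<And>X. X \<in> set Xs \<Longrightarrow> random_matrix Q N X"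
    and r: "r \<in> multi_index N (length Xs)" "c \<in> multi_index N (length Xs)"
  shows "integrable Q (\<lambda>w. tensor (map (\<lambda>X. X w) Xs) r c)"
proof -
  have rc: "r l < N" "c l < N" if "l < length Xs" for l using r that by (auto simp: multi_index_def)
  have "integrable Q (\<lambda>w. \<Prod>l<length Xs. (Xs ! l) w $$ (r l, c l))"
  proof (rule integrable_prod_of_moments[OF Q])
    fix l assume l: "l < length Xs"
    then have R: "random_matrix Q N (Xs ! l)" using X by simp
    then show "(\<lambda>w. (Xs ! l) w $$ (r l, c l)) \<in> borel_measurable Q"
      unfolding random_matrix_def
      using measurable_compose[OF _ measurable_entry_borel_mat[OF rc[OF l]]] by blast
    show "integrable Q (\<lambda>w. norm ((Xs ! l) w $$ (r l, c l)) ^ n)" for n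
      using R rc[OF l] unfolding random_matrix_def by blast
  qed
  also have "(\<lambda>w. \<Prod>l<length Xs. (Xs ! l) w $$ (r l, c l)) = (\<lambda>w. tensor (map (\<lambda>X. X w) Xs) r c)"
    by (simp add: tensor_def)
  finally show ?thesis .
qed

lemma mean_moment_eq:
  fixes Xs :: "('w \<Rightarrow> complex mat) list"
  assumes Q: "prob_space Q" and X: "\<And>X. X \<in> set Xs \<Longrightarrow> random_matrix Q N X"
    and p: "p \<in> partitions (length Xs)"
  shows "mean_moment Q N Xs p = of_nat N powi (- int (nc (pjoin (length Xs) p (id_ptn (length Xs))))) *
    (\<Sum>I\<in>double_index N (length Xs). op_vec (length Xs) (mean_tensor Q Xs) I * of_bool (blockconst p I))"
proof -
  let ?k = "length Xs"
  have "(LINT w|Q. (\<Sum>I\<in>double_index N ?k. op_vec ?k (tensor (map (\<lambda>X. X w) Xs)) I * of_bool (blockconst p I))) =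
    (\<Sum>I\<in>double_index N ?k. (LINT w|Q. op_vec ?k (tensor (map (\<lambda>X. X w) Xs)) I * of_bool (blockconst p I)))"
    by (rule Bochner_Integration.integral_sum)
       (unfold op_vec_def, intro integrable_mult_left integrable_tensor[OF Q X] row_col_in)
  also have "\<dots> = (\<Sum>I\<in>double_index N ?k. op_vec ?k (mean_tensor Q Xs) I * of_bool (blockconst p I))"
    by (simp only: integral_mult_left_zero op_vec_def mean_tensor_def)
  finally show ?thesis
    unfolding mean_moment_def Let_def op_trace_rho_transpose[OF p] by simp
qed

section \<open>The kernels expressing moments through cumulants\<close>

definition moment_kernel :: "nat \<Rightarrow> nat \<Rightarrow> ptn \<Rightarrow> ptn \<Rightarrow> complex" where
  "moment_kernel k N p q = of_nat N powi (- int (defect k q p))"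

text \<open>
  The last factor is the proportion, among the indices constant on the blocks of \<open>p\<close>, of those whose
  kernel is exactly \<open>p\<close>.
\<close>

definition excl_kernel :: "nat \<Rightarrow> nat \<Rightarrow> ptn \<Rightarrow> ptn \<Rightarrow> complex" where
  "excl_kernel k N p q = of_bool (coarser k q p) * moment_kernel k N p q *
     (of_nat (card {I \<in> double_index N k. Ker k I = p}) / of_nat N ^ nc p)"

lemma powi_neg_nat_tendsto: "(\<lambda>N. of_nat N powi (- int d) :: complex) \<longlonglongrightarrow> of_bool (d = 0)"
proof (cases "d = 0")
  case False
  have "(\<lambda>N. inverse (of_nat N) ^ d :: complex) \<longlonglongrightarrow> 0 ^ d"
    by (intro tendsto_power) (rule lim_inverse_n)
  then show ?thesis using False by (simp add: power_int_minus power_inverse power_0_left)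
qed simp

lemma moment_kernel_tendsto:
  assumes "p \<in> partitions k" "q \<in> partitions k"
  shows "(\<lambda>N. moment_kernel k N p q) \<longlonglongrightarrow> of_bool (ptn_le k q p)"
  unfolding moment_kernel_def ptn_le_iff_defect[OF assms] by (rule powi_neg_nat_tendsto)

lemma card_blockconst_double_index:
  "p \<in> partitions k \<Longrightarrow> card {I \<in> double_index N k. blockconst p I} = N ^ nc p"
  using card_blockconst[of "points k" p "{..<N}"] by (simp add: partitions_def nc_def double_index_def)

lemma card_Ker_le:
  assumes "p \<in> partitions k"
  shows "card {I \<in> double_index N k. Ker k I = p} \<le> N ^ nc p"
  unfolding card_blockconst_double_index[OF assms, symmetric]
  by (rule card_mono) (use coarser_Ker_iff[OF assms] coarser_refl[OF assms] in auto)

text \<open>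
  Among the \<open>N ^ nc p\<close> indices constant on the blocks of \<open>p\<close>, those with a strictly coarser kernel
  have at most \<open>nc p - 1\<close> values to choose, for each of finitely many kernels.
\<close>

lemma card_Ker_asymp:
  assumes p: "p \<in> partitions k"
  shows "(\<lambda>N. real (card {I \<in> double_index N k. Ker k I = p}) / real N ^ nc p) \<longlonglongrightarrow> 1"
proof -
  let ?c = "\<lambda>N q. card {I \<in> double_index N k. Ker k I = q}"
  let ?Q = "{q \<in> partitions k. coarser k p q \<and> q \<noteq> p}"
  have fQ: "finite ?Q" by simp
  \<comment> \<open>The indices constant on the blocks of \<open>p\<close>, sorted by their kernels.\<close>
  have split: "N ^ nc p = ?c N p + (\<Sum>q\<in>?Q. ?c N q)" for N
  proof -
    have "{I \<in> double_index N k. blockconst p I} = (\<Union>q\<in>insert p ?Q. {I \<in> double_index N k. Ker k I = q})"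
      using coarser_Ker_iff[OF p] coarser_refl[OF p] Ker_partition by auto
    then have "N ^ nc p = card (\<Union>q\<in>insert p ?Q. {I \<in> double_index N k. Ker k I = q})"
      using card_blockconst_double_index[OF p, of N] by simp
    also have "\<dots> = (\<Sum>q\<in>insert p ?Q. ?c N q)"
      by (rule card_UN_disjoint) auto
    finally show ?thesis by simp
  qed
  have small: "(\<lambda>N. real (?c N q) / real N ^ nc p) \<longlonglongrightarrow> 0" if q: "q \<in> ?Q" for q
  proof (rule tendsto_sandwich[OF _ _ tendsto_const lim_inverse_n])
    have "nc q < nc p" using nc_strict_mono[of k p q] q by auto
    have "real (?c N q) / real N ^ nc p \<le> inverse (real N)" if N: "N \<ge> 1" for N
    proof -
      have "real (?c N q) \<le> real N ^ nc q"
        using card_Ker_le[of q k N] q by (simp flip: of_nat_power)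
      then have "real (?c N q) * real N \<le> real N ^ nc q * real N" by (rule mult_right_mono) simp
      also have "\<dots> = real N ^ Suc (nc q)" by simp
      also have "\<dots> \<le> real N ^ nc p" using \<open>nc q < nc p\<close> N by (intro power_increasing) auto
      finally show ?thesis using N by (simp add: field_simps)
    qed
    then show "\<forall>\<^sub>F N in sequentially. real (?c N q) / real N ^ nc p \<le> inverse (real N)"
      by (rule eventually_sequentiallyI)
  qed auto
  have "(\<lambda>N. 1 - (\<Sum>q\<in>?Q. real (?c N q) / real N ^ nc p)) \<longlonglongrightarrow> 1 - (\<Sum>q\<in>?Q. 0)"
    by (intro tendsto_intros small)
  moreover have "1 - (\<Sum>q\<in>?Q. real (?c N q) / real N ^ nc p) = real (?c N p) / real N ^ nc p" if "N \<ge> 1" for N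
  proof -
    have "real N ^ nc p = real (?c N p) + (\<Sum>q\<in>?Q. real (?c N q))"
      unfolding of_nat_power[symmetric] split[of N] by simp
    moreover have "real N ^ nc p \<noteq> 0" using that by simp
    ultimately show ?thesis
      unfolding sum_divide_distrib[symmetric] by (simp add: field_simps)
  qed
  then have "\<forall>\<^sub>F N in sequentially. 1 - (\<Sum>q\<in>?Q. real (?c N q) / real N ^ nc p) = real (?c N p) / real N ^ nc p"
    by (rule eventually_sequentiallyI)
  ultimately show ?thesis
    by (simp add: Lim_transform_eventually)
qed

lemma excl_kernel_tendsto:
  assumes p: "p \<in> partitions k" and q: "q \<in> partitions k"
  shows "(\<lambda>N. excl_kernel k N p q) \<longlonglongrightarrow> of_bool (ptn_sqsup k q p)"
proof (cases "coarser k q p")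
  case True
  have "(\<lambda>N. complex_of_real (real (card {I \<in> double_index N k. Ker k I = p}) / real N ^ nc p)) \<longlonglongrightarrow> of_real 1"
    by (rule tendsto_of_real[OF card_Ker_asymp[OF p]])
  then have "(\<lambda>N. excl_kernel k N p q) \<longlonglongrightarrow> 1 * of_bool (ptn_le k q p) * 1"
    unfolding excl_kernel_def using True
    by (intro tendsto_mult moment_kernel_tendsto[OF p q]) simp_all
  then show ?thesis using ptn_sqsup_iff_defect[OF True] ptn_le_iff_defect[OF p q] by simp
next
  case False
  then show ?thesis by (simp add: excl_kernel_def ptn_sqsup_def)
qed

section \<open>Expansion of the finite-dimensional quantities\<close>

lemma power_int_combine:
  assumes "N > 0" and "(a + b + int c) = d"
  shows "of_nat N powi a * (of_nat N powi b * of_nat (N ^ c)) = (of_nat N powi d :: complex)"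
  using assms by (simp add: power_int_add flip: assms(2))

context haar_class
begin

text \<open>
  Pairing the operators of \<open>p\<close> and \<open>q\<close> counts the indices constant on the blocks of their join; with the
  normalizations, the exponents of \<open>N\<close> add up to minus the defect.
\<close>

lemma mean_moment_expansion:
  fixes Xs :: "('w \<Rightarrow> complex mat) list"
  defines "k \<equiv> length Xs"
  assumes Q: "prob_space Q" and X: "\<And>X. X \<in> set Xs \<Longrightarrow> random_matrix Q N X"
    and N: "N > 0" and p: "p \<in> class_ptns A k"
    and \<kappa>: "\<And>I. I \<in> double_index N k \<Longrightarrow> op_vec k (haar_average \<mu> N k (mean_tensor Q Xs)) I =
      (\<Sum>q\<in>class_ptns A k. \<kappa> q * of_nat N powi (int (nc (pjoin k q (id_ptn k))) - int (nc q)) *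
         of_bool (blockconst q I))"
  shows "mean_moment Q N Xs p = (\<Sum>q\<in>class_ptns A k. moment_kernel k N p q * \<kappa> q)"
proof -
  let ?S = "class_ptns A k" and ?D = "double_index N k"
  let ?w = "\<lambda>q. complex_of_nat N powi (int (nc (pjoin k q (id_ptn k))) - int (nc q))"
  have P: "q \<in> partitions k" if "q \<in> ?S" for q using that class_ptns_partitions by blast
  note Pp = P[OF p]
  have "(\<Sum>I\<in>?D. op_vec k (mean_tensor Q Xs) I * of_bool (blockconst p I)) =
      (\<Sum>I\<in>?D. average k (op_vec k (mean_tensor Q Xs)) I * of_bool (blockconst p I))"
    by (rule average_pairing[OF p, symmetric])
  also have "\<dots> = (\<Sum>I\<in>?D. op_vec k (haar_average \<mu> N k (mean_tensor Q Xs)) I * of_bool (blockconst p I))"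
    by (intro sum.cong refl) (simp only: haar_average_eq)
  also have "\<dots> = (\<Sum>I\<in>?D. \<Sum>q\<in>?S. \<kappa> q * ?w q * (of_bool (blockconst q I) * of_bool (blockconst p I)))"
    by (intro sum.cong refl) (simp only: \<kappa> sum_distrib_right mult.assoc)
  also have "\<dots> = (\<Sum>q\<in>?S. \<kappa> q * ?w q * (\<Sum>I\<in>?D. of_bool (blockconst q I) * of_bool (blockconst p I)))"
    by (subst sum.swap) (simp only: sum_distrib_left)
  also have "\<dots> = (\<Sum>q\<in>?S. \<kappa> q * ?w q * of_nat (N ^ nc (pjoin k p q)))"
  proof (intro sum.cong refl)
    fix q assume q: "q \<in> ?S"
    have "(\<Sum>I\<in>?D. of_bool (blockconst q I) * of_bool (blockconst p I)) =
        (\<Sum>I\<in>?D. if blockconst (pjoin k p q) I then 1 else (0 :: complex))"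
      by (intro sum.cong refl) (simp add: blockconst_pjoin[OF Pp P[OF q]] of_bool_def)
    also have "\<dots> = of_nat (card {I \<in> ?D. blockconst (pjoin k p q) I})"
      by (simp add: sum.If_cases Int_def)
    also have "\<dots> = of_nat (N ^ nc (pjoin k p q))"
      by (simp only: card_blockconst_double_index[OF pjoin_partitions[OF Pp P[OF q]]])
    finally show "\<kappa> q * ?w q * (\<Sum>I\<in>?D. of_bool (blockconst q I) * of_bool (blockconst p I)) =
      \<kappa> q * ?w q * of_nat (N ^ nc (pjoin k p q))" by simp
  qed
  finally have "mean_moment Q N Xs p = of_nat N powi (- int (nc (pjoin k p (id_ptn k)))) *
      (\<Sum>q\<in>?S. \<kappa> q * ?w q * of_nat (N ^ nc (pjoin k p q)))"
    using mean_moment_eq[where Q = Q and Xs = Xs and N = N and p = p] Q X Pp by (simp add: k_def)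
  also have "\<dots> = (\<Sum>q\<in>?S. moment_kernel k N p q * \<kappa> q)"
    unfolding sum_distrib_left
  proof (intro sum.cong refl)
    fix q assume q: "q \<in> ?S"
    have "of_nat N powi (- int (nc (pjoin k p (id_ptn k)))) * (?w q * of_nat (N ^ nc (pjoin k p q))) =
        moment_kernel k N p q"
      unfolding moment_kernel_def
      by (rule power_int_combine[OF N]) (use defect_eq[OF Pp P[OF q]] in simp)
    then show "of_nat N powi (- int (nc (pjoin k p (id_ptn k)))) * (\<kappa> q * ?w q * of_nat (N ^ nc (pjoin k p q))) =
        moment_kernel k N p q * \<kappa> q"
      by (metis mult.assoc mult.commute)
  qed
  finally show ?thesis .
qed

text \<open>
  Pairing the operator of \<open>q\<close> with the exclusive operator of \<open>p\<close> counts the indices with kernel \<open>p\<close>, and is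
  zero unless \<open>p\<close> is coarser than \<open>q\<close>.
\<close>

lemma fin_excl_moment_expansion:
  fixes Xs :: "('w \<Rightarrow> complex mat) list"
  defines "k \<equiv> length Xs"
  assumes N: "N > 0" and p: "p \<in> partitions k"
    and \<kappa>: "\<And>I. I \<in> double_index N k \<Longrightarrow> op_vec k (haar_average \<mu> N k (mean_tensor Q Xs)) I =
      (\<Sum>q\<in>class_ptns A k. \<kappa> q * of_nat N powi (int (nc (pjoin k q (id_ptn k))) - int (nc q)) *
         of_bool (blockconst q I))"
  shows "fin_excl_moment \<mu> Q N Xs p = (\<Sum>q\<in>class_ptns A k. excl_kernel k N p q * \<kappa> q)"
proof -
  let ?S = "class_ptns A k" and ?D = "double_index N k"
  let ?w = "\<lambda>q. complex_of_nat N powi (int (nc (pjoin k q (id_ptn k))) - int (nc q))"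
  let ?c = "card {I \<in> ?D. Ker k I = p}"
  have P: "q \<in> partitions k" if "q \<in> ?S" for q using that class_ptns_partitions by blast
  have "op_trace N k (op_mult N k (haar_average \<mu> N k (mean_tensor Q Xs)) (rho_excl N k (ptn_transpose p))) =
      (\<Sum>I\<in>?D. \<Sum>q\<in>?S. \<kappa> q * ?w q * (of_bool (blockconst q I) * of_bool (Ker k I = p)))"
    unfolding op_trace_rho_excl_transpose
    by (intro sum.cong refl) (simp only: \<kappa> sum_distrib_right mult.assoc)
  also have "\<dots> = (\<Sum>q\<in>?S. \<kappa> q * ?w q * (\<Sum>I\<in>?D. of_bool (blockconst q I) * of_bool (Ker k I = p)))"
    by (subst sum.swap) (simp only: sum_distrib_left)
  also have "\<dots> = (\<Sum>q\<in>?S. \<kappa> q * ?w q * (of_bool (coarser k q p) * of_nat ?c))"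
  proof (intro sum.cong refl)
    fix q assume q: "q \<in> ?S"
    have "(\<Sum>I\<in>?D. of_bool (blockconst q I) * of_bool (Ker k I = p)) =
        (\<Sum>I\<in>?D. of_bool (coarser k q p) * (if Ker k I = p then 1 else (0 :: complex)))"
      by (intro sum.cong refl) (auto simp: coarser_Ker_iff[OF P[OF q], symmetric] of_bool_def)
    also have "\<dots> = of_bool (coarser k q p) * of_nat ?c"
      unfolding sum_distrib_left[symmetric] by (simp add: sum.If_cases Int_def)
    finally show "\<kappa> q * ?w q * (\<Sum>I\<in>?D. of_bool (blockconst q I) * of_bool (Ker k I = p)) =
      \<kappa> q * ?w q * (of_bool (coarser k q p) * of_nat ?c)" by simp
  qed
  finally have "fin_excl_moment \<mu> Q N Xs p = of_nat N powi (- int (nc (pjoin k p (id_ptn k)))) *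
      (\<Sum>q\<in>?S. \<kappa> q * ?w q * (of_bool (coarser k q p) * of_nat ?c))"
    by (simp only: fin_excl_moment_def Let_def k_def)
  also have "\<dots> = (\<Sum>q\<in>?S. excl_kernel k N p q * \<kappa> q)"
    unfolding sum_distrib_left
  proof (intro sum.cong refl)
    fix q assume q: "q \<in> ?S"
    show "of_nat N powi (- int (nc (pjoin k p (id_ptn k)))) * (\<kappa> q * ?w q * (of_bool (coarser k q p) * of_nat ?c)) =
        excl_kernel k N p q * \<kappa> q"
    proof (cases "coarser k q p")
      case True
      have "pjoin k p q = p" using pjoin_absorb[OF True] pjoin_commute by metis
      then have "of_nat N powi (- int (nc (pjoin k p (id_ptn k)))) * (?w q * of_nat (N ^ nc p)) =
          moment_kernel k N p q"
        unfolding moment_kernel_def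
        by (intro power_int_combine[OF N]) (use defect_eq[OF p P[OF q]] in simp)
      then have "of_nat N powi (- int (nc (pjoin k p (id_ptn k)))) * ?w q = moment_kernel k N p q / of_nat N ^ nc p"
        using N by (simp add: field_simps)
      moreover have "of_nat N powi (- int (nc (pjoin k p (id_ptn k)))) * (\<kappa> q * ?w q * (of_bool (coarser k q p) * of_nat ?c)) =
          (of_nat N powi (- int (nc (pjoin k p (id_ptn k)))) * ?w q) * (of_nat ?c * \<kappa> q)"
        using True by (simp only: of_bool_eq mult_1 mult_ac)
      ultimately show ?thesis using True by (simp add: excl_kernel_def)
    qed (simp add: excl_kernel_def)
  qed
  finally show ?thesis .
qed

lemma haar_average_expansion:
  fixes Xs :: "('w \<Rightarrow> complex mat) list"
  defines "k \<equiv> length Xs"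
  assumes N: "2 * k + 2 \<le> N"
  obtains \<kappa> where "\<And>p. p \<notin> class_ptns A k \<Longrightarrow> \<kappa> p = 0"
    "\<And>I. I \<in> double_index N k \<Longrightarrow> op_vec k (haar_average \<mu> N k (mean_tensor Q Xs)) I =
      (\<Sum>q\<in>class_ptns A k. \<kappa> q * of_nat N powi (int (nc (pjoin k q (id_ptn k))) - int (nc q)) *
         of_bool (blockconst q I))"
proof -
  let ?S = "class_ptns A k"
  let ?w = "\<lambda>q. complex_of_nat N powi (int (nc (pjoin k q (id_ptn k))) - int (nc q))"
  obtain \<kappa> where \<kappa>: "\<And>I. I \<in> double_index N k \<Longrightarrow> average k (op_vec k (mean_tensor Q Xs)) I =
      (\<Sum>q\<in>?S. \<kappa> q * of_bool (blockconst q I))"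
    using invariant_vec_spanned[OF average_invariant N] by blast
  show ?thesis
  proof (rule that[of "\<lambda>q. if q \<in> ?S then \<kappa> q / ?w q else 0"])
    fix I assume I: "I \<in> double_index N k"
    show "op_vec k (haar_average \<mu> N k (mean_tensor Q Xs)) I =
      (\<Sum>q\<in>?S. (if q \<in> ?S then \<kappa> q / ?w q else 0) * ?w q * of_bool (blockconst q I))"
      unfolding haar_average_eq[OF I] \<kappa>[OF I] using N by (intro sum.cong refl) simp
  qed simp
qed

text \<open>
  Existence of the coefficients is the spanning theorem. For uniqueness, the average determines the
  mean moments of the class, and these determine the coefficients as soon as the moment kernel is
  injective.
\<close>

lemma fin_cumulant_expansion:
  fixes Xs :: "('w \<Rightarrow> complex mat) list"
  defines "k \<equiv> length Xs"
  assumes Q: "prob_space Q" and X: "\<And>X. X \<in> set Xs \<Longrightarrow> random_matrix Q N X"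
    and N: "2 * k + 2 \<le> N"
    and inj: "\<And>\<kappa>. (\<And>p. p \<in> class_ptns A k \<Longrightarrow> (\<Sum>q\<in>class_ptns A k. moment_kernel k N p q * \<kappa> q) = 0) \<Longrightarrow>
        (\<And>q. q \<in> class_ptns A k \<Longrightarrow> \<kappa> q = 0)"
    and I: "I \<in> double_index N k"
  shows "op_vec k (haar_average \<mu> N k (mean_tensor Q Xs)) I =
      (\<Sum>q\<in>class_ptns A k. fin_cumulant A \<mu> Q N Xs q *
         of_nat N powi (int (nc (pjoin k q (id_ptn k))) - int (nc q)) * of_bool (blockconst q I))"
proof -
  let ?S = "class_ptns A k"
  let ?w = "\<lambda>q. complex_of_nat N powi (int (nc (pjoin k q (id_ptn k))) - int (nc q))"
  let ?E = "haar_average \<mu> N k (mean_tensor Q Xs)"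
  let ?coord = "\<lambda>\<kappa>. \<forall>r\<in>multi_index N k. \<forall>c\<in>multi_index N k.
     ?E r c = (\<Sum>p\<in>?S. \<kappa> p * ?w p * rho N k p r c)"
  let ?vec = "\<lambda>\<kappa>. \<forall>I\<in>double_index N k. op_vec k ?E I = (\<Sum>q\<in>?S. \<kappa> q * ?w q * of_bool (blockconst q I))"
  have P: "q \<in> partitions k" if "q \<in> ?S" for q using that class_ptns_partitions by blast
  have rho: "(\<Sum>p\<in>?S. \<kappa> p * ?w p * rho N k p r c) = (\<Sum>p\<in>?S. \<kappa> p * ?w p * of_bool (blockconst p (joint k r c)))"
    if "r \<in> multi_index N k" "c \<in> multi_index N k" for \<kappa> r c
    by (intro sum.cong refl) (simp only: rho_eq[OF P that])
  have iff: "?coord \<kappa> \<longleftrightarrow> ?vec \<kappa>" for \<kappa>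
  proof
    assume c: "?coord \<kappa>"
    show "?vec \<kappa>"
    proof
      fix I assume I: "I \<in> double_index N k"
      then show "op_vec k ?E I = (\<Sum>q\<in>?S. \<kappa> q * ?w q * of_bool (blockconst q I))"
        using c row_col_in[OF I] rho[OF row_col_in[OF I], of \<kappa>] by (simp only: op_vec_def joint_row_col)
    qed
  next
    assume v: "?vec \<kappa>"
    show "?coord \<kappa>"
    proof (intro ballI)
      fix r c assume rc: "r \<in> multi_index N k" "c \<in> multi_index N k"
      have "op_vec k ?E (joint k r c) = (\<Sum>q\<in>?S. \<kappa> q * ?w q * of_bool (blockconst q (joint k r c)))"
        using v joint_in[OF rc] by blast
      then show "?E r c = (\<Sum>p\<in>?S. \<kappa> p * ?w p * rho N k p r c)"
        by (simp only: rho[OF rc] op_vec_def row_col_joint[OF rc])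
    qed
  qed
  let ?P = "\<lambda>\<kappa>. (\<forall>p. p \<notin> ?S \<longrightarrow> \<kappa> p = 0) \<and> ?coord \<kappa>"
  obtain \<kappa> where \<kappa>: "?P \<kappa>"
  proof -
    obtain \<kappa> where "\<And>p. p \<notin> ?S \<Longrightarrow> \<kappa> p = 0" and
      "\<And>I. I \<in> double_index N k \<Longrightarrow> op_vec k ?E I = (\<Sum>q\<in>?S. \<kappa> q * ?w q * of_bool (blockconst q I))"
      by (rule haar_average_expansion[of Xs Q, folded k_def, OF N]) blast
    then show ?thesis using that[of \<kappa>] unfolding iff by blast
  qed
  have "\<kappa>' = \<kappa>" if \<kappa>': "?P \<kappa>'" for \<kappa>'
  proof
    fix q
    have N0: "0 < N" using N by simp
    have "(\<Sum>q\<in>?S. moment_kernel k N p q * (\<kappa>' q - \<kappa> q)) = 0" if p: "p \<in> ?S" for p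
    proof -
      have m: "mean_moment Q N Xs p = (\<Sum>q\<in>?S. moment_kernel k N p q * f q)" if f: "?P f" for f
      proof (rule mean_moment_expansion[where Q = Q and Xs = Xs, folded k_def])
        show "op_vec k ?E I = (\<Sum>q\<in>?S. f q * ?w q * of_bool (blockconst q I))" if "I \<in> double_index N k" for I
          using f that unfolding iff by blast
      qed (use Q X N0 p in auto)
      show ?thesis using m[OF \<kappa>] m[OF \<kappa>'] by (simp add: right_diff_distrib sum_subtractf)
    qed
    then have "q \<in> ?S \<Longrightarrow> \<kappa>' q - \<kappa> q = 0" using inj[of "\<lambda>q. \<kappa>' q - \<kappa> q"] by blast
    then show "\<kappa>' q = \<kappa> q" using \<kappa> \<kappa>' by (cases "q \<in> ?S") auto
  qed
  then have "fin_cumulant A \<mu> Q N Xs = \<kappa>"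
    unfolding fin_cumulant_def Let_def k_def[symmetric]
    using \<kappa> by (intro the_equality) blast+
  then show ?thesis using \<kappa> I unfolding iff by blast
qed

end

section \<open>Convergence\<close>

text \<open>
  The limit of the moment kernel is the incidence matrix of a partial order, hence unitriangular.
\<close>

lemma eventually_kernel_injective:
  "\<forall>\<^sub>F N in sequentially. \<forall>\<kappa>.
     (\<forall>p\<in>class_ptns A k. (\<Sum>q\<in>class_ptns A k. moment_kernel k N p q * \<kappa> q) = 0) \<longrightarrow>
     (\<forall>q\<in>class_ptns A k. \<kappa> q = 0)"
proof -
  let ?S = "class_ptns A k"
  have P: "q \<in> partitions k" if "q \<in> ?S" for q using that class_ptns_partitions by blast
  obtain C where C: "C \<ge> 0" "\<forall>\<^sub>F N in sequentially. \<forall>\<kappa>.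
     (\<Sum>q\<in>?S. norm (\<kappa> q)) \<le> C * (\<Sum>p\<in>?S. norm (\<Sum>q\<in>?S. moment_kernel k N p q * \<kappa> q))"
    by (rule unitriangular_perturbation_bound[of ?S "\<lambda>p q. of_bool (ptn_le k q p)" "ptn_dist k (id_ptn k)"
          "moment_kernel k"])
       (use P ptn_le_refl ptn_le_dist_less moment_kernel_tendsto in \<open>auto split: if_splits\<close>)
  from C(2) show ?thesis
  proof eventually_elim
    case (elim N)
    show ?case
    proof (intro allI impI ballI)
      fix \<kappa> q assume z: "\<forall>p\<in>?S. (\<Sum>q\<in>?S. moment_kernel k N p q * \<kappa> q) = 0" and q: "q \<in> ?S"
      have "(\<Sum>p\<in>?S. norm (\<Sum>q\<in>?S. moment_kernel k N p q * \<kappa> q)) = 0" using z by simp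
      then have "(\<Sum>q\<in>?S. norm (\<kappa> q)) \<le> 0" using elim[rule_format, of \<kappa>] by simp
      moreover have "norm (\<kappa> q) \<le> (\<Sum>q\<in>?S. norm (\<kappa> q))"
        by (rule member_le_sum[OF q, of "\<lambda>q. norm (\<kappa> q)"]) auto
      ultimately have "norm (\<kappa> q) \<le> 0" by linarith
      then show "\<kappa> q = 0" by simp
    qed
  qed
qed

text \<open>
  The defining system of the asymptotic cumulants is unitriangular, so the definite description denotes
  its only solution.
\<close>

lemma asym_cumulant_eq:
  assumes p: "p \<in> class_ptns A (length is)"
  shows "(\<Sum>q\<in>class_ptns A (length is). of_bool (ptn_le (length is) q p) * asym_cumulant A P M is q) = lim_moment P M is p"
proof -
  let ?k = "length is"
  let ?S = "class_ptns A ?k"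
  let ?G = "\<lambda>p q. of_bool (ptn_le ?k q p) :: complex"
  have part: "q \<in> partitions ?k" if "q \<in> ?S" for q using that class_ptns_partitions by blast
  have sum_eq: "(\<Sum>p' | p' \<in> ?S \<and> ptn_le ?k p' p. \<kappa> p') = (\<Sum>q\<in>?S. ?G p q * \<kappa> q)" for p \<kappa>
    by (rule sum_filter_of_bool) simp
  note tri = finite_class_ptns[of A ?k]
  have G1: "?G p p = 1" if "p \<in> ?S" for p using ptn_le_refl[OF part[OF that]] by simp
  have G0: "ptn_dist ?k (id_ptn ?k) q < ptn_dist ?k (id_ptn ?k) p"
    if "p \<in> ?S" "q \<in> ?S" "q \<noteq> p" "?G p q \<noteq> 0" for p q
    using ptn_le_dist_less[OF part part] that by (auto split: if_splits)
  obtain \<kappa>0 where "\<forall>p\<in>?S. (\<Sum>q\<in>?S. ?G p q * \<kappa>0 q) = lim_moment P M is p"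
    using unitriangular_solvable[where G = ?G and r = "ptn_dist ?k (id_ptn ?k)", OF tri G1 G0] by blast
  define \<kappa> where "\<kappa> q = (if q \<in> ?S then \<kappa>0 q else 0)" for q
  have \<kappa>: "(\<Sum>q\<in>?S. ?G p q * \<kappa> q) = lim_moment P M is p" if "p \<in> ?S" for p
    using \<open>\<forall>p\<in>?S. (\<Sum>q\<in>?S. ?G p q * \<kappa>0 q) = lim_moment P M is p\<close> that
    by (metis (mono_tags, lifting) \<kappa>_def sum.cong)
  have "asym_cumulant A P M is = \<kappa>"
    unfolding asym_cumulant_def Let_def sum_eq
  proof (rule the_equality)
    show "(\<forall>p. p \<notin> ?S \<longrightarrow> \<kappa> p = 0) \<and> (\<forall>p\<in>?S. lim_moment P M is p = (\<Sum>q\<in>?S. ?G p q * \<kappa> q))"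
      using \<kappa> by (simp add: \<kappa>_def)
  next
    fix \<kappa>' assume \<kappa>': "(\<forall>p. p \<notin> ?S \<longrightarrow> \<kappa>' p = 0) \<and> (\<forall>p\<in>?S. lim_moment P M is p = (\<Sum>q\<in>?S. ?G p q * \<kappa>' q))"
    show "\<kappa>' = \<kappa>"
    proof
      fix q show "\<kappa>' q = \<kappa> q"
      proof (cases "q \<in> ?S")
        case True
        show ?thesis
          by (rule unitriangular_unique[where G = ?G and r = "ptn_dist ?k (id_ptn ?k)", OF tri G1 G0 _ True])
             (use \<kappa> \<kappa>' in auto)
      next
        case False
        then show ?thesis using \<kappa>' by (simp add: \<kappa>_def)
      qed
    qed
  qed
  then show ?thesis using \<kappa>[OF p] by simp
qed

lemma asym_excl_moment_eq:
  "asym_excl_moment A P M is p =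
     (\<Sum>q\<in>class_ptns A (length is). of_bool (ptn_sqsup (length is) q p) * asym_cumulant A P M is q)"
  unfolding asym_excl_moment_def Let_def by (rule sum_filter_of_bool) simp

theorem theorem4p2:
  fixes A :: ptn_class
    and P :: "nat \<Rightarrow> 'w measure"
    and M :: "nat \<Rightarrow> 'i \<Rightarrow> 'w \<Rightarrow> complex mat"
    and \<mu> :: "nat \<Rightarrow> complex mat measure"
  assumes "\<And>N. prob_space (P N)"
    and "\<And>N i. random_matrix (P N) N (M N i)"
    and "\<And>N. haar_prob N (class_group A N) (\<mu> N)"
  shows "(converges_in_distribution A P M \<longleftrightarrow>
            (\<forall>is. \<forall>p\<in>class_ptns A (length is).
               convergent (\<lambda>N. fin_cumulant A (\<mu> N) (P N) N (map (M N) is) p))) \<and>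
         (converges_in_distribution A P M \<longleftrightarrow>
            (\<forall>is. \<forall>p\<in>partitions (length is).
               convergent (\<lambda>N. fin_excl_moment (\<mu> N) (P N) N (map (M N) is) p))) \<and>
         (converges_in_distribution A P M \<longrightarrow>
            (\<forall>is. (\<forall>p\<in>class_ptns A (length is).
                     (\<lambda>N. fin_cumulant A (\<mu> N) (P N) N (map (M N) is) p)
                       \<longlonglongrightarrow> asym_cumulant A P M is p) \<and>
                  (\<forall>p\<in>partitions (length is).
                     (\<lambda>N. fin_excl_moment (\<mu> N) (P N) N (map (M N) is) p)
                       \<longlonglongrightarrow> asym_excl_moment A P M is p)))"
proof -
  define m where "m is N p = mean_moment (P N) N (map (M N) is) p" for "is" N p
  define \<kappa> where "\<kappa> is N p = fin_cumulant A (\<mu> N) (P N) N (map (M N) is) p" for "is" N p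
  define e where "e is N p = fin_excl_moment (\<mu> N) (P N) N (map (M N) is) p" for "is" N p
  let ?S = "\<lambda>is :: 'i list. class_ptns A (length is)"
  have part: "q \<in> partitions (length is)" if "q \<in> ?S is" for q and "is" :: "'i list"
    using that class_ptns_partitions by blast
  have ev: "\<forall>\<^sub>F N in sequentially.
      (\<forall>p\<in>?S is. m is N p = (\<Sum>q\<in>?S is. moment_kernel (length is) N p q * \<kappa> is N q)) \<and>
      (\<forall>p\<in>partitions (length is). e is N p = (\<Sum>q\<in>?S is. excl_kernel (length is) N p q * \<kappa> is N q))" for "is"
    using eventually_kernel_injective[of A "length is"] eventually_ge_at_top[of "2 * length is + 2"]
  proof eventually_elim
    case (elim N)
    let ?k = "length is"
    let ?Xs = "map (M N) is"
    interpret haar_class A N "\<mu> N" using assms(3) by unfold_locales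
    have X: "random_matrix (P N) N X" if "X \<in> set ?Xs" for X using that assms(2) by auto
    have N0: "0 < N" using elim(2) by simp
    have len: "length ?Xs = ?k" by simp
    have ex: "op_vec ?k (haar_average (\<mu> N) N ?k (mean_tensor (P N) ?Xs)) I =
      (\<Sum>q\<in>?S is. \<kappa> is N q * of_nat N powi (int (nc (pjoin ?k q (id_ptn ?k))) - int (nc q)) *
         of_bool (blockconst q I))" if "I \<in> double_index N ?k" for I
      unfolding \<kappa>_def
    proof (rule fin_cumulant_expansion[where Q = "P N" and Xs = ?Xs, unfolded len])
      show "\<kappa>' q = 0" if "\<And>p. p \<in> ?S is \<Longrightarrow> (\<Sum>q\<in>?S is. moment_kernel ?k N p q * \<kappa>' q) = 0" "q \<in> ?S is" for \<kappa>' q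
        using elim(1) that by blast
    qed (fact assms(1) X elim(2) that)+
    have "m is N p = (\<Sum>q\<in>?S is. moment_kernel ?k N p q * \<kappa> is N q)" if "p \<in> ?S is" for p
      unfolding m_def
      by (rule mean_moment_expansion[where Q = "P N" and Xs = ?Xs, unfolded len]) (fact assms(1) X N0 that ex)+
    moreover have "e is N p = (\<Sum>q\<in>?S is. excl_kernel ?k N p q * \<kappa> is N q)" if "p \<in> partitions ?k" for p
      unfolding e_def
      by (rule fin_excl_moment_expansion[where Q = "P N" and Xs = ?Xs, unfolded len]) (fact N0 that ex)+
    ultimately show ?case by blast
  qed
  have evm: "\<forall>\<^sub>F N in sequentially. m is N p = (\<Sum>q\<in>?S is. moment_kernel (length is) N p q * \<kappa> is N q)"
    if "p \<in> ?S is" for "is" p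
    using ev[of "is"] by eventually_elim (use that in blast)
  have eve: "\<forall>\<^sub>F N in sequentially. e is N p = (\<Sum>q\<in>?S is. excl_kernel (length is) N p q * \<kappa> is N q)"
    if "p \<in> partitions (length is)" for "is" p
    using ev[of "is"] by eventually_elim (use that in blast)
  have conv: "converges_in_distribution A P M \<longleftrightarrow> (\<forall>is. \<forall>p\<in>?S is. convergent (\<lambda>N. m is N p))"
    by (simp add: converges_in_distribution_def m_def)

  have cumulant_lim: "(\<lambda>N. \<kappa> is N q) \<longlonglongrightarrow> asym_cumulant A P M is q"
    if c: "\<forall>is. \<forall>p\<in>?S is. convergent (\<lambda>N. m is N p)" and q: "q \<in> ?S is" for "is" q
  proof (rule unitriangular_perturbation_tendsto[of "?S is" "\<lambda>p q. of_bool (ptn_le (length is) q p)"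
        "ptn_dist (length is) (id_ptn (length is))" "moment_kernel (length is)" "m is" "\<kappa> is"
        "lim_moment P M is" "asym_cumulant A P M is"])
    show "(\<lambda>N. m is N p) \<longlonglongrightarrow> lim_moment P M is p" if "p \<in> ?S is" for p
      using c that unfolding lim_moment_def m_def by (simp add: convergent_LIMSEQ_iff)
    show "ptn_dist (length is) (id_ptn (length is)) q < ptn_dist (length is) (id_ptn (length is)) p"
      if "p \<in> ?S is" "q \<in> ?S is" "q \<noteq> p" "(of_bool (ptn_le (length is) q p) :: complex) \<noteq> 0" for p q
      using ptn_le_dist_less[OF part part] that by (auto split: if_splits)
  qed (use q part ptn_le_refl moment_kernel_tendsto evm asym_cumulant_eq in auto)

  have excl_lim: "(\<lambda>N. e is N p) \<longlonglongrightarrow> (\<Sum>q\<in>?S is. of_bool (ptn_sqsup (length is) q p) * l q)"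
    if p: "p \<in> partitions (length is)" and l: "\<And>q. q \<in> ?S is \<Longrightarrow> (\<lambda>N. \<kappa> is N q) \<longlonglongrightarrow> l q" for "is" p l
  proof -
    have "(\<lambda>N. \<Sum>q\<in>?S is. excl_kernel (length is) N p q * \<kappa> is N q) \<longlonglongrightarrow>
        (\<Sum>q\<in>?S is. of_bool (ptn_sqsup (length is) q p) * l q)"
      by (intro tendsto_sum tendsto_mult excl_kernel_tendsto[OF p part] l)
    then show ?thesis
      by (rule Lim_transform_eventually) (rule eventually_mono[OF eve[OF p]], erule sym)
  qed

  have cumulant_conv: "convergent (\<lambda>N. m is N p)"
    if c: "\<forall>q\<in>?S is. convergent (\<lambda>N. \<kappa> is N q)" and p: "p \<in> ?S is" for "is" p
  proof -
    have "(\<lambda>N. \<Sum>q\<in>?S is. moment_kernel (length is) N p q * \<kappa> is N q) \<longlonglongrightarrow>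
        (\<Sum>q\<in>?S is. of_bool (ptn_le (length is) q p) * lim (\<lambda>N. \<kappa> is N q))"
      using c by (intro tendsto_sum tendsto_mult moment_kernel_tendsto part p) (auto simp: convergent_LIMSEQ_iff)
    then have "(\<lambda>N. m is N p) \<longlonglongrightarrow>
        (\<Sum>q\<in>?S is. of_bool (ptn_le (length is) q p) * lim (\<lambda>N. \<kappa> is N q))"
      by (rule Lim_transform_eventually) (rule eventually_mono[OF evm[OF p]], erule sym)
    then show ?thesis by (rule convergentI)
  qed

  \<comment> \<open>The exclusive moments of the class alone determine the cumulants: restricted to it, the limit kernel is unitriangular for refinement.\<close>
  have excl_conv: "convergent (\<lambda>N. \<kappa> is N q)"
    if c: "\<forall>p\<in>partitions (length is). convergent (\<lambda>N. e is N p)" and q: "q \<in> ?S is" for "is" q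
  proof -
    let ?G = "\<lambda>p q. of_bool (ptn_sqsup (length is) q p) :: complex"
    have G1: "?G p p = 1" if "p \<in> ?S is" for p using ptn_sqsup_refl[OF part[OF that]] by simp
    have G0: "- real (nc q) < - real (nc p)" if "p \<in> ?S is" "q \<in> ?S is" "q \<noteq> p" "?G p q \<noteq> 0" for p q
      using nc_strict_mono[of "length is" q p] that by (auto simp: ptn_sqsup_def split: if_splits)
    obtain l where l: "\<forall>p\<in>?S is. (\<Sum>q\<in>?S is. ?G p q * l q) = lim (\<lambda>N. e is N p)"
      using unitriangular_solvable[where G = ?G and r = "\<lambda>p. - real (nc p)" and m = "\<lambda>p. lim (\<lambda>N. e is N p)",
          OF finite_class_ptns G1 G0] by blast
    have "(\<lambda>N. \<kappa> is N q) \<longlonglongrightarrow> l q"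
    proof (rule unitriangular_perturbation_tendsto[where G = ?G and r = "\<lambda>p. - real (nc p)"
          and GN = "excl_kernel (length is)" and mN = "e is" and \<kappa>N = "\<kappa> is"
          and m = "\<lambda>p. lim (\<lambda>N. e is N p)" and \<kappa> = l, OF finite_class_ptns G1 G0 _ _ _ _ q])
      show "(\<lambda>N. e is N p) \<longlonglongrightarrow> lim (\<lambda>N. e is N p)" if "p \<in> ?S is" for p
        using c part[OF that] by (simp add: convergent_LIMSEQ_iff)
    qed (use part excl_kernel_tendsto eve l in auto)
    then show ?thesis by (rule convergentI)
  qed

  have 1: "converges_in_distribution A P M \<longleftrightarrow> (\<forall>is. \<forall>p\<in>?S is. convergent (\<lambda>N. \<kappa> is N p))"
    unfolding conv using cumulant_lim cumulant_conv convergentI by blast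
  have 2: "converges_in_distribution A P M \<longleftrightarrow> (\<forall>is. \<forall>p\<in>partitions (length is). convergent (\<lambda>N. e is N p))"
  proof
    assume "converges_in_distribution A P M"
    then show "\<forall>is. \<forall>p\<in>partitions (length is). convergent (\<lambda>N. e is N p)"
      unfolding conv using excl_lim[OF _ cumulant_lim] convergentI by blast
  next
    assume "\<forall>is. \<forall>p\<in>partitions (length is). convergent (\<lambda>N. e is N p)"
    then show "converges_in_distribution A P M" unfolding 1 using excl_conv by blast
  qed
  have 3: "(\<lambda>N. \<kappa> is N q) \<longlonglongrightarrow> asym_cumulant A P M is q"
    if "converges_in_distribution A P M" "q \<in> ?S is" for "is" q
    using cumulant_lim that unfolding conv by blast
  have 4: "(\<lambda>N. e is N p) \<longlonglongrightarrow> asym_excl_moment A P M is p"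
    if "converges_in_distribution A P M" "p \<in> partitions (length is)" for "is" p
    unfolding asym_excl_moment_eq by (rule excl_lim[OF that(2) 3[OF that(1)]])
  show ?thesis
    using 1 2 3 4 unfolding \<kappa>_def e_def by blast
qed

end
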